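(* Let $A \ast B$ be a free product of two freely indecomposable groups $A$ and $B$, neither of which is infinite cyclic. Then for any generic tuple $z$ of (non-zero) natural numbers the following holds: 1. If $A \ncong B$ and $C \in \{A,B\}$ is such that $C \ncong \mathbb{Z}/2$, then the homogenisation $\bar{f}^C_z$ of the code quasimorphism $f^C_z$ is an unbounded Aut-invariant quasimorphism on $A \ast B$. 2. If $A \cong B \ncong \mathbb{Z}/2$, then the sum $\bar{f}^A_z + \bar{f}^B_z$ is an unbounded Aut-invariant quasimorphism on $A \ast B$. In both cases (that is, if $A \ncong B$, or if $A \cong B \ncong \mathbb{Z}/2$) the space of homogeneous Aut-invariant quasimorphisms on $A \ast B$ that vanish on letters has infinite dimension.
   Context: A group is freely indecomposable if it is non-trivial and not isomorphic to any free product $G_1 \ast G_2$ with $G_1, G_2$ non-trivial. A map $\psi \colon G \to \mathbb{R}$ is a quasimorphism if there is $D \geq 0$ with $|\psi(g)+\psi(h)-\psi(gh)| \leq D$ for all $g,h \in G$. It is homogeneous if $\psi(g^n) = n\psi(g)$ for all $g \in G$, $n \in \mathbb{Z}$, and Aut-invariant if $\psi(\varphi(g)) = \psi(g)$ for all $g \in G$, $\varphi \in \mathrm{Aut}(G)$. The homogenisation of a quasimorphism $\psi$ is $\bar{\psi}(g) = \lim_{n \to \infty} \psi(g^n)/n$; it is a homogeneous quasimorphism. A letter of $A \ast B$ is an element lying in one of the factors $A$, $B$. Every element of $A \ast B$ has a unique reduced form: a product of non-identity letters with no two consecutive letters in the same factor. Codes: for $C \in \{A,B\}$ and $g \in A \ast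 B$, the $C$-tuple of $g$ is the (ordered) tuple of letters from $C$ appearing in the reduced form of $g$. The $C$-code of $g$ is the tuple of positive integers $(n_1,\dots,n_r)$ of lengths of the successive maximal runs of equal consecutive entries in the $C$-tuple. (E.g. if the $C$-tuple is $(a^2,a,a,a^4,a,a)$ with $a,a^2,a^4$ pairwise distinct, the $C$-code is $(1,2,1,2)$.) For a non-empty tuple $z = (n_1,\dots,n_k)$ of non-zero natural numbers, $\theta^C_z(g)$ is the maximal number of disjoint appearances of $z$ as a tuple of consecutive entries in the $C$-code of $g$. The code quasimorphism is $f^C_z \colon A \ast B \to \mathbb{Z}$, $f^C_z(g) = \theta^C_z(g) - \theta^C_z(g^{-1})$ (it is a quasimorphism). A tuple $z = (n_1,\dots,n_k)$ of non-zero natural numbers is generic if the reversed tuple $\bar{z} = (n_k,\dots,n_1)$ does not appear as a tuple of $k$ adjacent entries in $z^2 = (n_1,\dots,n_k,n_1,\dots,n_k)$. *)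

theory Defs
  imports
    Complex_Main
    "HOL-Algebra.Algebra"
    "HOL-Library.Sublist"
    "HOL-Library.Disjoint_Sets"
    "HOL-Library.Function_Algebras"
begin

section \<open>Free products of two groups\<close>

text \<open>
  Elements of the free product are represented by their reduced forms. The empty word is the
  identity; multiplication is concatenation followed by reduction.
\<close>

definition reduced_word :: "'a monoid \<Rightarrow> 'b monoid \<Rightarrow> ('a + 'b) list \<Rightarrow> bool" where
  "reduced_word A B w \<longleftrightarrow>
     set w \<subseteq> Inl ` (carrier A - {\<one>\<^bsub>A\<^esub>}) \<union> Inr ` (carrier B - {\<one>\<^bsub>B\<^esub>}) \<and>
     successively (\<lambda>x y. isl x \<noteq> isl y) w"

text \<open>Left multiplication of a reduced word by a non-identity letter.\<close>

fun fp_cons :: "'a monoid \<Rightarrow> 'b monoid \<Rightarrow> 'a + 'b \<Rightarrow> ('a + 'b) list \<Rightarrow> ('a + 'b) list" where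
  "fp_cons A B (Inl a) (Inl a' # w) =
     (if a \<otimes>\<^bsub>A\<^esub> a' = \<one>\<^bsub>A\<^esub> then w else Inl (a \<otimes>\<^bsub>A\<^esub> a') # w)"
| "fp_cons A B (Inr b) (Inr b' # w) =
     (if b \<otimes>\<^bsub>B\<^esub> b' = \<one>\<^bsub>B\<^esub> then w else Inr (b \<otimes>\<^bsub>B\<^esub> b') # w)"
| "fp_cons A B x w = x # w"

definition free_product :: "'a monoid \<Rightarrow> 'b monoid \<Rightarrow> ('a + 'b) list monoid" where
  "free_product A B =
     \<lparr>carrier = {w. reduced_word A B w}, monoid.mult = foldr (fp_cons A B), one = []\<rparr>"

definition fp_inl :: "'a monoid \<Rightarrow> 'a \<Rightarrow> ('a + 'b) list" where
  "fp_inl A a = (if a = \<one>\<^bsub>A\<^esub> then [] else [Inl a])"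

definition fp_inr :: "'b monoid \<Rightarrow> 'b \<Rightarrow> ('a + 'b) list" where
  "fp_inr B b = (if b = \<one>\<^bsub>B\<^esub> then [] else [Inr b])"

definition fp_letters :: "'a monoid \<Rightarrow> 'b monoid \<Rightarrow> ('a + 'b) list set" where
  "fp_letters A B = fp_inl A ` carrier A \<union> fp_inr B ` carrier B"

lemma reduced_word_Cons:
  "reduced_word A B (x # w) \<longleftrightarrow>
     x \<in> Inl ` (carrier A - {\<one>\<^bsub>A\<^esub>}) \<union> Inr ` (carrier B - {\<one>\<^bsub>B\<^esub>}) \<and>
     reduced_word A B w \<and> (w \<noteq> [] \<longrightarrow> isl x \<noteq> isl (hd w))"
  by (auto simp: reduced_word_def successively_Cons)

lemma reduced_word_Nil [simp]: "reduced_word A B []"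
  by (simp add: reduced_word_def)

context
  fixes A :: "'a monoid" and B :: "'b monoid"
  assumes A: "group A" and B: "group B"
begin

interpretation A: group A by (rule A)
interpretation B: group B by (rule B)

lemma reduced_fp_cons:
  assumes "x \<in> Inl ` (carrier A - {\<one>\<^bsub>A\<^esub>}) \<union> Inr ` (carrier B - {\<one>\<^bsub>B\<^esub>})" "reduced_word A B w"
  shows "reduced_word A B (fp_cons A B x w)"
proof (cases w)
  case Nil
  with assms show ?thesis by (auto simp: reduced_word_Cons)
next
  case (Cons y v)
  with assms show ?thesis
    by (cases x; cases y) (auto simp: reduced_word_Cons)
qed

lemma reduced_foldr_fp_cons:
  "reduced_word A B u \<Longrightarrow> reduced_word A B v \<Longrightarrow> reduced_word A B (foldr (fp_cons A B) u v)"
  by (induction u) (auto simp: reduced_word_Cons intro!: reduced_fp_cons)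

lemma fp_cons_Inl_Inl:
  assumes "a \<in> carrier A" "a' \<in> carrier A" "a \<noteq> \<one>\<^bsub>A\<^esub>" "a' \<noteq> \<one>\<^bsub>A\<^esub>" "reduced_word A B w"
  shows "fp_cons A B (Inl a) (fp_cons A B (Inl a') w) =
    (if a \<otimes>\<^bsub>A\<^esub> a' = \<one>\<^bsub>A\<^esub> then w else fp_cons A B (Inl (a \<otimes>\<^bsub>A\<^esub> a')) w)"
proof (cases w)
  case Nil
  with assms show ?thesis by auto
next
  case w: (Cons y v)
  show ?thesis
  proof (cases y)
    case (Inr b)
    with w assms show ?thesis by auto
  next
    case (Inl c)
    with w assms have c: "c \<in> carrier A" "c \<noteq> \<one>\<^bsub>A\<^esub>" and v: "v \<noteq> [] \<Longrightarrow> \<not> isl (hd v)"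
      by (auto simp: reduced_word_Cons)
    have e: "fp_cons A B (Inl a) v = Inl a # v"
      using v by (cases v; cases "hd v") auto
    have as: "a \<otimes>\<^bsub>A\<^esub> (a' \<otimes>\<^bsub>A\<^esub> c) = (a \<otimes>\<^bsub>A\<^esub> a') \<otimes>\<^bsub>A\<^esub> c"
      using assms c by (simp add: A.m_assoc)
    have 1: "a \<otimes>\<^bsub>A\<^esub> a' = \<one>\<^bsub>A\<^esub> \<Longrightarrow> a' \<otimes>\<^bsub>A\<^esub> c = \<one>\<^bsub>A\<^esub> \<Longrightarrow> a = c"
      using as assms c by simp
    have 3: "a \<otimes>\<^bsub>A\<^esub> a' = \<one>\<^bsub>A\<^esub> \<Longrightarrow> a \<otimes>\<^bsub>A\<^esub> (a' \<otimes>\<^bsub>A\<^esub> c) = c"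
      using as c by simp
    have 2: "a' \<otimes>\<^bsub>A\<^esub> c = \<one>\<^bsub>A\<^esub> \<Longrightarrow> (a \<otimes>\<^bsub>A\<^esub> a') \<otimes>\<^bsub>A\<^esub> c = a"
      using as assms c by simp
    show ?thesis
      using w Inl assms c e as 1 2 3 by (auto simp: A.m_assoc)
  qed
qed

lemma fp_cons_Inr_Inr:
  assumes "b \<in> carrier B" "b' \<in> carrier B" "b \<noteq> \<one>\<^bsub>B\<^esub>" "b' \<noteq> \<one>\<^bsub>B\<^esub>" "reduced_word A B w"
  shows "fp_cons A B (Inr b) (fp_cons A B (Inr b') w) =
    (if b \<otimes>\<^bsub>B\<^esub> b' = \<one>\<^bsub>B\<^esub> then w else fp_cons A B (Inr (b \<otimes>\<^bsub>B\<^esub> b')) w)"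
proof (cases w)
  case Nil
  with assms show ?thesis by auto
next
  case w: (Cons y v)
  show ?thesis
  proof (cases y)
    case (Inl b)
    with w assms show ?thesis by auto
  next
    case (Inr c)
    with w assms have c: "c \<in> carrier B" "c \<noteq> \<one>\<^bsub>B\<^esub>" and v: "v \<noteq> [] \<Longrightarrow> isl (hd v)"
      by (auto simp: reduced_word_Cons)
    have e: "fp_cons A B (Inr b) v = Inr b # v"
      using v by (cases v; cases "hd v") auto
    have as: "b \<otimes>\<^bsub>B\<^esub> (b' \<otimes>\<^bsub>B\<^esub> c) = (b \<otimes>\<^bsub>B\<^esub> b') \<otimes>\<^bsub>B\<^esub> c"
      using assms c by (simp add: B.m_assoc)
    have 1: "b \<otimes>\<^bsub>B\<^esub> b' = \<one>\<^bsub>B\<^esub> \<Longrightarrow> b' \<otimes>\<^bsub>B\<^esub> c = \<one>\<^bsub>B\<^esub> \<Longrightarrow> b = c"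
      using as assms c by simp
    have 3: "b \<otimes>\<^bsub>B\<^esub> b' = \<one>\<^bsub>B\<^esub> \<Longrightarrow> b \<otimes>\<^bsub>B\<^esub> (b' \<otimes>\<^bsub>B\<^esub> c) = c"
      using as c by simp
    have 2: "b' \<otimes>\<^bsub>B\<^esub> c = \<one>\<^bsub>B\<^esub> \<Longrightarrow> (b \<otimes>\<^bsub>B\<^esub> b') \<otimes>\<^bsub>B\<^esub> c = b"
      using as assms c by simp
    show ?thesis
      using w Inr assms c e as 1 2 3 by (auto simp: B.m_assoc)
  qed
qed

lemma foldr_fp_cons_fp_cons:
  assumes "x \<in> Inl ` (carrier A - {\<one>\<^bsub>A\<^esub>}) \<union> Inr ` (carrier B - {\<one>\<^bsub>B\<^esub>})"
    and "reduced_word A B v" "reduced_word A B w"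
  shows "foldr (fp_cons A B) (fp_cons A B x v) w = fp_cons A B x (foldr (fp_cons A B) v w)"
proof (cases v)
  case Nil
  then show ?thesis by simp
next
  case v: (Cons y u)
  have "reduced_word A B (foldr (fp_cons A B) u w)"
    using assms v by (auto simp: reduced_word_Cons intro!: reduced_foldr_fp_cons)
  then show ?thesis
    using assms v
    by (cases x; cases y) (auto simp: reduced_word_Cons fp_cons_Inl_Inl fp_cons_Inr_Inr)
qed

lemma foldr_fp_cons_assoc:
  assumes "reduced_word A B u" "reduced_word A B v" "reduced_word A B w"
  shows "foldr (fp_cons A B) (foldr (fp_cons A B) u v) w =
    foldr (fp_cons A B) u (foldr (fp_cons A B) v w)"
  using assms
  by (induction u) (auto simp: reduced_word_Cons foldr_fp_cons_fp_cons reduced_foldr_fp_cons)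

lemma foldr_fp_cons_Nil: "reduced_word A B u \<Longrightarrow> foldr (fp_cons A B) u [] = u"
proof (induction u)
  case (Cons x u)
  then show ?case
    by (cases u; cases x; cases "hd u") (auto simp: reduced_word_Cons)
qed simp

lemma fp_left_inverse:
  assumes "reduced_word A B u"
  shows "\<exists>v. reduced_word A B v \<and> foldr (fp_cons A B) v u = []"
  using assms
proof (induction u)
  case (Cons x u)
  then obtain v where v: "reduced_word A B v" "foldr (fp_cons A B) v u = []"
    by (auto simp: reduced_word_Cons)
  obtain y where y: "y \<in> Inl ` (carrier A - {\<one>\<^bsub>A\<^esub>}) \<union> Inr ` (carrier B - {\<one>\<^bsub>B\<^esub>})"
      "fp_cons A B y (x # u) = u"
  proof (cases x)
    case (Inl a)
    with Cons.prems have "a \<in> carrier A" "a \<noteq> \<one>\<^bsub>A\<^esub>"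
      by (auto simp: reduced_word_Cons)
    moreover from this have "inv\<^bsub>A\<^esub> a \<noteq> \<one>\<^bsub>A\<^esub>"
      by (metis A.inv_inv A.inv_one)
    ultimately show ?thesis
      using Inl that[of "Inl (inv\<^bsub>A\<^esub> a)"] by auto
  next
    case (Inr b)
    with Cons.prems have "b \<in> carrier B" "b \<noteq> \<one>\<^bsub>B\<^esub>"
      by (auto simp: reduced_word_Cons)
    moreover from this have "inv\<^bsub>B\<^esub> b \<noteq> \<one>\<^bsub>B\<^esub>"
      by (metis B.inv_inv B.inv_one)
    ultimately show ?thesis
      using Inr that[of "Inr (inv\<^bsub>B\<^esub> b)"] by auto
  qed
  have ry: "reduced_word A B [y]"
    using y by (simp add: reduced_word_Cons)
  have "foldr (fp_cons A B) (foldr (fp_cons A B) v [y]) (x # u) = []"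
    using foldr_fp_cons_assoc[OF v(1) ry Cons.prems] y v by simp
  then show ?case
    using reduced_foldr_fp_cons[OF v(1) ry] by blast
qed (auto intro!: exI[of _ "[]"])

lemma group_free_product: "group (free_product A B)"
proof (rule groupI)
  fix u assume "u \<in> carrier (free_product A B)"
  then show "\<exists>v\<in>carrier (free_product A B). v \<otimes>\<^bsub>free_product A B\<^esub> u = \<one>\<^bsub>free_product A B\<^esub>"
    using fp_left_inverse[of u] by (auto simp: free_product_def)
qed (auto simp: free_product_def foldr_fp_cons_assoc reduced_foldr_fp_cons)

end

text \<open>
  The factors of a free product embed into it, so every decomposition of \<open>G\<close> is isomorphic to one
  whose factors have the element type of \<open>G\<close>; quantifying over that type loses nothing.
\<close>

definition freely_indecomposable :: "'a monoid \<Rightarrow> bool" where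
  "freely_indecomposable G \<longleftrightarrow>
     carrier G \<noteq> {\<one>\<^bsub>G\<^esub>} \<and>
     \<not> (\<exists>(G1 :: 'a monoid) (G2 :: 'a monoid). group G1 \<and> group G2 \<and>
          carrier G1 \<noteq> {\<one>\<^bsub>G1\<^esub>} \<and> carrier G2 \<noteq> {\<one>\<^bsub>G2\<^esub>} \<and> G \<cong> free_product G1 G2)"


section \<open>Quasimorphisms\<close>

definition quasimorphism :: "'g monoid \<Rightarrow> ('g \<Rightarrow> real) \<Rightarrow> bool" where
  "quasimorphism G \<psi> \<longleftrightarrow>
     (\<exists>D\<ge>0. \<forall>g\<in>carrier G. \<forall>h\<in>carrier G. \<bar>\<psi> g + \<psi> h - \<psi> (g \<otimes>\<^bsub>G\<^esub> h)\<bar> \<le> D)"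

definition homogeneous :: "'g monoid \<Rightarrow> ('g \<Rightarrow> real) \<Rightarrow> bool" where
  "homogeneous G \<psi> \<longleftrightarrow> (\<forall>g\<in>carrier G. \<forall>n::int. \<psi> (g [^]\<^bsub>G\<^esub> n) = of_int n * \<psi> g)"

definition Aut_invariant :: "'g monoid \<Rightarrow> ('g \<Rightarrow> real) \<Rightarrow> bool" where
  "Aut_invariant G \<psi> \<longleftrightarrow> (\<forall>\<phi>\<in>carrier (AutoGroup G). \<forall>g\<in>carrier G. \<psi> (\<phi> g) = \<psi> g)"

definition unbounded_on_group :: "'g monoid \<Rightarrow> ('g \<Rightarrow> real) \<Rightarrow> bool" where
  "unbounded_on_group G \<psi> \<longleftrightarrow> \<not> (\<exists>M. \<forall>g\<in>carrier G. \<bar>\<psi> g\<bar> \<le> M)"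

definition homogenisation :: "'g monoid \<Rightarrow> ('g \<Rightarrow> real) \<Rightarrow> 'g \<Rightarrow> real" where
  "homogenisation G \<psi> g = lim (\<lambda>n::nat. \<psi> (g [^]\<^bsub>G\<^esub> n) / real n)"


section \<open>Codes\<close>

definition A_tuple :: "('a + 'b) list \<Rightarrow> 'a list" where
  "A_tuple w = map projl (filter isl w)"

definition B_tuple :: "('a + 'b) list \<Rightarrow> 'b list" where
  "B_tuple w = map projr (filter (\<lambda>x. \<not> isl x) w)"

function run_lengths :: "'c list \<Rightarrow> nat list" where
  "run_lengths [] = []"
| "run_lengths (x # xs) =
     Suc (length (takeWhile (\<lambda>y. y = x) xs)) # run_lengths (dropWhile (\<lambda>y. y = x) xs)"
  by pat_completeness auto
termination
  by (relation "measure length") (auto simp: less_Suc_eq_le length_dropWhile_le)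

definition A_code :: "('a + 'b) list \<Rightarrow> nat list" where
  "A_code g = run_lengths (A_tuple g)"

definition B_code :: "('a + 'b) list \<Rightarrow> nat list" where
  "B_code g = run_lengths (B_tuple g)"

definition appearances :: "nat list \<Rightarrow> nat list \<Rightarrow> nat set" where
  "appearances z c = {i. i + length z \<le> length c \<and> take (length z) (drop i c) = z}"

definition max_disjoint_appearances :: "nat list \<Rightarrow> nat list \<Rightarrow> nat" where
  "max_disjoint_appearances z c =
     Max {card I | I. I \<subseteq> appearances z c \<and> disjoint_family_on (\<lambda>i. {i..<i + length z}) I}"

text \<open>The argument \<open>code\<close> is \<^const>\<open>A_code\<close> or \<^const>\<open>B_code\<close>, and \<open>G\<close> is the free product.\<close>

definition code_quasimorphism :: "'g monoid \<Rightarrow> ('g \<Rightarrow> nat list) \<Rightarrow> nat list \<Rightarrow> 'g \<Rightarrow> int" where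
  "code_quasimorphism G code z g =
     int (max_disjoint_appearances z (code g)) -
     int (max_disjoint_appearances z (code (inv\<^bsub>G\<^esub> g)))"

definition code_homogenisation ::
    "'g monoid \<Rightarrow> ('g \<Rightarrow> nat list) \<Rightarrow> nat list \<Rightarrow> 'g \<Rightarrow> real" where
  "code_homogenisation G code z =
     homogenisation G (\<lambda>g. real_of_int (code_quasimorphism G code z g))"

definition generic :: "nat list \<Rightarrow> bool" where
  "generic z \<longleftrightarrow> z \<noteq> [] \<and> (\<forall>n\<in>set z. n \<noteq> 0) \<and> \<not> sublist (rev z) (z @ z)"


section \<open>Spaces of quasimorphisms\<close>

global_interpretation real_fun: vector_space "\<lambda>(c::real) (f::'g \<Rightarrow> real) x. c * f x"
  by unfold_locales (auto simp: fun_eq_iff algebra_simps)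

text \<open>
  Functions on \<^term>\<open>carrier G\<close> are represented by functions on the whole type that vanish outside
  the carrier. Without this condition the free values off the carrier would contribute to the
  dimension.
\<close>

definition letter_vanishing_quasimorphisms ::
    "'a monoid \<Rightarrow> 'b monoid \<Rightarrow> (('a + 'b) list \<Rightarrow> real) set" where
  "letter_vanishing_quasimorphisms A B =
     {\<psi>. quasimorphism (free_product A B) \<psi> \<and> homogeneous (free_product A B) \<psi> \<and>
         Aut_invariant (free_product A B) \<psi> \<and> (\<forall>g\<in>fp_letters A B. \<psi> g = 0) \<and>
         (\<forall>g. g \<notin> carrier (free_product A B) \<longrightarrow> \<psi> g = 0)}"

lemma subspace_letter_vanishing_quasimorphisms:
  "real_fun.subspace (letter_vanishing_quasimorphisms A B)"
proof (rule real_fun.subspaceI)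
  show "0 \<in> letter_vanishing_quasimorphisms A B"
    by (auto simp: letter_vanishing_quasimorphisms_def quasimorphism_def homogeneous_def
        Aut_invariant_def)
next
  fix f h
  assume *: "f \<in> letter_vanishing_quasimorphisms A B" "h \<in> letter_vanishing_quasimorphisms A B"
  let ?G = "free_product A B"
  obtain D E where "D \<ge> 0" "E \<ge> 0"
    and D: "\<forall>x\<in>carrier ?G. \<forall>y\<in>carrier ?G. \<bar>f x + f y - f (x \<otimes>\<^bsub>?G\<^esub> y)\<bar> \<le> D"
    and E: "\<forall>x\<in>carrier ?G. \<forall>y\<in>carrier ?G. \<bar>h x + h y - h (x \<otimes>\<^bsub>?G\<^esub> y)\<bar> \<le> E"
    using * by (auto simp: letter_vanishing_quasimorphisms_def quasimorphism_def)
  have "\<forall>x\<in>carrier ?G. \<forall>y\<in>carrier ?G.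
      \<bar>(f + h) x + (f + h) y - (f + h) (x \<otimes>\<^bsub>?G\<^esub> y)\<bar> \<le> D + E"
  proof (intro ballI)
    fix x y assume "x \<in> carrier ?G" "y \<in> carrier ?G"
    with D E have "\<bar>f x + f y - f (x \<otimes>\<^bsub>?G\<^esub> y)\<bar> \<le> D" "\<bar>h x + h y - h (x \<otimes>\<^bsub>?G\<^esub> y)\<bar> \<le> E"
      by blast+
    then show "\<bar>(f + h) x + (f + h) y - (f + h) (x \<otimes>\<^bsub>?G\<^esub> y)\<bar> \<le> D + E"
      by simp
  qed
  with \<open>D \<ge> 0\<close> \<open>E \<ge> 0\<close> have "quasimorphism ?G (f + h)"
    unfolding quasimorphism_def by (intro exI[of _ "D + E"]) auto
  with * show "f + h \<in> letter_vanishing_quasimorphisms A B"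
    by (auto simp: letter_vanishing_quasimorphisms_def homogeneous_def Aut_invariant_def
        algebra_simps)
next
  fix c f
  assume *: "f \<in> letter_vanishing_quasimorphisms A B"
  let ?G = "free_product A B"
  obtain D where "D \<ge> 0"
    and D: "\<forall>x\<in>carrier ?G. \<forall>y\<in>carrier ?G. \<bar>f x + f y - f (x \<otimes>\<^bsub>?G\<^esub> y)\<bar> \<le> D"
    using * by (auto simp: letter_vanishing_quasimorphisms_def quasimorphism_def)
  have "\<bar>c * f x + c * f y - c * f (x \<otimes>\<^bsub>?G\<^esub> y)\<bar> \<le> \<bar>c\<bar> * D"
    if "x \<in> carrier ?G" "y \<in> carrier ?G" for x y
  proof -
    have "\<bar>c * f x + c * f y - c * f (x \<otimes>\<^bsub>?G\<^esub> y)\<bar> = \<bar>c\<bar> * \<bar>f x + f y - f (x \<otimes>\<^bsub>?G\<^esub> y)\<bar>"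
      by (simp add: algebra_simps flip: abs_mult)
    with D that show ?thesis
      by (simp add: mult_left_mono)
  qed
  with \<open>D \<ge> 0\<close> have "quasimorphism ?G (\<lambda>x. c * f x)"
    unfolding quasimorphism_def by (intro exI[of _ "\<bar>c\<bar> * D"]) auto
  with * show "(\<lambda>x. c * f x) \<in> letter_vanishing_quasimorphisms A B"
    by (auto simp: letter_vanishing_quasimorphisms_def homogeneous_def Aut_invariant_def
        algebra_simps)
qed

definition infinite_dimensional :: "('g \<Rightarrow> real) set \<Rightarrow> bool" where
  "infinite_dimensional V \<longleftrightarrow> \<not> (\<exists>S. finite S \<and> S \<subseteq> V \<and> V \<subseteq> real_fun.span S)"

end

theory Submission
  imports Defs
begin

text \<open>
  If \<open>g = x s\<close> and \<open>h = s\<inverse> y\<close> with \<open>s\<close> the cancelled part, then counting appearances of \<open>z\<close> is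
  additive up to a bounded error along these pieces, and the contributions of \<open>s\<close> and \<open>s\<inverse>\<close> to the
  code quasimorphism cancel. An element whose code is \<open>z z\<close> has powers with periodic code, in which by
  genericity \<open>z\<close> is never met backwards; this gives unboundedness.

  Invariance reduces to the claim that every automorphism is, up to an inner one, a letterwise map.
  The tool is the case of the Kurosh theorem which says that a freely indecomposable subgroup \<open>H\<close>, not
  infinite cyclic, is conjugate into a factor. The edges of the Bass-Serre tree are the elements of
  \<open>A * B\<close>, and the edges between \<open>1\<close> and \<open>w\<close> are the prefixes of \<open>w\<close>. If \<open>H\<close> contains a hyperbolic
  element with axis through the edge \<open>1\<close>, then collapsing all edges outside the orbit \<open>H\<close> exhibits \<open>H\<close> as
  a free product of two non-trivial groups or as an infinite cyclic group. If no conjugate of \<open>H\<close> does,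
  then \<open>H\<close> fixes a vertex.
\<close>

section \<open>Homogenisation\<close>

text \<open>Both hypotheses on the factors exclude automorphisms that are not letterwise: an
  infinite cyclic factor with generator \<open>b\<close> allows \<open>b\<close> to be sent to
  \<open>a b\<close> with \<open>a\<close> in the other factor, and a freely decomposable factor
  allows one of its parts to be conjugated alone by the other factor. Codes ignore letterwise maps
  because they only record which consecutive letters of one side are equal; homogenisation makes
  them ignore conjugation too. The obstacle is that the Kurosh argument gives only inclusions, with
  unrelated conjugators for the two factors. Applied to the inverse automorphism it turns an
  inclusion into an equality; malnormality then sends the two factors to different sides, and
  surjectivity kills the remaining conjugator. Edge stabilisers in the tree are trivial, so after
  the collapse \<open>H\<close> acts on a tree with one free orbit of edges. One orbit of vertices
  makes \<open>H\<close> the free product of a vertex group and an infinite cyclic group; two orbits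
  make it the free product of two vertex groups. Infinite dimension comes from codes whose values on
  matching words form a diagonal matrix.\<close>

lemma quasi_additive_mult:
  fixes a :: "nat \<Rightarrow> real"
  assumes D: "\<And>m n. \<bar>a (m + n) - a m - a n\<bar> \<le> D"
  shows "\<bar>a (Suc m * n) - real (Suc m) * a n\<bar> \<le> real m * D"
proof (induction m)
  case (Suc m)
  show ?case
    using Suc D[of n "Suc m * n"] by (simp add: algebra_simps)
qed simp

text \<open>Both quotients are compared with the common value
  \<open>a (m * n) / (m * n)\<close>.\<close>

lemma quasi_additive_dist:
  fixes a :: "nat \<Rightarrow> real"
  assumes D: "\<And>m n. \<bar>a (m + n) - a m - a n\<bar> \<le> D" and "m > 0" "n > 0"
  shows "\<bar>a m / real m - a n / real n\<bar> \<le> D / real m + D / real n"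
proof -
  have D0: "D \<ge> 0"
    using D[of 0 0] by linarith
  have *: "\<bar>a (k * l) - real k * a l\<bar> \<le> real k * D" if "k > 0" for k l
    using quasi_additive_mult[of a D "k - 1" l, OF D] that D0
      mult_right_mono[of "real (k - 1)" "real k" D]
    by fastforce
  have **: "\<bar>a (k * l) / (real k * real l) - a l / real l\<bar> \<le> D / real l" if "k > 0" "l > 0" for k l
  proof -
    have "\<bar>a (k * l) / (real k * real l) - a l / real l\<bar> =
        \<bar>(a (k * l) - real k * a l) / (real k * real l)\<bar>"
      using that by (simp add: field_simps)
    also have "\<dots> = \<bar>a (k * l) - real k * a l\<bar> / (real k * real l)"
      using that by simp
    also have "\<dots> \<le> real k * D / (real k * real l)"
      using * that by (intro divide_right_mono) auto
    finally show ?thesis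
      using that by simp
  qed
  show ?thesis
    using **[of m n] **[of n m] assms(2,3) by (simp add: mult.commute)
qed

text \<open>The distance bound makes the quotients Cauchy. Letting \<open>m\<close> tend to infinity
  in it leaves \<open>D / real n\<close>, and multiplying by \<open>n\<close> gives an error that is
  uniform in \<open>n\<close>.\<close>

lemma quasi_additive_limit:
  fixes a :: "nat \<Rightarrow> real"
  assumes D: "\<And>m n. \<bar>a (m + n) - a m - a n\<bar> \<le> D"
  shows "(\<lambda>n. a n / real n) \<longlonglongrightarrow> lim (\<lambda>n. a n / real n)"
    and "\<bar>a n - real n * lim (\<lambda>n. a n / real n)\<bar> \<le> D"
proof -
  have D0: "D \<ge> 0"
    using D[of 0 0] by linarith
  have "Cauchy (\<lambda>n. a n / real n)"
  proof (rule CauchyI)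
    fix e :: real
    assume e: "e > 0"
    obtain M :: nat where M: "2 * D / e < real M"
      using reals_Archimedean2 by blast
    have M0: "M > 0"
      using M D0 e by (metis divide_nonneg_pos gr0I linorder_not_less mult_nonneg_nonneg of_nat_0 zero_le_numeral)
    have le: "D / real k < e / 2" if "k \<ge> M" for k
    proof -
      have "2 * D / e < real k"
        using M that by linarith
      then show ?thesis
        using e that M0 by (simp add: field_simps)
    qed
    show "\<exists>M. \<forall>m\<ge>M. \<forall>n\<ge>M. norm (a m / real m - a n / real n) < e"
    proof (intro exI allI impI)
      fix m n
      assume mn: "m \<ge> M" "n \<ge> M"
      then have "\<bar>a m / real m - a n / real n\<bar> \<le> D / real m + D / real n"
        using M0 by (intro quasi_additive_dist D) auto
      with le[OF mn(1)] le[OF mn(2)] show "norm (a m / real m - a n / real n) < e"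
        unfolding real_norm_def by linarith
    qed
  qed
  then show lim: "(\<lambda>n. a n / real n) \<longlonglongrightarrow> lim (\<lambda>n. a n / real n)"
    using Cauchy_convergent_iff convergent_LIMSEQ_iff by blast
  show "\<bar>a n - real n * lim (\<lambda>n. a n / real n)\<bar> \<le> D"
  \<comment> \<open>The quotient at 0 says nothing, but quasi-additivity at \<open>0\<close>,
    \<open>0\<close> bounds \<open>a 0\<close> directly.\<close>
  proof (cases "n = 0")
    case True
    then show ?thesis
      using D[of 0 0] by simp
  next
    case n: False
    let ?L = "lim (\<lambda>n. a n / real n)"
    have "(\<lambda>m. \<bar>a m / real m - a n / real n\<bar>) \<longlonglongrightarrow> \<bar>?L - a n / real n\<bar>"
      by (intro tendsto_intros lim)
    moreover have "(\<lambda>m. D / real m + D / real n) \<longlonglongrightarrow> 0 + D / real n"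
      by (intro tendsto_intros lim_const_over_n)
    moreover have "\<forall>\<^sub>F m in sequentially. \<bar>a m / real m - a n / real n\<bar> \<le> D / real m + D / real n"
      using eventually_gt_at_top[of 0]
      by eventually_elim (use quasi_additive_dist[of a D, OF D] n in auto)
    ultimately have "\<bar>?L - a n / real n\<bar> \<le> D / real n"
      using tendsto_le[OF sequentially_bot] by fastforce
    then have "real n * \<bar>?L - a n / real n\<bar> \<le> D"
      using n by (simp add: field_simps)
    moreover have "real n * \<bar>?L - a n / real n\<bar> = \<bar>real n * (?L - a n / real n)\<bar>"
      by (simp add: abs_mult)
    moreover have "real n * (?L - a n / real n) = real n * ?L - a n"
      using n by (simp add: algebra_simps)
    ultimately have "\<bar>real n * ?L - a n\<bar> \<le> D"
      by simp
    then show ?thesis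
      by (simp add: abs_minus_commute)
  qed
qed

lemma limit_linear_growth:
  fixes a :: "nat \<Rightarrow> real"
  assumes "\<And>n. \<bar>a n - real n * c\<bar> \<le> K"
  shows "lim (\<lambda>n. a n / real n) = c"
proof -
  have "(\<lambda>n. a n / real n - c) \<longlonglongrightarrow> 0"
  proof (rule tendsto_0_le)
    show "(\<lambda>n. K / real n) \<longlonglongrightarrow> 0"
      by (rule lim_const_over_n)
    show "\<forall>\<^sub>F n in sequentially. norm (a n / real n - c) \<le> norm (K / real n) * 1"
      using eventually_gt_at_top[of 0]
    proof eventually_elim
      case (elim n)
      have "a n / real n - c = (a n - real n * c) / real n"
        using elim by (simp add: field_simps)
      moreover have "K \<ge> 0"
        using assms[of 0] by linarith
      ultimately show ?case
        using assms[of n] elim by (simp add: divide_right_mono)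
    qed
  qed
  then show ?thesis
    by (intro limI) (simp add: LIM_zero_iff)
qed

section \<open>The homogenisation of a quasimorphism on a group\<close>

lemma (in group) inv_nat_pow:
  "x \<in> carrier G \<Longrightarrow> inv x [^] (n::nat) = inv (x [^] n)"
  using int_pow_inv[of x "int n"] by (simp add: int_pow_int)

context
  fixes G :: "'g monoid" (structure)
  assumes G: "group G"
begin

interpretation group G by (rule G)

text \<open>Homogenisations are identified by linear growth with bounded error, so that no limit has
  to be handled again.\<close>

lemma homogenisation_eqI:
  assumes "\<And>n. \<bar>f (g [^] n) - real n * c\<bar> \<le> K"
  shows "homogenisation G f g = c"
  unfolding homogenisation_def by (rule limit_linear_growth) (rule assms)

context
  fixes f :: "'g \<Rightarrow> real" and D :: real
  assumes D: "\<And>g h. g \<in> carrier G \<Longrightarrow> h \<in> carrier G \<Longrightarrow> \<bar>f g + f h - f (g \<otimes> h)\<bar> \<le> D"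
begin

lemma homogenisation_pow:
  assumes "g \<in> carrier G"
  shows "\<bar>f (g [^] (n::nat)) - real n * homogenisation G f g\<bar> \<le> D"
  unfolding homogenisation_def
proof (rule quasi_additive_limit(2))
  fix m n :: nat
  show "\<bar>f (g [^] (m + n)) - f (g [^] m) - f (g [^] n)\<bar> \<le> D"
    using D[of "g [^] m" "g [^] n"] assms by (simp add: nat_pow_mult)
qed

lemma homogenisation_close:
  "g \<in> carrier G \<Longrightarrow> \<bar>f g - homogenisation G f g\<bar> \<le> D"
  using homogenisation_pow[of g 1] by simp

lemma quasimorphism_homogenisation: "quasimorphism G (homogenisation G f)"
proof -
  have D0: "D \<ge> 0"
    using order_trans[OF abs_ge_zero D[OF one_closed one_closed]] .
  have "\<bar>homogenisation G f g + homogenisation G f h - homogenisation G f (g \<otimes> h)\<bar> \<le> 4 * D"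
    if "g \<in> carrier G" "h \<in> carrier G" for g h
    using D[OF that] homogenisation_close[OF that(1)] homogenisation_close[OF that(2)]
      homogenisation_close[OF m_closed[OF that]]
    by linarith
  then show ?thesis
    unfolding quasimorphism_def using D0 by (intro exI[of _ "4 * D"]) auto
qed

lemma homogenisation_nat_pow:
  assumes "g \<in> carrier G"
  shows "homogenisation G f (g [^] (k::nat)) = real k * homogenisation G f g"
proof (rule homogenisation_eqI)
  fix n
  show "\<bar>f ((g [^] k) [^] n) - real n * (real k * homogenisation G f g)\<bar> \<le> D"
    using homogenisation_pow[OF assms, of "k * n"] assms by (simp add: nat_pow_pow mult_ac)
qed

text \<open>The values at a power and at its inverse add up to the value at the identity, up to the
  defect.\<close>

lemma homogenisation_inv:
  assumes "g \<in> carrier G"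
  shows "homogenisation G f (inv g) = - homogenisation G f g"
proof (rule homogenisation_eqI)
  fix n :: nat
  have "inv g [^] n = inv (g [^] n)"
    using assms by (rule inv_nat_pow)
  then show "\<bar>f (inv g [^] n) - real n * - homogenisation G f g\<bar> \<le> 2 * D + \<bar>f \<one>\<bar>"
    using D[of "g [^] n" "inv (g [^] n)"] homogenisation_pow[OF assms, of n] assms
    by simp
qed

lemma homogeneous_homogenisation: "homogeneous G (homogenisation G f)"
  unfolding homogeneous_def
proof (intro ballI allI)
  fix g and n :: int
  assume g: "g \<in> carrier G"
  show "homogenisation G f (g [^] n) = of_int n * homogenisation G f g"
    using g by (cases n rule: int_cases2)
      (simp_all add: int_pow_int int_pow_neg_int homogenisation_nat_pow homogenisation_inv)
qed

text \<open>Powers of a conjugate are conjugates of powers by the same \<open>h\<close>, which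
  changes \<open>f\<close> by an amount independent of \<open>n\<close>. This is how inner
  automorphisms become invisible.\<close>

lemma homogenisation_conj:
  assumes g: "g \<in> carrier G" and h: "h \<in> carrier G"
  shows "homogenisation G f (h \<otimes> g \<otimes> inv h) = homogenisation G f g"
proof (rule homogenisation_eqI)
  fix n :: nat
  have p: "(h \<otimes> g \<otimes> inv h) [^] n = h \<otimes> g [^] n \<otimes> inv h"
  proof (induction n)
    case (Suc n)
    have "h \<otimes> g [^] n \<otimes> inv h \<otimes> (h \<otimes> g \<otimes> inv h) =
        h \<otimes> g [^] n \<otimes> (inv h \<otimes> h) \<otimes> g \<otimes> inv h"
      using g h by (simp only: m_assoc m_closed inv_closed nat_pow_closed)
    then show ?case
      using g h Suc by (simp add: m_assoc)
  qed (use h in simp)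
  show "\<bar>f ((h \<otimes> g \<otimes> inv h) [^] n) - real n * homogenisation G f g\<bar>
      \<le> 3 * D + \<bar>f h\<bar> + \<bar>f (inv h)\<bar>"
    unfolding p
    using D[of "h \<otimes> g [^] n" "inv h"] D[of h "g [^] n"] homogenisation_pow[OF g, of n] g h
    by simp
qed

end

end

lemma homogeneous_unbounded:
  assumes "homogeneous G \<psi>" "g \<in> carrier G" "\<psi> g \<noteq> 0" "group G"
  shows "unbounded_on_group G \<psi>"
  unfolding unbounded_on_group_def
proof
  interpret group G by fact
  assume "\<exists>M. \<forall>g\<in>carrier G. \<bar>\<psi> g\<bar> \<le> M"
  then obtain M where M: "\<And>g. g \<in> carrier G \<Longrightarrow> \<bar>\<psi> g\<bar> \<le> M"
    by blast
  obtain n :: nat where "M < real n * \<bar>\<psi> g\<bar>"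
    using reals_Archimedean3[of "\<bar>\<psi> g\<bar>"] assms(3) by auto
  moreover have "\<psi> (g [^]\<^bsub>G\<^esub> int n) = real n * \<psi> g"
    using assms(1,2) unfolding homogeneous_def by (metis of_int_of_nat_eq)
  ultimately show False
    using M[of "g [^]\<^bsub>G\<^esub> int n"] assms(2) by (simp add: abs_mult)
qed

section \<open>Run lengths and disjoint appearances\<close>

text \<open>A recursion that follows list induction, unlike the defining equation with
  \<open>dropWhile\<close>.\<close>

lemma run_lengths_Cons_Cons:
  "run_lengths (x # y # xs) =
    (if x = y then Suc (hd (run_lengths (y # xs))) # tl (run_lengths (y # xs))
     else 1 # run_lengths (y # xs))"
  by simp

text \<open>Only the last run of \<open>u\<close> and the first run of \<open>v\<close> meet; they
  either stay apart or merge into one entry.\<close>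

lemma run_lengths_append:
  obtains "run_lengths (u @ v) = run_lengths u @ run_lengths v"
  | c p q d where "run_lengths u = c @ [p]" "run_lengths v = q # d"
      "run_lengths (u @ v) = c @ (p + q) # d"
proof -
  have "run_lengths (u @ v) = run_lengths u @ run_lengths v \<or>
    (\<exists>c p q d. run_lengths u = c @ [p] \<and> run_lengths v = q # d \<and> run_lengths (u @ v) = c @ (p + q) # d)"
  proof (induction u)
    case (Cons x u)
    show ?case
    proof (cases u)
      case Nil
      show ?thesis
      proof (cases v)
        case v: (Cons y v')
        show ?thesis
        proof (cases "x = y")
          case True
          obtain q d where qd: "run_lengths v = q # d"
            using v by simp
          then have "run_lengths (x # v) = Suc q # d"
            using True unfolding v run_lengths_Cons_Cons by simp
          then have "run_lengths (x # u) = [] @ [1]" "run_lengths ((x # u) @ v) = [] @ (1 + q) # d"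
            using Nil by simp_all
          with qd show ?thesis
            by blast
        qed (use Nil v in auto)
      qed (use Nil in auto)
    next
      case u: (Cons y u')
      obtain m ms where m: "run_lengths u = m # ms"
        using u by simp
      from Cons.IH show ?thesis
      proof (elim disjE exE conjE)
        assume "run_lengths (u @ v) = run_lengths u @ run_lengths v"
        then show ?thesis
          unfolding u append_Cons run_lengths_Cons_Cons
          using m unfolding u by (auto simp del: run_lengths.simps)
      next
        fix c p q d
        assume *: "run_lengths u = c @ [p]" "run_lengths v = q # d" "run_lengths (u @ v) = c @ (p + q) # d"
        \<comment> \<open>Prepending \<open>x\<close> lengthens or adds a first run. If
          \<open>c\<close> is empty, the first run is also the last run of \<open>u\<close>, and the
          increment goes into \<open>p'\<close> instead of \<open>h\<close>.\<close>
        define h where "h = (if x = y then case c of [] \<Rightarrow> [] | e # es \<Rightarrow> Suc e # es else 1 # c)"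
        define p' where "p' = (if x = y \<and> c = [] then Suc p else p)"
        have "run_lengths (x # u) = h @ [p']" "run_lengths ((x # u) @ v) = h @ (p' + q) # d"
          using *(1,3) unfolding u append_Cons run_lengths_Cons_Cons h_def p'_def
          by (auto simp del: run_lengths.simps split: list.splits)
        then show ?thesis
          using *(2) by blast
      qed
    qed
  qed simp
  then show thesis
    using that by blast
qed

text \<open>Runs depend only on which entries are equal. Both letterwise automorphisms and the
  inversion of letters preserve codes for this reason.\<close>

lemma run_lengths_map:
  "inj_on f (set xs) \<Longrightarrow> run_lengths (map f xs) = run_lengths xs"
proof (induct xs rule: induct_list012)
  case (3 x y xs)
  then have "f x = f y \<longleftrightarrow> x = y"
    by (auto dest: inj_onD)
  moreover have "run_lengths (map f (y # xs)) = run_lengths (y # xs)"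
    using 3 by (auto simp del: run_lengths.simps intro: inj_on_subset)
  ultimately show ?case
    by (simp only: list.map run_lengths_Cons_Cons)
qed auto

section \<open>Counting disjoint appearances of a tuple\<close>

lemma finite_appearances: "finite (appearances z c)"
  by (rule finite_subset[of _ "{..length c}"]) (auto simp: appearances_def)

lemma max_disjoint_appearances_finite:
  "finite {card I | I. I \<subseteq> appearances z c \<and> disjoint_family_on (\<lambda>i. {i..<i + length z}) I}"
  by (rule finite_subset[of _ "card ` Pow (appearances z c)"])
    (auto simp: finite_appearances)

lemma card_le_max_disjoint_appearances:
  assumes "I \<subseteq> appearances z c" "disjoint_family_on (\<lambda>i. {i..<i + length z}) I"
  shows "card I \<le> max_disjoint_appearances z c"
  unfolding max_disjoint_appearances_def
  using assms by (intro Max_ge max_disjoint_appearances_finite) auto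

lemma max_disjoint_appearances_witness:
  obtains I where "I \<subseteq> appearances z c" "disjoint_family_on (\<lambda>i. {i..<i + length z}) I"
    "card I = max_disjoint_appearances z c"
proof -
  have "max_disjoint_appearances z c \<in>
      {card I | I. I \<subseteq> appearances z c \<and> disjoint_family_on (\<lambda>i. {i..<i + length z}) I}"
    unfolding max_disjoint_appearances_def
    by (rule Max_in[OF max_disjoint_appearances_finite]) (auto simp: disjoint_family_on_def)
  then show thesis
    using that by auto
qed

text \<open>A choice in \<open>d\<close>, shifted past \<open>c\<close>, is disjoint from a choice
  in \<open>c\<close>.\<close>

lemma max_disjoint_appearances_superadditive:
  assumes "z \<noteq> []"
  shows "max_disjoint_appearances z c + max_disjoint_appearances z d \<le> max_disjoint_appearances z (c @ d)"
proof -
  obtain I where I: "I \<subseteq> appearances z c" "disjoint_family_on (\<lambda>i. {i..<i + length z}) I"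
    "card I = max_disjoint_appearances z c"
    by (rule max_disjoint_appearances_witness)
  obtain J where J: "J \<subseteq> appearances z d" "disjoint_family_on (\<lambda>i. {i..<i + length z}) J"
    "card J = max_disjoint_appearances z d"
    by (rule max_disjoint_appearances_witness)
  let ?J = "(+) (length c) ` J"
  have Ic: "i + length z \<le> length c" if "i \<in> I" for i
    using I(1) that by (auto simp: appearances_def)
  have "card (I \<union> ?J) \<le> max_disjoint_appearances z (c @ d)"
  proof (rule card_le_max_disjoint_appearances)
    show "I \<union> ?J \<subseteq> appearances z (c @ d)"
      using I(1) J(1) by (fastforce simp: appearances_def)
    show "disjoint_family_on (\<lambda>i. {i..<i + length z}) (I \<union> ?J)"
      unfolding disjoint_family_on_def
    proof (intro ballI impI)
      fix i j
      assume ij: "i \<in> I \<union> ?J" "j \<in> I \<union> ?J" "i \<noteq> j"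
      consider "i \<in> I" "j \<in> I" | "i \<in> I" "j \<in> ?J" | "i \<in> ?J" "j \<in> I" | "i \<in> ?J" "j \<in> ?J"
        using ij by blast
      then show "{i..<i + length z} \<inter> {j..<j + length z} = {}"
      proof cases
        case 1
        then show ?thesis
          using I(2) ij(3) by (auto simp: disjoint_family_on_def)
      next
        case 2
        then show ?thesis
          using Ic[of i] by auto
      next
        case 3
        then show ?thesis
          using Ic[of j] by auto
      next
        case 4
        then obtain i' j' where *: "i = length c + i'" "j = length c + j'" "i' \<in> J" "j' \<in> J"
          by blast
        then have "{i'..<i' + length z} \<inter> {j'..<j' + length z} = {}"
          using J(2) ij(3) by (auto simp: disjoint_family_on_def)
        moreover have "{i..<i + length z} = (+) (length c) ` {i'..<i' + length z}"
          "{j..<j + length z} = (+) (length c) ` {j'..<j' + length z}"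
          unfolding *(1,2) by (simp_all add: ac_simps)
        ultimately show ?thesis
          by (simp flip: image_Int)
      qed
    qed
  qed
  moreover have "card (I \<union> ?J) = card I + card ?J"
  proof (rule card_Un_disjoint)
    show "finite I" "finite ?J"
      using finite_subset[OF I(1)] finite_subset[OF J(1)] finite_appearances by auto
    \<comment> \<open>Here \<open>z\<close> must be non-empty: an appearance of the empty tuple at
      \<open>length c\<close> could be chosen on both sides.\<close>
    show "I \<inter> ?J = {}"
      using Ic assms by fastforce
  qed
  moreover have "card ?J = card J"
    by (rule card_image) auto
  ultimately show ?thesis
    using I(3) J(3) by simp
qed

text \<open>All appearances that straddle the cut cover the position \<open>length c\<close>, so a
  disjoint choice has at most one of them; this is the summand 1.\<close>

lemma max_disjoint_appearances_subadditive:
  assumes "z \<noteq> []"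
  shows "max_disjoint_appearances z (c @ d) \<le>
    max_disjoint_appearances z c + max_disjoint_appearances z d + 1"
proof -
  obtain I where I: "I \<subseteq> appearances z (c @ d)" "disjoint_family_on (\<lambda>i. {i..<i + length z}) I"
    "card I = max_disjoint_appearances z (c @ d)"
    by (rule max_disjoint_appearances_witness)
  define I1 where "I1 = {i \<in> I. i + length z \<le> length c}"
  define I2 where "I2 = {i \<in> I. length c \<le> i}"
  define I3 where "I3 = {i \<in> I. i < length c \<and> length c < i + length z}"
  have fin: "finite I"
    using I(1) finite_appearances finite_subset by blast
  have "I = I1 \<union> I2 \<union> I3"
    by (auto simp: I1_def I2_def I3_def)
  then have "card I \<le> card I1 + card I2 + card I3"
    using card_Un_le[of "I1 \<union> I2" I3] card_Un_le[of I1 I2] by simp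
  moreover have "card I1 \<le> max_disjoint_appearances z c"
    using I(1,2) by (intro card_le_max_disjoint_appearances)
      (auto simp: I1_def appearances_def disjoint_family_on_def)
  moreover have "card I2 \<le> max_disjoint_appearances z d"
  proof -
    let ?J = "(\<lambda>i. i - length c) ` I2"
    have "card ?J \<le> max_disjoint_appearances z d"
    proof (rule card_le_max_disjoint_appearances)
      show "?J \<subseteq> appearances z d"
        using I(1) by (auto simp: I2_def appearances_def)
      show "disjoint_family_on (\<lambda>i. {i..<i + length z}) ?J"
        unfolding disjoint_family_on_def
      proof (intro ballI impI)
        fix i j
        assume ij: "i \<in> ?J" "j \<in> ?J" "i \<noteq> j"
        then have "i + length c \<in> I" "j + length c \<in> I"
          by (auto simp: I2_def)
        then have *: "{i + length c..<i + length c + length z} \<inter> {j + length c..<j + length c + length z} = {}"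
          using I(2) ij(3) by (auto simp: disjoint_family_on_def)
        show "{i..<i + length z} \<inter> {j..<j + length z} = {}"
        proof (rule ccontr)
          assume "\<not> ?thesis"
          then obtain m where "m \<in> {i..<i + length z} \<inter> {j..<j + length z}"
            by blast
          then have "m + length c \<in> {i + length c..<i + length c + length z} \<inter> {j + length c..<j + length c + length z}"
            by auto
          with * show False
            by blast
        qed
      qed
    qed
    moreover have "card ?J = card I2"
      by (intro card_image) (auto simp: I2_def inj_on_def)
    ultimately show ?thesis
      by simp
  qed
  moreover have "card I3 \<le> 1"
  proof -
    have "i = j" if "i \<in> I3" "j \<in> I3" for i j
    proof (rule ccontr)
      assume "i \<noteq> j"
      then have "{i..<i + length z} \<inter> {j..<j + length z} = {}"
        using I(2) that by (auto simp: disjoint_family_on_def I3_def)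
      moreover have "length c \<in> {i..<i + length z} \<inter> {j..<j + length z}"
        using that by (auto simp: I3_def)
      ultimately show False
        by blast
    qed
    then show ?thesis
      by (metis card_le_Suc0_iff_eq One_nat_def card.infinite less_eq_nat.simps(1))
  qed
  ultimately show ?thesis
    using I(3) by linarith
qed

lemma max_disjoint_appearances_singleton:
  assumes "z \<noteq> []"
  shows "max_disjoint_appearances z [n] \<le> 1"
proof -
  obtain I where I: "I \<subseteq> appearances z [n]" "card I = max_disjoint_appearances z [n]"
    by (rule max_disjoint_appearances_witness)
  have "I \<subseteq> {0}"
    using I(1) assms by (cases z) (auto simp: appearances_def)
  then show ?thesis
    using I(2) card_mono[of "{0::nat}" I] by simp
qed

lemma max_disjoint_appearances_not_sublist:
  assumes "\<not> sublist z c"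
  shows "max_disjoint_appearances z c = 0"
proof -
  have "sublist (take (length z) (drop i c)) c" for i
    by (rule sublist_order.order.trans[OF sublist_take sublist_drop])
  then have "appearances z c = {}"
    using assms unfolding appearances_def by (metis (mono_tags, lifting) Collect_empty_eq)
  then show ?thesis
    using max_disjoint_appearances_witness[of z c] by (metis card.empty subset_empty)
qed

lemma max_disjoint_appearances_concat_replicate:
  assumes "z \<noteq> []"
  shows "n \<le> max_disjoint_appearances z (concat (replicate n z))"
proof (induction n)
  case (Suc n)
  have "card {0::nat} \<le> max_disjoint_appearances z z"
    by (rule card_le_max_disjoint_appearances) (auto simp: appearances_def disjoint_family_on_def)
  then show ?case
    using Suc max_disjoint_appearances_superadditive[OF assms, of z "concat (replicate n z)"]
    by simp
qed simp

text \<open>A list no longer than one period crosses at most one boundary between periods, so two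
  periods suffice to see it.\<close>

lemma sublist_concat_replicate:
  assumes "sublist w (concat (replicate n z))" "length w \<le> length z"
  shows "sublist w (z @ z)"
  using assms(1)
proof (induction n)
  case (Suc n)
  then have "sublist w (z @ concat (replicate n z))"
    by simp
  then consider "sublist w z" | "sublist w (concat (replicate n z))"
    | w1 w2 where "w = w1 @ w2" "suffix w1 z" "prefix w2 (concat (replicate n z))"
    unfolding sublist_append by blast
  then show ?case
  proof cases
    case 1
    then show ?thesis
      by (simp add: sublist_append)
  next
    case 2
    then show ?thesis
      by (rule Suc.IH)
  next
    case 3
    have "prefix w2 z"
    proof (cases n)
      case 0
      then show ?thesis
        using 3(3) by simp
    next
      case (Suc m)
      then have "prefix w2 (z @ concat (replicate m z))"
        using 3(3) by simp
      moreover have "length w2 \<le> length z"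
        using assms(2) 3(1) by simp
      ultimately show ?thesis
        by (meson prefixI prefix_length_prefix)
    qed
    then show ?thesis
      using 3(1,2) unfolding sublist_append by blast
  qed
qed simp

text \<open>Finding \<open>z\<close> in the reversed power means finding \<open>rev z\<close> in the
  power, hence already in \<open>z @ z\<close>, which genericity forbids.\<close>

lemma generic_reverse_periodic:
  assumes "generic z"
  shows "max_disjoint_appearances z (rev (concat (replicate n z))) = 0"
proof (rule max_disjoint_appearances_not_sublist)
  show "\<not> sublist z (rev (concat (replicate n z)))"
  proof
    assume "sublist z (rev (concat (replicate n z)))"
    then have "sublist (rev z) (concat (replicate n z))"
      by (metis rev_rev_ident sublist_rev)
    then have "sublist (rev z) (z @ z)"
      by (rule sublist_concat_replicate) simp
    then show False
      using assms by (simp add: generic_def)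
  qed
qed

text \<open>Each cut of a code costs at most 1, and so does each of the runs \<open>p\<close>,
  \<open>q\<close> and \<open>p + q\<close> at the joint. The value 5 is a convenient bound for the
  total, not a sharp one.\<close>

lemma max_disjoint_appearances_run_lengths_append:
  assumes "z \<noteq> []"
  shows "\<bar>real (max_disjoint_appearances z (run_lengths (u @ v))) -
    real (max_disjoint_appearances z (run_lengths u)) -
    real (max_disjoint_appearances z (run_lengths v))\<bar> \<le> 5"
proof (rule run_lengths_append[of u v])
  let ?m = "max_disjoint_appearances z"
  have app: "?m c + ?m d \<le> ?m (c @ d)" "?m (c @ d) \<le> ?m c + ?m d + 1" for c d
    using max_disjoint_appearances_superadditive max_disjoint_appearances_subadditive assms
    by auto
  have single: "?m [n] \<le> 1" for n
    using max_disjoint_appearances_singleton[OF assms] .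
  {
    assume "run_lengths (u @ v) = run_lengths u @ run_lengths v"
    then show ?thesis
      using app[of "run_lengths u" "run_lengths v"] by simp
  next
    fix c p q d
    assume "run_lengths u = c @ [p]" "run_lengths v = q # d" "run_lengths (u @ v) = c @ (p + q) # d"
    then show ?thesis
      using app[of c "[p]"] app[of "[q]" d] app[of c "[p + q] @ d"] app[of "[p + q]" d]
        single[of p] single[of q] single[of "p + q"]
      by simp
  }
qed

section \<open>Words in a free product\<close>

text \<open>Inverting a reduced word reverses its tuple and inverts the letters, and the latter does
  not affect runs. So this is the code quasimorphism, expressed without the group.\<close>

definition code_difference :: "nat list \<Rightarrow> 'c list \<Rightarrow> real" where
  "code_difference z xs =
    real (max_disjoint_appearances z (run_lengths xs)) -
    real (max_disjoint_appearances z (run_lengths (rev xs)))"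

lemma code_difference_Nil [simp]: "code_difference z [] = 0"
  and code_difference_singleton [simp]: "code_difference z [x] = 0"
  and code_difference_rev: "code_difference z (rev xs) = - code_difference z xs"
  by (simp_all add: code_difference_def)

text \<open>The bound 5 is paid twice, for the list and for its reverse.\<close>

lemma code_difference_append:
  assumes "z \<noteq> []"
  shows "\<bar>code_difference z (u @ v) - code_difference z u - code_difference z v\<bar> \<le> 10"
  using max_disjoint_appearances_run_lengths_append[OF assms, of u v]
    max_disjoint_appearances_run_lengths_append[OF assms, of "rev v" "rev u"]
  unfolding code_difference_def rev_append by linarith

lemma code_difference_map:
  "inj_on f (set xs) \<Longrightarrow> code_difference z (map f xs) = code_difference z xs"
  using run_lengths_map[of f "rev xs"] by (simp add: code_difference_def run_lengths_map rev_map)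

text \<open>The Boolean treats the two factors uniformly, \<open>True\<close> standing for
  \<open>A\<close>; letters keep their tags so that both sides have the same type.\<close>

definition side :: "bool \<Rightarrow> ('a + 'b) list \<Rightarrow> ('a + 'b) list" where
  "side s w = filter (\<lambda>x. isl x = s) w"

definition side_code :: "bool \<Rightarrow> ('a + 'b) list \<Rightarrow> nat list" where
  "side_code s w = run_lengths (side s w)"

lemma side_Nil [simp]: "side s [] = []"
  and side_append [simp]: "side s (u @ v) = side s u @ side s v"
  by (simp_all add: side_def)

lemma A_code_eq_side_code: "A_code = side_code True"
proof
  fix w :: "('a + 'b) list"
  have "inj_on projl (set (filter isl w))"
    by (auto simp: inj_on_def intro: sum.expand)
  then show "A_code w = side_code True w"
    by (simp add: A_code_def A_tuple_def side_code_def side_def run_lengths_map)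
qed

lemma B_code_eq_side_code: "B_code = side_code False"
proof
  fix w :: "('a + 'b) list"
  have "inj_on projr (set (filter (\<lambda>x. \<not> isl x) w))"
    by (auto simp: inj_on_def intro: sum.expand)
  then show "B_code w = side_code False w"
    by (simp add: B_code_def B_tuple_def side_code_def side_def run_lengths_map)
qed

lemma (in group) mult_eq_one_iff:
  "x \<in> carrier G \<Longrightarrow> y \<in> carrier G \<Longrightarrow> x \<otimes> y = \<one> \<longleftrightarrow> y = inv x"
  using inv_equality[of x y] by auto

locale free_product_groups = A: group A + B: group B
  for A :: "'a monoid" and B :: "'b monoid"
begin

abbreviation "G \<equiv> free_product A B"
abbreviation "W \<equiv> reduced_word A B"

section \<open>Letters, inverses and products of reduced words\<close>

definition letters :: "('a + 'b) set" where
  "letters = Inl ` (carrier A - {\<one>\<^bsub>A\<^esub>}) \<union> Inr ` (carrier B - {\<one>\<^bsub>B\<^esub>})"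

fun letter_inv :: "'a + 'b \<Rightarrow> 'a + 'b" where
  "letter_inv (Inl a) = Inl (inv\<^bsub>A\<^esub> a)"
| "letter_inv (Inr b) = Inr (inv\<^bsub>B\<^esub> b)"

fun letter_mult :: "'a + 'b \<Rightarrow> 'a + 'b \<Rightarrow> 'a + 'b" where
  "letter_mult (Inl a) (Inl b) = Inl (a \<otimes>\<^bsub>A\<^esub> b)"
| "letter_mult (Inr a) (Inr b) = Inr (a \<otimes>\<^bsub>B\<^esub> b)"
| "letter_mult x y = x"

definition word_inv :: "('a + 'b) list \<Rightarrow> ('a + 'b) list" where
  "word_inv w = rev (map letter_inv w)"

sublocale group G
  by (rule group_free_product[OF A.is_group B.is_group])

lemma carrier_G [simp]: "w \<in> carrier G \<longleftrightarrow> W w"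
  and one_G [simp]: "\<one>\<^bsub>G\<^esub> = []"
  and mult_G: "u \<otimes>\<^bsub>G\<^esub> v = foldr (fp_cons A B) u v"
  by (simp_all add: free_product_def)

lemma W_Cons: "W (x # w) \<longleftrightarrow> x \<in> letters \<and> W w \<and> (w = [] \<or> isl x \<noteq> isl (hd w))"
  by (auto simp: reduced_word_Cons letters_def)

lemma W_append: "W (u @ v) \<longleftrightarrow> W u \<and> W v \<and> (u = [] \<or> v = [] \<or> isl (last u) \<noteq> isl (hd v))"
  by (auto simp: reduced_word_def successively_append_iff)

lemma letter_inv_letters [simp]: "x \<in> letters \<Longrightarrow> letter_inv x \<in> letters"
  by (auto simp: letters_def)

lemma isl_letter_inv [simp]: "isl (letter_inv x) = isl x"
  by (cases x) auto

lemma letter_inv_inv [simp]: "x \<in> letters \<Longrightarrow> letter_inv (letter_inv x) = x"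
  by (auto simp: letters_def)

lemma inj_on_letter_inv: "inj_on letter_inv letters"
  by (rule inj_on_inverseI) (rule letter_inv_inv)

lemma fp_cons_letter:
  assumes "x \<in> letters" "y \<in> letters"
  shows "isl x \<noteq> isl y \<Longrightarrow> fp_cons A B x (y # w) = x # y # w"
    and "fp_cons A B x (letter_inv x # w) = w"
    and "isl x = isl y \<Longrightarrow> y \<noteq> letter_inv x \<Longrightarrow> fp_cons A B x (y # w) = letter_mult x y # w"
  using assms by (auto simp: letters_def A.mult_eq_one_iff B.mult_eq_one_iff)

lemma letter_mult:
  assumes "x \<in> letters" "y \<in> letters" "isl x = isl y" "y \<noteq> letter_inv x"
  shows "letter_mult x y \<in> letters" "isl (letter_mult x y) = isl x"
    "letter_mult x y \<noteq> y" "letter_mult x y \<noteq> x"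
  using assms by (auto simp: letters_def A.mult_eq_one_iff B.mult_eq_one_iff)

lemma word_inv_Nil [simp]: "word_inv [] = []"
  and word_inv_append [simp]: "word_inv (u @ v) = word_inv v @ word_inv u"
  and word_inv_singleton [simp]: "word_inv [x] = [letter_inv x]"
  and length_word_inv [simp]: "length (word_inv w) = length w"
  and word_inv_eq_Nil [simp]: "word_inv w = [] \<longleftrightarrow> w = []"
  by (auto simp: word_inv_def)

lemma isl_hd_word_inv [simp]: "w \<noteq> [] \<Longrightarrow> isl (hd (word_inv w)) = isl (last w)"
  and isl_last_word_inv [simp]: "w \<noteq> [] \<Longrightarrow> isl (last (word_inv w)) = isl (hd w)"
  by (simp_all add: word_inv_def hd_rev last_rev last_map hd_map)

lemma W_letters: "W w \<Longrightarrow> set w \<subseteq> letters"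
  by (simp add: reduced_word_def letters_def)

lemma W_word_inv: "W w \<Longrightarrow> W (word_inv w)"
proof (induction w)
  case (Cons x w)
  have "word_inv (x # w) = word_inv w @ [letter_inv x]"
    by (simp add: word_inv_def)
  with Cons show ?case
    by (auto simp: W_Cons W_append)
qed simp

lemma word_inv_inv: "W w \<Longrightarrow> word_inv (word_inv w) = w"
  using W_letters[of w] by (auto simp: word_inv_def rev_map intro!: map_idI)

lemma mult_append: "W (u @ v) \<Longrightarrow> u \<otimes>\<^bsub>G\<^esub> v = u @ v"
  using foldr_fp_cons_Nil[OF A.is_group B.is_group, of "u @ v"]
    foldr_fp_cons_Nil[OF A.is_group B.is_group, of v]
  by (simp add: mult_G W_append)

lemma mult_Nil_left [simp]: "[] \<otimes>\<^bsub>G\<^esub> v = v"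
  by (simp add: mult_G)

lemma mult_Nil_right [simp]: "W u \<Longrightarrow> u \<otimes>\<^bsub>G\<^esub> [] = u"
  using mult_append[of u "[]"] by simp

lemma W_mult [simp]: "W u \<Longrightarrow> W v \<Longrightarrow> W (u \<otimes>\<^bsub>G\<^esub> v)"
  using m_closed[of u v] by simp

lemma W_inv [simp]: "W u \<Longrightarrow> W (inv\<^bsub>G\<^esub> u)"
  using inv_closed[of u] by simp

lemma W_pow [simp]: "W u \<Longrightarrow> W (u [^]\<^bsub>G\<^esub> (n::nat))"
  using nat_pow_closed[of u n] by simp

lemma inv_G:
  assumes "W w"
  shows "inv\<^bsub>G\<^esub> w = word_inv w"
proof (rule inv_equality)
  show "word_inv w \<otimes>\<^bsub>G\<^esub> w = \<one>\<^bsub>G\<^esub>"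
    using assms
  proof (induction w)
    case (Cons x w)
    then have "word_inv (x # w) = word_inv w @ [letter_inv x]"
      by (simp add: word_inv_def)
    moreover have "fp_cons A B (letter_inv x) (x # w) = w"
      using Cons.prems fp_cons_letter(2)[of "letter_inv x" x w] by (simp add: W_Cons)
    ultimately show ?case
      using Cons by (simp add: mult_G W_Cons)
  qed (simp add: mult_G)
qed (use assms W_word_inv in auto)

text \<open>Cancellation removes a part \<open>s\<close>. It stops either where the remaining words
  concatenate to a reduced word or at two letters of one factor whose product is not the identity;
  this product is then a single letter, and no further reduction occurs.\<close>

lemma mult_cases:
  assumes "W u" "W v"
  obtains (cancel) x s y where "u = x @ s" "v = word_inv s @ y" "W (x @ y)" "u \<otimes>\<^bsub>G\<^esub> v = x @ y"
  | (merge) x s y p q where "u = x @ [p] @ s" "v = word_inv s @ [q] @ y" "isl p = isl q"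
      "q \<noteq> letter_inv p" "W (x @ [letter_mult p q] @ y)" "u \<otimes>\<^bsub>G\<^esub> v = x @ [letter_mult p q] @ y"
proof -
  have "(\<exists>x s y. u = x @ s \<and> v = word_inv s @ y \<and> W (x @ y) \<and> u \<otimes>\<^bsub>G\<^esub> v = x @ y) \<or>
    (\<exists>x s y p q. u = x @ [p] @ s \<and> v = word_inv s @ [q] @ y \<and> isl p = isl q \<and> q \<noteq> letter_inv p \<and>
      W (x @ [letter_mult p q] @ y) \<and> u \<otimes>\<^bsub>G\<^esub> v = x @ [letter_mult p q] @ y)"
    (is "?C u v \<or> ?M u v")
    using assms
  proof (induction u arbitrary: v rule: rev_induct)
    case Nil
    then have "?C [] v"
      by (intro exI[of _ "[]"] exI[of _ v]) (simp add: mult_G)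
    then show ?case ..
  next
    case (snoc p u)
    show ?case
    proof (cases v)
      case Nil
      then have "?C (u @ [p]) v"
        using snoc.prems mult_append[of "u @ [p]" "[]"] by (intro exI[of _ "u @ [p]"] exI[of _ "[]"]) simp
      then show ?thesis ..
    next
      case v: (Cons q v')
      have L: "p \<in> letters" "q \<in> letters"
        using snoc.prems v by (auto simp: W_append W_Cons)
      consider "isl p \<noteq> isl q" | "q = letter_inv p" | "isl p = isl q" "q \<noteq> letter_inv p"
        by blast
      then show ?thesis
      proof cases
        case 1
        then have "W ((u @ [p]) @ v)"
          using snoc.prems v by (auto simp: W_append W_Cons)
        then have "?C (u @ [p]) v"
          using mult_append by (intro exI[of _ "u @ [p]"] exI[of _ "[]"] exI[of _ v]) simp
        then show ?thesis ..
      next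
        case 2
        have e: "(u @ [p]) \<otimes>\<^bsub>G\<^esub> v = u \<otimes>\<^bsub>G\<^esub> v'"
          using fp_cons_letter(2)[OF L(1,1)] v 2 by (simp add: mult_G)
        \<comment> \<open>The pair \<open>p\<close>, \<open>q\<close> disappears, so the
          decomposition of the shorter product is reused with \<open>p\<close> appended to the
          cancelled part.\<close>
        have "?C u v' \<or> ?M u v'"
          using snoc v by (auto simp: W_append W_Cons)
        then show ?thesis
        proof
          assume "?C u v'"
          then obtain x s y where "u = x @ s" "v' = word_inv s @ y" "W (x @ y)" "u \<otimes>\<^bsub>G\<^esub> v' = x @ y"
            by blast
          then have "?C (u @ [p]) v"
            using e v 2 by (intro exI[of _ x] exI[of _ "s @ [p]"] exI[of _ y]) simp
          then show ?thesis ..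
        next
          assume "?M u v'"
          then obtain x s y p' q' where "u = x @ [p'] @ s" "v' = word_inv s @ [q'] @ y" "isl p' = isl q'"
            "q' \<noteq> letter_inv p'" "W (x @ [letter_mult p' q'] @ y)"
            "u \<otimes>\<^bsub>G\<^esub> v' = x @ [letter_mult p' q'] @ y"
            by blast
          then have "?M (u @ [p]) v"
            using e v 2
            by (intro exI[of _ x] exI[of _ "s @ [p]"] exI[of _ y] exI[of _ p'] exI[of _ q']) simp
          then show ?thesis ..
        qed
      next
        case 3
        have w: "W (u @ [letter_mult p q] @ v')"
          using snoc.prems v 3 letter_mult[OF L 3] by (auto simp: W_append W_Cons)
        have "(u @ [p]) \<otimes>\<^bsub>G\<^esub> v = u \<otimes>\<^bsub>G\<^esub> (letter_mult p q # v')"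
          using fp_cons_letter(3)[OF L 3] v by (simp add: mult_G)
        also have "\<dots> = u @ [letter_mult p q] @ v'"
          using mult_append[of u "letter_mult p q # v'"] w by simp
        finally have "?M (u @ [p]) v"
          using w v 3
          by (intro exI[of _ u] exI[of _ "[]"] exI[of _ v'] exI[of _ p] exI[of _ q]) simp
        then show ?thesis ..
      qed
    qed
  qed
  then show thesis
    using cancel merge by blast
qed

lemma side_word_inv: "side s (word_inv w) = map letter_inv (rev (side s w))"
  by (induction w) (auto simp: side_def word_inv_def)

lemma set_side: "set (side s w) \<subseteq> set w"
  by (auto simp: side_def)

text \<open>The inversion of letters is injective and hence harmless; only the reversal of the tuple
  remains.\<close>

lemma code_difference_word_inv:
  assumes "W w"
  shows "code_difference z (side s (word_inv w)) = - code_difference z (side s w)"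
proof -
  have "inj_on letter_inv (set (rev (side s w)))"
    using inj_on_subset[OF inj_on_letter_inv] W_letters[OF assms] set_side[of s w]
    by (metis set_rev subset_trans)
  then show ?thesis
    by (simp add: side_word_inv code_difference_map code_difference_rev)
qed

lemma code_quasimorphism_eq:
  assumes "W w"
  shows "real_of_int (code_quasimorphism G (side_code s) z w) = code_difference z (side s w)"
proof -
  have "inj_on letter_inv (set (rev (side s w)))"
    using inj_on_subset[OF inj_on_letter_inv] W_letters[OF assms] set_side[of s w]
    by (metis set_rev subset_trans)
  then show ?thesis
    using assms by (simp add: code_quasimorphism_def side_code_def code_difference_def inv_G
        side_word_inv run_lengths_map)
qed

text \<open>The cancelled part \<open>r\<close> occurs in \<open>u\<close> and inverted in
  \<open>v\<close>, and its two contributions cancel. In the merging case \<open>u\<close>,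
  \<open>v\<close> and the product are each cut twice, at cost 10 per cut, and single letters
  contribute 0; this gives 60.\<close>

lemma code_difference_quasi:
  assumes "z \<noteq> []" "W u" "W v"
  shows "\<bar>code_difference z (side s u) + code_difference z (side s v) -
    code_difference z (side s (u \<otimes>\<^bsub>G\<^esub> v))\<bar> \<le> 60"
proof -
  let ?d = "code_difference z :: ('a + 'b) list \<Rightarrow> real"
  have app: "\<bar>?d (side s (u @ v)) - ?d (side s u) - ?d (side s v)\<bar> \<le> 10" for u v
    using code_difference_append[OF assms(1)] by simp
  have single: "?d (side s [x]) = 0" for x
    by (simp add: side_def)
  from assms(2,3) show ?thesis
  proof (cases rule: mult_cases)
    case (cancel x r y)
    have "?d (side s (word_inv r)) = - ?d (side s r)"
      using assms(2) cancel(1) by (intro code_difference_word_inv) (simp add: W_append)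
    then show ?thesis
      using app[of x r] app[of "word_inv r" y] app[of x y]
      unfolding cancel(4) unfolding cancel(1,2) by linarith
  next
    case (merge x r y p q)
    have "?d (side s (word_inv r)) = - ?d (side s r)"
      using assms(2) merge(1) by (intro code_difference_word_inv) (simp add: W_append W_Cons)
    then show ?thesis
      using app[of x "[p] @ r"] app[of "[p]" r] app[of "word_inv r" "[q] @ y"] app[of "[q]" y]
        app[of x "[letter_mult p q] @ y"] app[of "[letter_mult p q]" y]
        single[of p] single[of q] single[of "letter_mult p q"]
      unfolding merge(6) unfolding merge(1,2) by linarith
  qed
qed

abbreviation "code_limit s z \<equiv> code_homogenisation G (side_code s) z"

lemma code_quasimorphism_defect:
  assumes "z \<noteq> []" "u \<in> carrier G" "v \<in> carrier G"
  shows "\<bar>real_of_int (code_quasimorphism G (side_code s) z u) +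
    real_of_int (code_quasimorphism G (side_code s) z v) -
    real_of_int (code_quasimorphism G (side_code s) z (u \<otimes>\<^bsub>G\<^esub> v))\<bar> \<le> 60"
  using code_difference_quasi[of z u v s] assms m_closed[of u v] by (simp add: code_quasimorphism_eq)

lemma quasimorphism_code_limit: "z \<noteq> [] \<Longrightarrow> quasimorphism G (code_limit s z)"
  unfolding code_homogenisation_def
  by (rule quasimorphism_homogenisation[OF is_group code_quasimorphism_defect])

lemma homogeneous_code_limit: "z \<noteq> [] \<Longrightarrow> homogeneous G (code_limit s z)"
  unfolding code_homogenisation_def
  by (rule homogeneous_homogenisation[OF is_group code_quasimorphism_defect])

lemma code_limit_conjugate:
  "z \<noteq> [] \<Longrightarrow> W g \<Longrightarrow> W h \<Longrightarrow> code_limit s z (h \<otimes>\<^bsub>G\<^esub> g \<otimes>\<^bsub>G\<^esub> inv\<^bsub>G\<^esub> h) = code_limit s z g"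
  unfolding code_homogenisation_def
  by (rule homogenisation_conj[OF is_group code_quasimorphism_defect]) auto

lemma code_limit_eqI:
  assumes "W g" "\<And>n::nat. \<bar>code_difference z (side s (g [^]\<^bsub>G\<^esub> n)) - real n * c\<bar> \<le> K"
  shows "code_limit s z g = c"
  unfolding code_homogenisation_def
proof (rule homogenisation_eqI[OF is_group])
  fix n :: nat
  show "\<bar>real_of_int (code_quasimorphism G (side_code s) z (g [^]\<^bsub>G\<^esub> n)) - real n * c\<bar> \<le> K"
    using assms by (simp add: code_quasimorphism_eq)
qed

end

section \<open>Recognising free products\<close>

fun word_eval :: "'k monoid \<Rightarrow> ('k + 'k) list \<Rightarrow> 'k" where
  "word_eval K [] = \<one>\<^bsub>K\<^esub>"
| "word_eval K (x # w) = case_sum id id x \<otimes>\<^bsub>K\<^esub> word_eval K w"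

text \<open>By induction a non-empty reduced word is evaluated into the set given by its first
  letter, hence not to the identity; \<open>gen\<close> gives surjectivity. Keeping the identity
  outside both sets replaces the usual requirement that one of the groups has more than two
  elements.\<close>

lemma ping_pong_free_product:
  fixes K :: "'k monoid" (structure)
  assumes K: "group K" and H1: "subgroup H1 K" and H2: "subgroup H2 K"
    and X1: "\<And>h. h \<in> H1 \<Longrightarrow> h \<noteq> \<one> \<Longrightarrow> h \<in> X1"
    and X2: "\<And>h. h \<in> H2 \<Longrightarrow> h \<noteq> \<one> \<Longrightarrow> h \<in> X2"
    and X12: "\<And>h x. h \<in> H1 \<Longrightarrow> h \<noteq> \<one> \<Longrightarrow> x \<in> X2 \<Longrightarrow> h \<otimes> x \<in> X1"
    and X21: "\<And>h x. h \<in> H2 \<Longrightarrow> h \<noteq> \<one> \<Longrightarrow> x \<in> X1 \<Longrightarrow> h \<otimes> x \<in> X2"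
    and one: "\<one> \<notin> X1" "\<one> \<notin> X2"
    and gen: "carrier K \<subseteq> generate K (H1 \<union> H2)"
  shows "K \<cong> free_product (K\<lparr>carrier := H1\<rparr>) (K\<lparr>carrier := H2\<rparr>)"
proof -
  interpret K: group K by (rule K)
  interpret P: free_product_groups "K\<lparr>carrier := H1\<rparr>" "K\<lparr>carrier := H2\<rparr>"
    using H1 H2 K by (intro free_product_groups.intro subgroup.subgroup_is_group)
  let ?e = "word_eval K"
  have letter: "case_sum id id x \<in> carrier K" if "x \<in> P.letters" for x
    using that subgroup.subset[OF H1] subgroup.subset[OF H2] by (auto simp: P.letters_def)
  have closed: "?e w \<in> carrier K" if "P.W w" for w
    using that by (induction w) (auto simp: P.W_Cons letter)
  have cons: "?e (fp_cons (K\<lparr>carrier := H1\<rparr>) (K\<lparr>carrier := H2\<rparr>) x w) = case_sum id id x \<otimes> ?e w"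
    if "x \<in> P.letters" "P.W w" for x w
  proof (cases w)
    case (Cons y v)
    have "case_sum id id x \<in> carrier K" "case_sum id id y \<in> carrier K" "?e v \<in> carrier K"
      using letter that closed Cons by (auto simp: P.W_Cons)
    then show ?thesis
      using Cons by (cases x; cases y) (auto simp flip: K.m_assoc)
  qed simp
  have mult: "?e (u \<otimes>\<^bsub>P.G\<^esub> v) = ?e u \<otimes> ?e v" if "P.W u" "P.W v" for u v
    using that(1)
  proof (induction u)
    case Nil
    then show ?case
      using closed[OF that(2)] by (simp add: P.mult_G)
  next
    case (Cons x u)
    have "P.W (u \<otimes>\<^bsub>P.G\<^esub> v)"
      using P.m_closed[of u v] Cons.prems that(2) by (simp add: P.W_Cons)
    then show ?case
      using Cons cons[of x "u \<otimes>\<^bsub>P.G\<^esub> v"] letter[of x] closed that(2)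
      by (simp add: P.mult_G P.W_Cons K.m_assoc)
  qed
  interpret e: group_hom P.G K ?e
    using closed mult by (intro group_hom.intro group_hom_axioms.intro homI K P.is_group) auto
  have "w \<noteq> [] \<Longrightarrow> P.W w \<Longrightarrow> ?e w \<in> (if isl (hd w) then X1 else X2)" for w
  proof (induction w)
    case (Cons x w)
    show ?case
    proof (cases "w = []")
      case True
      then show ?thesis
        using Cons.prems X1 X2 letter[of x] by (auto simp: P.W_Cons P.letters_def)
    next
      case False
      then show ?thesis
        using Cons X12 X21 by (cases x) (auto simp: P.W_Cons P.letters_def)
    qed
  qed simp
  then have "w = []" if "P.W w" "?e w = \<one>" for w
    using that one by (metis (full_types))
  then have inj: "inj_on ?e (carrier P.G)"
    by (subst e.inj_on_one_iff) auto
  have "carrier K \<subseteq> ?e ` carrier P.G"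
  proof -
    have "h \<in> ?e ` carrier P.G" if h: "h \<in> H1 \<union> H2" for h
    proof -
      consider "h = \<one>" | "h \<in> H1" "h \<noteq> \<one>" | "h \<in> H2" "h \<noteq> \<one>"
        using h by blast
      then show ?thesis
      proof cases
        case 1
        then show ?thesis
          by (intro image_eqI[of _ _ "[]"]) auto
      next
        case 2
        then show ?thesis
          using subgroup.mem_carrier[OF H1]
          by (intro image_eqI[of _ _ "[Inl h]"]) (auto simp: P.W_Cons P.letters_def)
      next
        case 3
        then show ?thesis
          using subgroup.mem_carrier[OF H2]
          by (intro image_eqI[of _ _ "[Inr h]"]) (auto simp: P.W_Cons P.letters_def)
      qed
    qed
    then have "generate K (H1 \<union> H2) \<subseteq> ?e ` carrier P.G"
      by (intro K.generate_subgroup_incl e.img_is_subgroup) auto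
    then show ?thesis
      using gen by blast
  qed
  then have "?e \<in> iso P.G K"
    using inj closed e.homh by (auto simp: iso_iff)
  then show ?thesis
    using P.iso_sym is_isoI by blast
qed

text \<open>Free indecomposability speaks of factors with the element type of \<open>K\<close>,
  whereas the natural subgroups consist of words. They are therefore pulled back along
  \<open>f\<close>.\<close>

lemma ping_pong_embedding:
  fixes K :: "'k monoid" and G :: "'g monoid" (structure)
  assumes f: "group_hom K G f" and inj: "inj_on f (carrier K)"
    and H1: "subgroup H1 G" "H1 \<subseteq> f ` carrier K" and H2: "subgroup H2 G" "H2 \<subseteq> f ` carrier K"
    and X1: "\<And>h. h \<in> H1 \<Longrightarrow> h \<noteq> \<one> \<Longrightarrow> h \<in> X1"
    and X2: "\<And>h. h \<in> H2 \<Longrightarrow> h \<noteq> \<one> \<Longrightarrow> h \<in> X2"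
    and X12: "\<And>h x. h \<in> H1 \<Longrightarrow> h \<noteq> \<one> \<Longrightarrow> x \<in> X2 \<Longrightarrow> h \<otimes> x \<in> X1"
    and X21: "\<And>h x. h \<in> H2 \<Longrightarrow> h \<noteq> \<one> \<Longrightarrow> x \<in> X1 \<Longrightarrow> h \<otimes> x \<in> X2"
    and one: "\<one> \<notin> X1" "\<one> \<notin> X2"
    and gen: "f ` carrier K \<subseteq> generate G (H1 \<union> H2)"
    and nontrivial: "H1 \<noteq> {\<one>}" "H2 \<noteq> {\<one>}"
  shows "\<not> freely_indecomposable K"
proof -
  interpret f: group_hom K G f by (rule f)
  let ?J = "\<lambda>H. {k \<in> carrier K. f k \<in> H}"
  have im: "f ` ?J H = H" if "H \<subseteq> f ` carrier K" for H
    using that by auto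
  have sub: "subgroup (?J H) K" if "subgroup H G" for H
  proof (rule subgroup.intro)
    interpret H: subgroup H G by (rule that)
    show "x \<otimes>\<^bsub>K\<^esub> y \<in> ?J H" if "x \<in> ?J H" "y \<in> ?J H" for x y
      using that by simp
    show "inv\<^bsub>K\<^esub> x \<in> ?J H" if "x \<in> ?J H" for x
      using that by simp
    show "\<one>\<^bsub>K\<^esub> \<in> ?J H"
      by simp
  qed auto
  have ne: "f k \<noteq> \<one>" if "k \<in> carrier K" "k \<noteq> \<one>\<^bsub>K\<^esub>" for k
    using that inj_onD[OF inj, of k "\<one>\<^bsub>K\<^esub>"] by auto
  have "carrier K \<subseteq> generate K (?J H1 \<union> ?J H2)"
  proof
    fix k
    assume k: "k \<in> carrier K"
    have "f ` generate K (?J H1 \<union> ?J H2) = generate G (f ` (?J H1 \<union> ?J H2))"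
      by (intro f.generate_img[symmetric]) auto
    also have "f ` (?J H1 \<union> ?J H2) = H1 \<union> H2"
      using im[OF H1(2)] im[OF H2(2)] by (simp add: image_Un)
    finally have "f k \<in> f ` generate K (?J H1 \<union> ?J H2)"
      using gen k by auto
    moreover have "generate K (?J H1 \<union> ?J H2) \<subseteq> carrier K"
      by (intro f.G.generate_incl) auto
    ultimately show "k \<in> generate K (?J H1 \<union> ?J H2)"
      using inj k by (auto dest: inj_onD)
  qed
  moreover have "group K"
    by (rule f.G.is_group)
  ultimately have "K \<cong> free_product (K\<lparr>carrier := ?J H1\<rparr>) (K\<lparr>carrier := ?J H2\<rparr>)"
    using ne one by (intro ping_pong_free_product[where ?X1.0 = "?J X1" and ?X2.0 = "?J X2"] sub H1(1) H2(1))
      (auto simp: X1 X2 X12 X21)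
  moreover have "group (K\<lparr>carrier := ?J H1\<rparr>)" "group (K\<lparr>carrier := ?J H2\<rparr>)"
    using sub H1(1) H2(1) by (auto intro: subgroup.subgroup_is_group f.G.is_group)
  moreover have "?J H1 \<noteq> {\<one>\<^bsub>K\<^esub>}" "?J H2 \<noteq> {\<one>\<^bsub>K\<^esub>}"
    using im[OF H1(2)] im[OF H2(2)] nontrivial by (metis f.hom_one image_empty image_insert)+
  then have "carrier (K\<lparr>carrier := ?J H1\<rparr>) \<noteq> {\<one>\<^bsub>K\<lparr>carrier := ?J H1\<rparr>\<^esub>}"
    "carrier (K\<lparr>carrier := ?J H2\<rparr>) \<noteq> {\<one>\<^bsub>K\<lparr>carrier := ?J H2\<rparr>\<^esub>}"
    by simp_all
  ultimately show ?thesis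
    unfolding freely_indecomposable_def by blast
qed

section \<open>Subgroups of a free product\<close>

context free_product_groups
begin

text \<open>An irreducible element is an edge \<open>p\<close> of the orbit \<open>H\<close> with no edge of the orbit between \<open>1\<close> and \<open>p\<close>.
  Removing the edges in \<open>H\<close> from the tree leaves components; the vertex groups are the stabilisers
  in \<open>H\<close> of the two components next to the edge \<open>1\<close>.\<close>

definition irreducible_in :: "('a + 'b) list set \<Rightarrow> ('a + 'b) list \<Rightarrow> bool" where
  "irreducible_in H p \<longleftrightarrow> p \<in> H \<and> p \<noteq> [] \<and> (\<forall>u v. p = u @ v \<longrightarrow> u \<in> H \<longrightarrow> u = [] \<or> v = [])"

definition vertex_group :: "('a + 'b) list set \<Rightarrow> bool \<Rightarrow> ('a + 'b) list set" where
  "vertex_group H s = insert [] {p. irreducible_in H p \<and> isl (hd p) = s \<and> isl (last p) = s}"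

lemma irreducible_inD: "irreducible_in H p \<Longrightarrow> p \<in> H" "irreducible_in H p \<Longrightarrow> p \<noteq> []"
  by (simp_all add: irreducible_in_def)

context
  fixes H assumes H: "subgroup H G"
begin

interpretation H: subgroup H G by (rule H)

lemma subgroup_W: "w \<in> H \<Longrightarrow> W w"
  using H.mem_carrier by simp

lemma subgroup_word_inv: "w \<in> H \<Longrightarrow> word_inv w \<in> H"
  using H.m_inv_closed[of w] subgroup_W inv_G by simp

text \<open>A reduced concatenation is the product of its parts, so a quotient of two elements of
  \<open>H\<close> is obtained by cutting the word.\<close>

lemma subgroup_suffix:
  assumes "u @ v \<in> H" "u \<in> H"
  shows "v \<in> H"
proof -
  have "inv\<^bsub>G\<^esub> u \<otimes>\<^bsub>G\<^esub> (u \<otimes>\<^bsub>G\<^esub> v) = v"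
    using subgroup_W[OF assms(1)] by (simp add: W_append flip: m_assoc)
  moreover have "u \<otimes>\<^bsub>G\<^esub> v = u @ v"
    by (intro mult_append subgroup_W assms(1))
  ultimately show ?thesis
    using assms H.m_closed H.m_inv_closed by (metis)
qed

lemma subgroup_prefix:
  assumes "u @ v \<in> H" "v \<in> H"
  shows "u \<in> H"
proof -
  have "(u \<otimes>\<^bsub>G\<^esub> v) \<otimes>\<^bsub>G\<^esub> inv\<^bsub>G\<^esub> v = u"
    using subgroup_W[OF assms(1)] by (simp add: W_append m_assoc)
  moreover have "u \<otimes>\<^bsub>G\<^esub> v = u @ v"
    by (intro mult_append subgroup_W assms(1))
  ultimately show ?thesis
    using assms H.m_closed H.m_inv_closed by (metis)
qed

text \<open>The path from \<open>1\<close> to \<open>w\<close> is cut at its first edge in the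
  orbit; after translation the rest is a path from \<open>1\<close> to another element of
  \<open>H\<close>.\<close>

lemma irreducible_factor:
  assumes "w \<in> H" "w \<noteq> []"
  obtains p v where "w = p @ v" "irreducible_in H p" "v \<in> H"
proof -
  have "\<exists>p v. w = p @ v \<and> irreducible_in H p \<and> v \<in> H"
    using assms
  proof (induction w rule: length_induct)
    case (1 w)
    show ?case
    proof (cases "irreducible_in H w")
      case True
      then show ?thesis
        using H.one_closed by (intro exI[of _ w] exI[of _ "[]"]) simp
    next
      case False
      then obtain u v where uv: "w = u @ v" "u \<in> H" "u \<noteq> []" "v \<noteq> []"
        using 1 by (auto simp: irreducible_in_def)
      then obtain p v' where p: "u = p @ v'" "irreducible_in H p" "v' \<in> H"
        using "1.IH" by (metis append_assoc length_append length_greater_0_conv less_add_same_cancel1)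
      have "p @ (v' @ v) \<in> H" "p \<in> H"
        using uv(1) p(1) "1.prems"(1) irreducible_inD(1)[OF p(2)] by simp_all
      then have "v' @ v \<in> H"
        by (rule subgroup_suffix)
      then show ?thesis
        using uv p by auto
    qed
  qed
  then show thesis
    using that by blast
qed

text \<open>Translation by the inverse of \<open>p\<close> maps the edges between \<open>1\<close>
  and \<open>p\<close> to those between the inverse and \<open>1\<close>, and it preserves the
  orbit.\<close>

lemma irreducible_word_inv:
  assumes "irreducible_in H p"
  shows "irreducible_in H (word_inv p)"
  unfolding irreducible_in_def
proof (intro conjI allI impI)
  have p: "p \<in> H" "p \<noteq> []"
    using assms by (auto simp: irreducible_in_def)
  show "word_inv p \<in> H" "word_inv p \<noteq> []"
    using p subgroup_word_inv by auto
  fix u v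
  assume uv: "word_inv p = u @ v" "u \<in> H"
  then have "p = word_inv v @ word_inv u"
    by (metis subgroup_W p(1) word_inv_append word_inv_inv)
  moreover from this have "word_inv v \<in> H"
    using subgroup_prefix[of "word_inv v" "word_inv u"] p(1) uv(2) subgroup_word_inv by simp
  ultimately have "word_inv v = [] \<or> word_inv u = []"
    using assms unfolding irreducible_in_def by blast
  then show "u = [] \<or> v = []"
    by auto
qed

text \<open>The edges \<open>word_inv p\<close> and \<open>q\<close> lie on the same side of the
  edge \<open>1\<close>, both adjacent to the same component left by removing the orbit. So either
  they coincide, or no edge of the orbit lies between them. In words: the letters either cancel
  completely or end in a merge.\<close>

lemma irreducible_mult:
  assumes p: "irreducible_in H p" and q: "irreducible_in H q" and pq: "isl (last p) = isl (hd q)"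
  obtains "p \<otimes>\<^bsub>G\<^esub> q = []"
  | "irreducible_in H (p \<otimes>\<^bsub>G\<^esub> q)" "isl (hd (p \<otimes>\<^bsub>G\<^esub> q)) = isl (hd p)"
    "isl (last (p \<otimes>\<^bsub>G\<^esub> q)) = isl (last q)"
proof -
  have H: "p \<in> H" "q \<in> H" "p \<noteq> []" "q \<noteq> []"
    using p q by (auto simp: irreducible_in_def)
  have no_p: "u = [] \<or> v = []" if "p = u @ v" "u \<in> H" for u v
    using p that unfolding irreducible_in_def by blast
  have no_q: "u = [] \<or> v = []" if "q = u @ v" "u \<in> H" for u v
    using q that unfolding irreducible_in_def by blast
  have W: "W p" "W q"
    using H subgroup_W by auto
  then show thesis
  proof (cases rule: mult_cases)
    case (cancel x s y)
    \<comment> \<open>If both were non-empty, then the sides alternate at the ends of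
      \<open>s\<close>, or \<open>pq\<close> applies when \<open>s\<close> is empty; in either case
      the two letters meeting in \<open>x @ y\<close> would be on the same side.\<close>
    have "x = [] \<or> y = []"
    proof (rule ccontr)
      assume *: "\<not> ?thesis"
      then have "isl (last x) \<noteq> isl (hd y)"
        using cancel(3) by (simp add: W_append)
      then show False
        using * W pq unfolding cancel(1,2) by (cases "s = []") (auto simp: W_append)
    qed
    \<comment> \<open>If one word cancels entirely, its inverse is a non-empty part of the other
      word and lies in \<open>H\<close>; irreducibility then makes it the whole word.\<close>
    then have "x = [] \<and> y = []"
    proof
      assume x: "x = []"
      then have "word_inv s \<in> H" "word_inv s \<noteq> []"
        using H cancel(1) subgroup_word_inv by auto
      then show ?thesis
        using no_q[OF cancel(2)] x by simp
    next
      assume y: "y = []"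
      then have "s = word_inv q"
        using cancel(1,2) W by (simp add: word_inv_inv W_append)
      then have "s \<in> H" "s \<noteq> []"
        using H subgroup_word_inv by auto
      moreover from this have "x \<in> H"
        using subgroup_prefix H(1) cancel(1) by blast
      ultimately show ?thesis
        using no_p[OF cancel(1)] y by simp
    qed
    then show thesis
      using that(1) cancel(4) by simp
  next
    case (merge x s y a b)
    have L: "a \<in> letters" "b \<in> letters"
      using W merge(1,2) by (auto simp: W_append W_Cons)
    let ?c = "letter_mult a b"
    have c: "isl ?c = isl a"
      using letter_mult(2)[OF L merge(3,4)] .
    have "p \<otimes>\<^bsub>G\<^esub> q \<in> H"
      using H by simp
    then have cH: "x @ [?c] @ y \<in> H"
      using merge(6) by simp
    have "irreducible_in H (x @ [?c] @ y)"
      unfolding irreducible_in_def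
    proof (intro conjI allI impI cH)
      fix u v
      assume uv: "x @ [?c] @ y = u @ v" "u \<in> H"
      \<comment> \<open>A prefix in \<open>H\<close> that ends before the merged letter is a proper
        prefix of \<open>p\<close>. Otherwise the remaining \<open>v\<close> is a suffix of
        \<open>q\<close> in \<open>H\<close>, and its complement in \<open>q\<close> is a non-empty
        prefix in \<open>H\<close>.\<close>
      consider (1) us where "x = u @ us" | (2) us where "u = x @ [?c] @ us" "y = us @ v"
        using uv(1) by (auto simp: append_eq_append_conv2 Cons_eq_append_conv)
      then show "u = [] \<or> v = []"
      proof cases
        case 1
        then show ?thesis
          using no_p[of u "us @ [a] @ s"] merge(1) uv(2) by simp
      next
        case 2
        have "v \<in> H"
          using subgroup_suffix cH uv by (metis)
        moreover have e: "q = (word_inv s @ [b] @ us) @ v"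
          using merge(2) 2(2) by simp
        ultimately have "word_inv s @ [b] @ us \<in> H"
          using subgroup_prefix H(2) by (metis)
        then show ?thesis
          using no_q[OF e] by simp
      qed
    qed simp
    moreover have "isl (hd (x @ [?c] @ y)) = isl (hd p)" "isl (last (x @ [?c] @ y)) = isl (last q)"
      using c merge(1,2,3) by (auto simp: hd_append last_append)
    ultimately show thesis
      using that(2) merge(6) by simp
  qed
qed

text \<open>Equal sides at the joint are what \<open>irreducible_mult\<close> asks for, and it
  preserves the outer sides.\<close>

lemma subgroup_vertex_group: "subgroup (vertex_group H s) G"
proof (rule subgroup.intro)
  show "vertex_group H s \<subseteq> carrier G"
    using subgroup_W by (auto simp: vertex_group_def irreducible_in_def)
  show "x \<otimes>\<^bsub>G\<^esub> y \<in> vertex_group H s" if "x \<in> vertex_group H s" "y \<in> vertex_group H s" for x y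
  proof (cases "x = [] \<or> y = []")
    case True
    moreover have "W x" "W y"
      using that subgroup_W by (auto simp: vertex_group_def irreducible_in_def)
    ultimately show ?thesis
      using that by auto
  next
    case False
    then show ?thesis
      using that irreducible_mult[of x y] by (auto simp: vertex_group_def)
  qed
  show "inv\<^bsub>G\<^esub> x \<in> vertex_group H s" if "x \<in> vertex_group H s" for x
  proof (cases "x = []")
    case False
    then have "irreducible_in H x" "isl (hd x) = s" "isl (last x) = s"
      using that by (auto simp: vertex_group_def)
    then show ?thesis
      using irreducible_word_inv[of x] subgroup_W[of x] irreducible_inD[of H x]
      by (simp add: vertex_group_def inv_G)
  qed (use inv_one in \<open>simp add: vertex_group_def\<close>)
qed (auto simp: vertex_group_def)

lemma vertex_group_subset: "vertex_group H s \<subseteq> H"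
  using H.one_closed by (auto simp: vertex_group_def irreducible_in_def)

lemma generated_by_irreducibles:
  assumes "\<And>p. irreducible_in H p \<Longrightarrow> p \<in> generate G S"
  shows "H \<subseteq> generate G S"
proof
  fix w
  assume "w \<in> H"
  then show "w \<in> generate G S"
  proof (induction w rule: length_induct)
    case (1 w)
    show ?case
    proof (cases "w = []")
      case True
      then show ?thesis
        using generate.one[of G S] by simp
    next
      case False
      then obtain p v where pv: "w = p @ v" "irreducible_in H p" "v \<in> H"
        using 1 irreducible_factor by blast
      then have "v \<in> generate G S"
        using 1 by (auto simp: irreducible_in_def)
      moreover have "w = p \<otimes>\<^bsub>G\<^esub> v"
        using pv 1 mult_append subgroup_W by (metis)
      ultimately show ?thesis
        using assms[OF pv(2)] by (simp add: generate.eng)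
    qed
  qed
qed

lemma vertex_group_mult:
  assumes "h \<in> vertex_group H s" "w \<in> H" "w = [] \<or> isl (hd w) \<noteq> s"
  shows "h \<otimes>\<^bsub>G\<^esub> w = h @ w"
proof (rule mult_append)
  show "W (h @ w)"
    using assms subgroup_W vertex_group_subset by (auto simp: W_append vertex_group_def irreducible_in_def)
qed

text \<open>Two prefixes of one word are comparable, so the first irreducible factor of an element
  of \<open>H\<close> is unique; the ping-pong sets below are told apart by it.\<close>

lemma irreducible_prefix:
  assumes "irreducible_in H p" "irreducible_in H q" "prefix p (q @ v)"
  shows "p = q"
proof -
  from assms(3) have "prefix p q \<or> prefix q p"
    by (meson prefixI prefix_same_cases)
  then show ?thesis
  proof
    assume "prefix p q"
    then obtain v where "q = p @ v"
      by (auto simp: prefix_def)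
    then show ?thesis
      using assms(1,2) unfolding irreducible_in_def by (metis append_Nil2)
  next
    assume "prefix q p"
    then obtain v where "p = q @ v"
      by (auto simp: prefix_def)
    then show ?thesis
      using assms(1,2) unfolding irreducible_in_def by (metis append_Nil2)
  qed
qed

section \<open>One orbit of vertices: \<open>t\<close> carries one end of the edge \<open>1\<close>
  to the other\<close>

context
  fixes t
  assumes t: "irreducible_in H t" and hd_t: "isl (hd t)" and last_t: "\<not> isl (last t)"
begin

lemma stable_letter_facts: "t \<in> H" "t \<noteq> []" "W t" "word_inv t \<in> H" "W (word_inv t)"
  using irreducible_inD[OF t] subgroup_W subgroup_word_inv W_word_inv by auto

lemma stable_letter_mult:
  assumes "w \<in> H" "w = [] \<or> isl (hd w)"
  shows "t \<otimes>\<^bsub>G\<^esub> w = t @ w"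
  using assms last_t stable_letter_facts subgroup_W[of w] by (intro mult_append) (auto simp: W_append)

text \<open>Every further \<open>t\<close> is simply prepended, because \<open>t\<close> begins in
  \<open>A\<close> and ends in \<open>B\<close>.\<close>

lemma stable_letter_pow:
  assumes "w \<in> H" "w = [] \<or> isl (hd w)"
  shows "\<exists>v. t [^]\<^bsub>G\<^esub> Suc n \<otimes>\<^bsub>G\<^esub> w = t @ v \<and> t @ v \<in> H"
proof (induction n)
  case 0
  then show ?case
    using stable_letter_mult[OF assms] H.m_closed[of t w] stable_letter_facts assms(1) by auto
next
  case (Suc n)
  then obtain v where v: "t [^]\<^bsub>G\<^esub> Suc n \<otimes>\<^bsub>G\<^esub> w = t @ v" "t @ v \<in> H"
    by blast
  have "t [^]\<^bsub>G\<^esub> Suc (Suc n) \<otimes>\<^bsub>G\<^esub> w = t \<otimes>\<^bsub>G\<^esub> (t [^]\<^bsub>G\<^esub> Suc n \<otimes>\<^bsub>G\<^esub> w)"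
    using stable_letter_facts subgroup_W[OF assms(1)] nat_pow_Suc2[of t "Suc n"] m_assoc[of t "t [^]\<^bsub>G\<^esub> Suc n" w]
    by (simp del: nat_pow_Suc)
  also have "\<dots> = t @ (t @ v)"
    using stable_letter_mult[OF v(2)] v(1) hd_t stable_letter_facts by simp
  finally show ?case
    using v(2) stable_letter_facts H.m_closed[of t "t @ v"] stable_letter_mult[OF v(2)] hd_t by auto
qed

lemma stable_letter_inv_mult:
  assumes "w \<in> H" "w \<noteq> []" "\<not> isl (hd w)"
  shows "word_inv t \<otimes>\<^bsub>G\<^esub> w = word_inv t @ w"
  using assms hd_t stable_letter_facts subgroup_W[of w] by (intro mult_append) (auto simp: W_append)

text \<open>The first irreducible factor \<open>p\<close> of a non-empty \<open>w\<close> differs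
  from \<open>t\<close>, so \<open>word_inv t\<close> does not cancel against it: their product is
  irreducible and begins like \<open>word_inv t\<close>, in \<open>B\<close>.\<close>

lemma stable_letter_inv_mult_prefix:
  assumes "w \<in> H" "w = [] \<or> isl (hd w)" "\<not> prefix t w"
  shows "word_inv t \<otimes>\<^bsub>G\<^esub> w \<noteq> []" "\<not> isl (hd (word_inv t \<otimes>\<^bsub>G\<^esub> w))"
proof -
  have *: "word_inv t \<otimes>\<^bsub>G\<^esub> w \<noteq> [] \<and> \<not> isl (hd (word_inv t \<otimes>\<^bsub>G\<^esub> w))"
  proof (cases "w = []")
    case True
    then show ?thesis
      using stable_letter_facts last_t by simp
  next
    case False
    then obtain p v where pv: "w = p @ v" "irreducible_in H p" "v \<in> H"
      using irreducible_factor assms(1) by blast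
    have p: "p \<noteq> []" "W p" "p \<in> H"
      using irreducible_inD[OF pv(2)] subgroup_W by auto
    have "isl (last (word_inv t)) = isl (hd p)"
      using False assms(2) pv(1) p stable_letter_facts hd_t by simp
    with irreducible_word_inv[OF t] pv(2) show ?thesis
    proof (cases rule: irreducible_mult)
      case 1
      then have "p = t"
        using inv_equality[of "word_inv t" p] p stable_letter_facts inv_G[of "word_inv t"] inv_G[of p]
        by (metis carrier_G one_G word_inv_inv)
      then show ?thesis
        using assms(3) pv(1) by simp
    next
      case 2
      let ?q = "word_inv t \<otimes>\<^bsub>G\<^esub> p"
      have "W (p @ v)"
        using subgroup_W assms(1) pv(1) by simp
      then have "W (?q @ v)"
        using 2 p stable_letter_facts by (auto simp: W_append)
      then have "?q \<otimes>\<^bsub>G\<^esub> v = ?q @ v"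
        by (rule mult_append)
      moreover have "word_inv t \<otimes>\<^bsub>G\<^esub> w = ?q \<otimes>\<^bsub>G\<^esub> v"
        using mult_append[OF \<open>W (p @ v)\<close>] pv(1) p stable_letter_facts subgroup_W[OF pv(3)]
        by (simp add: m_assoc)
      ultimately show ?thesis
        using 2 irreducible_inD[OF 2(1)] stable_letter_facts last_t by simp
    qed
  qed
  then show "word_inv t \<otimes>\<^bsub>G\<^esub> w \<noteq> []" "\<not> isl (hd (word_inv t \<otimes>\<^bsub>G\<^esub> w))"
    by auto
qed

text \<open>Only the first factor applied can interact with \<open>w\<close>; afterwards the word
  begins in \<open>B\<close> and the others are prepended.\<close>

lemma stable_letter_inv_pow:
  assumes "w \<in> H" "w = [] \<or> isl (hd w)" "\<not> prefix t w"
  shows "word_inv t [^]\<^bsub>G\<^esub> Suc n \<otimes>\<^bsub>G\<^esub> w \<in> {v \<in> H. v \<noteq> [] \<and> \<not> isl (hd v)}"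
proof (induction n)
  case 0
  then show ?case
    using stable_letter_inv_mult_prefix[OF assms] H.m_closed[of "word_inv t" w] stable_letter_facts assms(1) by auto
next
  case (Suc n)
  let ?v = "word_inv t [^]\<^bsub>G\<^esub> Suc n \<otimes>\<^bsub>G\<^esub> w"
  have "word_inv t [^]\<^bsub>G\<^esub> Suc (Suc n) \<otimes>\<^bsub>G\<^esub> w = word_inv t \<otimes>\<^bsub>G\<^esub> ?v"
    using stable_letter_facts subgroup_W[OF assms(1)] nat_pow_Suc2[of "word_inv t" "Suc n"]
      m_assoc[of "word_inv t" "word_inv t [^]\<^bsub>G\<^esub> Suc n" w]
    by (simp del: nat_pow_Suc)
  also have "\<dots> = word_inv t @ ?v"
    using stable_letter_inv_mult[of ?v] Suc by blast
  finally have e: "word_inv t [^]\<^bsub>G\<^esub> Suc (Suc n) \<otimes>\<^bsub>G\<^esub> w = word_inv t @ ?v" .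
  have "word_inv t \<otimes>\<^bsub>G\<^esub> ?v \<in> H"
    using Suc stable_letter_facts(4) by blast
  then have "word_inv t @ ?v \<in> H"
    using stable_letter_inv_mult[of ?v] Suc by force
  then show ?case
    unfolding e using stable_letter_facts last_t by (simp del: nat_pow_Suc)
qed

text \<open>This is the ping-pong move of the cyclic group generated by \<open>t\<close>. Allowing
  \<open>w = []\<close> also covers the powers themselves and shows that \<open>t\<close> has
  infinite order.\<close>

lemma stable_letter_int_pow:
  assumes "w \<in> H" "w = [] \<or> isl (hd w)" "\<not> prefix t w" "n \<noteq> (0::int)"
  shows "t [^]\<^bsub>G\<^esub> n \<otimes>\<^bsub>G\<^esub> w \<in> {w \<in> H. w \<noteq> [] \<and> (isl (hd w) \<longrightarrow> prefix t w)}"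
proof (cases n rule: int_cases3)
  case (pos m)
  then obtain k where "n = int (Suc k)"
    by (metis Suc_pred)
  then have "t [^]\<^bsub>G\<^esub> n = t [^]\<^bsub>G\<^esub> Suc k"
    by (simp only: int_pow_int)
  then show ?thesis
    using stable_letter_pow[OF assms(1,2), of k] stable_letter_facts by (auto simp del: nat_pow_Suc)
next
  case (neg m)
  then obtain k where "n = - int (Suc k)"
    by (metis Suc_pred)
  moreover have "t [^]\<^bsub>G\<^esub> (- int (Suc k)) = word_inv t [^]\<^bsub>G\<^esub> Suc k"
    using stable_letter_facts int_pow_neg_int[of t "Suc k"] inv_nat_pow[of t "Suc k"] inv_G[of t]
    by (simp del: nat_pow_Suc of_nat_Suc)
  ultimately show ?thesis
    using stable_letter_inv_pow[OF assms(1-3), of k] by (simp del: nat_pow_Suc)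
qed (use assms in simp)

lemma stable_letter_pow_ne_one: "n \<noteq> (0::int) \<Longrightarrow> t [^]\<^bsub>G\<^esub> n \<noteq> []"
  using stable_letter_int_pow[of "[]" n] H.one_closed stable_letter_facts by auto

text \<open>Irreducible elements are sorted by the sides of their ends. From \<open>A\<close> to
  \<open>A\<close> they lie in the vertex group; from \<open>A\<close> to \<open>B\<close>, right
  multiplication by \<open>word_inv t\<close> leads there; from \<open>B\<close> to \<open>A\<close>
  the inverse is taken; from \<open>B\<close> to \<open>B\<close>, left multiplication by
  \<open>t\<close> leads to the second type.\<close>

lemma irreducible_in_generate:
  assumes p: "irreducible_in H p"
  shows "p \<in> generate G (vertex_group H True \<union> generate G {t})"
proof -
  let ?S = "vertex_group H True \<union> generate G {t}"
  have sub: "subgroup (generate G ?S) G"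
    using generate_is_subgroup vertex_group_subset subgroup_W stable_letter_facts generate_incl[of "{t}"]
    by (intro generate_is_subgroup) fastforce
  interpret S: subgroup "generate G ?S" G
    by (rule sub)
  have tS: "t \<in> generate G ?S"
    by (intro generate.incl) (simp add: generate.incl)
  then have tS': "word_inv t \<in> generate G ?S"
    using S.m_inv_closed[of t] stable_letter_facts inv_G by simp
  have TF: "q \<in> generate G ?S" if q: "irreducible_in H q" "isl (hd q)" for q
  proof (cases "isl (last q)")
    case True
    then show ?thesis
      using q by (intro generate.incl) (simp add: vertex_group_def)
  next
    case False
    have W: "W q" "q \<noteq> []"
      using irreducible_inD[OF q(1)] subgroup_W by auto
    have e: "(q \<otimes>\<^bsub>G\<^esub> word_inv t) \<otimes>\<^bsub>G\<^esub> t = q"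
      using W stable_letter_facts inv_G[of t] l_inv[of t] by (simp add: m_assoc)
    have "isl (last q) = isl (hd (word_inv t))"
      using False stable_letter_facts last_t by simp
    with q(1) irreducible_word_inv[OF t] have "q \<otimes>\<^bsub>G\<^esub> word_inv t \<in> vertex_group H True"
      by (rule irreducible_mult) (use q stable_letter_facts hd_t in \<open>auto simp: vertex_group_def\<close>)
    then have "q \<otimes>\<^bsub>G\<^esub> word_inv t \<in> generate G ?S"
      by (intro generate.incl) simp
    then show ?thesis
      using S.m_closed[OF _ tS] e by metis
  qed
  have W: "W p" "p \<noteq> []" "p \<in> H"
    using irreducible_inD[OF p] subgroup_W by auto
  show ?thesis
  proof (cases "isl (hd p)")
    case True
    then show ?thesis
      using TF p by simp
  next
    case hd: False
    show ?thesis
    proof (cases "isl (last p)")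
      case True
      then have "word_inv p \<in> generate G ?S"
        using TF[OF irreducible_word_inv[OF p]] W by simp
      then show ?thesis
        using S.m_inv_closed[of "word_inv p"] W W_word_inv[of p] inv_G[of "word_inv p"]
        by (simp add: word_inv_inv)
    next
      case False
      have e: "word_inv t \<otimes>\<^bsub>G\<^esub> (t \<otimes>\<^bsub>G\<^esub> p) = p"
        using W stable_letter_facts inv_G[of t] l_inv[of t] by (simp flip: m_assoc)
      have "isl (last t) = isl (hd p)"
        using hd last_t by simp
      with t p have "t \<otimes>\<^bsub>G\<^esub> p \<in> generate G ?S"
        by (rule irreducible_mult) (use hd_t TF S.one_closed in auto)
      then show ?thesis
        using S.m_closed[OF tS'] e by metis
    qed
  qed
qed

text \<open>\<open>H\<close> is the free product of the vertex group and the infinite cyclic group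
  of \<open>t\<close>. A non-trivial vertex group contradicts indecomposability, a trivial one
  leaves only the powers of \<open>t\<close>.\<close>

lemma stable_letter_decomposition:
  assumes f: "group_hom K G f" and inj: "inj_on f (carrier K)" and H_eq: "H = f ` carrier K"
  shows "\<not> freely_indecomposable K \<or> K \<cong> integer_group"
proof (cases "vertex_group H True = {[]}")
  case False
  \<comment> \<open>\<open>?X1\<close> collects the elements whose first irreducible factor begins
    in \<open>A\<close> and is not \<open>t\<close>; \<open>?X2\<close> is its complement among the
    non-trivial elements of \<open>H\<close>.\<close>
  let ?X1 = "{w \<in> H. w \<noteq> [] \<and> isl (hd w) \<and> \<not> prefix t w}"
  let ?X2 = "{w \<in> H. w \<noteq> [] \<and> (isl (hd w) \<longrightarrow> prefix t w)}"
  have V: "irreducible_in H h" "isl (hd h)" "isl (last h)" "\<not> prefix t (h @ v)"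
    if "h \<in> vertex_group H True" "h \<noteq> []" for h v
    using that irreducible_prefix[OF t, of h v] last_t by (auto simp: vertex_group_def)
  have gt: "generate G {t} = {t [^]\<^bsub>G\<^esub> (k::int) |k. k \<in> UNIV}"
    using generate_pow[of t] stable_letter_facts by simp
  have "\<not> freely_indecomposable K"
  proof (rule ping_pong_embedding[OF f inj])
    show "subgroup (vertex_group H True) G"
      by (rule subgroup_vertex_group)
    show "vertex_group H True \<subseteq> f ` carrier K"
      using vertex_group_subset H_eq by simp
    show "subgroup (generate G {t}) G"
      using stable_letter_facts by (intro generate_is_subgroup) simp
    show "generate G {t} \<subseteq> f ` carrier K"
      unfolding H_eq[symmetric] using stable_letter_facts H by (intro generate_subgroup_incl) auto
    show "h \<in> ?X1" if "h \<in> vertex_group H True" "h \<noteq> \<one>\<^bsub>G\<^esub>" for h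
      using V(1-3)[of h] V(4)[of h "[]"] that vertex_group_subset by auto
    show "h \<in> ?X2" if "h \<in> generate G {t}" "h \<noteq> \<one>\<^bsub>G\<^esub>" for h
    proof -
      from that obtain n :: int where n: "h = t [^]\<^bsub>G\<^esub> n" "n \<noteq> 0"
        unfolding gt by force
      have "W h"
        using n stable_letter_facts int_pow_closed[of t n] by simp
      then show ?thesis
        using stable_letter_int_pow[of "[]" n] n stable_letter_facts H.one_closed by simp
    qed
    show "h \<otimes>\<^bsub>G\<^esub> x \<in> ?X2" if "h \<in> generate G {t}" "h \<noteq> \<one>\<^bsub>G\<^esub>" "x \<in> ?X1" for h x
    proof -
      from that obtain n :: int where n: "h = t [^]\<^bsub>G\<^esub> n" "n \<noteq> 0"
        unfolding gt by force
      then show ?thesis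
        using stable_letter_int_pow[of x n] that by simp
    qed
    show "h \<otimes>\<^bsub>G\<^esub> x \<in> ?X1" if h: "h \<in> vertex_group H True" "h \<noteq> \<one>\<^bsub>G\<^esub>" and x: "x \<in> ?X2" for h x
    proof -
      have h': "h \<in> H" "h \<noteq> []" "W h"
        using h vertex_group_subset subgroup_W by auto
      have hx: "h \<otimes>\<^bsub>G\<^esub> x \<in> H"
        using h' x by simp
      show ?thesis
      proof (cases "isl (hd x)")
        case False
        then have "h \<otimes>\<^bsub>G\<^esub> x = h @ x"
          using vertex_group_mult[OF h(1)] x by simp
        then show ?thesis
          using V(1-3)[of h] V(4)[of h x] h h' hx by simp
      next
        case True
        then obtain v where v: "x = t @ v"
          using x by (auto simp: prefix_def)
        have Wx: "W (t @ v)"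
          using x v subgroup_W by simp
        \<comment> \<open>Here \<open>h\<close> may cancel into \<open>t\<close>. The product is
          again irreducible from \<open>A\<close> to \<open>B\<close>; it cannot vanish, since the
          inverse of \<open>t\<close> begins in \<open>B\<close> and \<open>h\<close> in
          \<open>A\<close>. As \<open>h\<close> is non-trivial, it differs from
          \<open>t\<close>.\<close>
        have ht: "irreducible_in H (h \<otimes>\<^bsub>G\<^esub> t) \<and> isl (hd (h \<otimes>\<^bsub>G\<^esub> t)) \<and> \<not> isl (last (h \<otimes>\<^bsub>G\<^esub> t))"
        proof (rule irreducible_mult[OF V(1) t])
          show "h \<in> vertex_group H True" "h \<noteq> []" "isl (last h) = isl (hd t)"
            using h V(3)[of h] hd_t by auto
          assume "h \<otimes>\<^bsub>G\<^esub> t = []"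
          then have "inv\<^bsub>G\<^esub> t = h"
            using inv_equality[of h t] h' stable_letter_facts by simp
          then show ?thesis
            using inv_G[of t] stable_letter_facts V(2)[of h] h h' last_t by fastforce
        qed (use V(2)[of h] h last_t in auto)
        have "W ((h \<otimes>\<^bsub>G\<^esub> t) @ v)"
          using ht Wx last_t stable_letter_facts h' by (auto simp: W_append)
        then have "(h \<otimes>\<^bsub>G\<^esub> t) \<otimes>\<^bsub>G\<^esub> v = (h \<otimes>\<^bsub>G\<^esub> t) @ v"
          by (rule mult_append)
        moreover have "h \<otimes>\<^bsub>G\<^esub> x = (h \<otimes>\<^bsub>G\<^esub> t) \<otimes>\<^bsub>G\<^esub> v"
          using mult_append[OF Wx] v h' stable_letter_facts Wx by (simp add: m_assoc W_append)
        ultimately have e: "h \<otimes>\<^bsub>G\<^esub> x = (h \<otimes>\<^bsub>G\<^esub> t) @ v"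
          by simp
        moreover have "\<not> prefix t ((h \<otimes>\<^bsub>G\<^esub> t) @ v)"
        proof
          assume "prefix t ((h \<otimes>\<^bsub>G\<^esub> t) @ v)"
          then have "t = h \<otimes>\<^bsub>G\<^esub> t"
            using irreducible_prefix[OF t] ht by blast
          then show False
            using h' stable_letter_facts r_cancel_one'[of t h] by simp
        qed
        ultimately show ?thesis
          using ht hx irreducible_inD[of H "h \<otimes>\<^bsub>G\<^esub> t"] by simp
      qed
    qed
    show "f ` carrier K \<subseteq> generate G (vertex_group H True \<union> generate G {t})"
      using generated_by_irreducibles irreducible_in_generate H_eq by blast
    show "generate G {t} \<noteq> {\<one>\<^bsub>G\<^esub>}"
      using stable_letter_facts generate.incl[of t "{t}" G] by auto
  qed (use False in auto)
  then show ?thesis ..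
next
  case True
  interpret f: group_hom K G f by (rule f)
  have gt: "generate G {t} = {t [^]\<^bsub>G\<^esub> (k::int) |k. k \<in> UNIV}"
    using generate_pow[of t] stable_letter_facts by simp
  have "vertex_group H True \<union> generate G {t} = generate G {t}"
    using True generate.one[of G "{t}"] by auto
  moreover have "generate G (generate G {t}) \<subseteq> generate G {t}"
    using stable_letter_facts by (intro generate_subgroup_incl[OF subset_refl] generate_is_subgroup) simp
  ultimately have "p \<in> generate G {t}" if "irreducible_in H p" for p
    using irreducible_in_generate[OF that] by auto
  then have Ht: "H \<subseteq> generate G {t}"
    by (rule generated_by_irreducibles)
  obtain k where k: "k \<in> carrier K" "f k = t"
    using stable_letter_facts H_eq by auto
  have pow: "f (k [^]\<^bsub>K\<^esub> (n::int)) = t [^]\<^bsub>G\<^esub> n" for n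
    using f.hom_int_pow[OF k(1), of n] k(2) by simp
  have "(\<lambda>n::int. k [^]\<^bsub>K\<^esub> n) \<in> iso integer_group K"
    unfolding iso_iff
  proof (intro conjI)
    show "(\<lambda>n::int. k [^]\<^bsub>K\<^esub> n) \<in> hom integer_group K"
      using k(1) by (auto intro!: homI simp: f.G.int_pow_mult)
    show "inj_on (\<lambda>n::int. k [^]\<^bsub>K\<^esub> n) (carrier integer_group)"
    proof (rule inj_onI)
      fix m n :: int
      assume "k [^]\<^bsub>K\<^esub> m = k [^]\<^bsub>K\<^esub> n"
      then have "k [^]\<^bsub>K\<^esub> (m - n) = \<one>\<^bsub>K\<^esub>"
        using k(1) by (simp add: f.G.int_pow_diff)
      then have "t [^]\<^bsub>G\<^esub> (m - n) = []"
        using pow[of "m - n"] f.hom_one by simp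
      then show "m = n"
        using stable_letter_pow_ne_one[of "m - n"] by auto
    qed
    show "(\<lambda>n::int. k [^]\<^bsub>K\<^esub> n) ` carrier integer_group = carrier K"
    proof (intro equalityI subsetI)
      fix x
      assume x: "x \<in> carrier K"
      then have "f x \<in> generate G {t}"
        using Ht H_eq by blast
      then obtain n :: int where "f x = t [^]\<^bsub>G\<^esub> n"
        unfolding gt by blast
      then have "x = k [^]\<^bsub>K\<^esub> n"
        using pow[of n] inj_onD[OF inj] x k(1) by simp
      then show "x \<in> (\<lambda>n::int. k [^]\<^bsub>K\<^esub> n) ` carrier integer_group"
        by simp
    qed (use k(1) in auto)
  qed
  then show ?thesis
    using group.iso_sym[OF group_integer_group] is_isoI by blast
qed

end

text \<open>With two orbits of vertices, every irreducible element lies in one of the vertex groups,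
  and ping-pong is played by the side of the first letter. The word \<open>w\<close> serves only
  non-triviality: the first irreducible factors of \<open>w\<close> and of its inverse lie in the
  two vertex groups.\<close>

lemma amalgam_decomposition:
  assumes no_mixed: "\<And>p. irreducible_in H p \<Longrightarrow> isl (hd p) \<Longrightarrow> isl (last p)"
    and w: "w \<in> H" "w \<noteq> []" "isl (hd w)" "\<not> isl (last w)"
    and f: "group_hom K G f" and inj: "inj_on f (carrier K)" and H_eq: "H = f ` carrier K"
  shows "\<not> freely_indecomposable K"
proof -
  have same: "isl (hd p) = isl (last p)" if p: "irreducible_in H p" for p
    using no_mixed[OF p] no_mixed[OF irreducible_word_inv[OF p]] irreducible_inD[OF p] by auto
  let ?X = "\<lambda>s. {w \<in> H. w \<noteq> [] \<and> isl (hd w) = s}"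
  have V: "h \<otimes>\<^bsub>G\<^esub> x \<in> ?X s" if h: "h \<in> vertex_group H s" "h \<noteq> []" and x: "x \<in> H" "x = [] \<or> isl (hd x) \<noteq> s" for h x s
  proof -
    have "h \<otimes>\<^bsub>G\<^esub> x = h @ x"
      using vertex_group_mult[OF h(1) x] .
    moreover have "h \<otimes>\<^bsub>G\<^esub> x \<in> H"
      using h x vertex_group_subset by auto
    ultimately show ?thesis
      using h by (auto simp: vertex_group_def)
  qed
  have V0: "h \<in> ?X s" if "h \<in> vertex_group H s" "h \<noteq> []" for h s
  proof -
    have "h \<in> H"
      using that vertex_group_subset by blast
    then show ?thesis
      using that by (simp add: vertex_group_def)
  qed
  have nontrivial: "vertex_group H s \<noteq> {[]}" if u: "u \<in> H" "u \<noteq> []" "isl (hd u) = s" for u s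
  proof -
    obtain p v where "u = p @ v" "irreducible_in H p"
      using irreducible_factor u by blast
    then have "p \<in> vertex_group H s" "p \<noteq> []"
      using same[of p] u(3) irreducible_inD[of H p] by (auto simp: vertex_group_def)
    then show ?thesis
      by blast
  qed
  show ?thesis
  proof (rule ping_pong_embedding[OF f inj])
    show "subgroup (vertex_group H True) G" "subgroup (vertex_group H False) G"
      by (rule subgroup_vertex_group)+
    show "vertex_group H True \<subseteq> f ` carrier K" "vertex_group H False \<subseteq> f ` carrier K"
      using vertex_group_subset H_eq by auto
    show "h \<in> ?X True" if "h \<in> vertex_group H True" "h \<noteq> \<one>\<^bsub>G\<^esub>" for h
      using that V0 by simp
    show "h \<in> ?X False" if "h \<in> vertex_group H False" "h \<noteq> \<one>\<^bsub>G\<^esub>" for h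
      using that V0 by simp
    show "h \<otimes>\<^bsub>G\<^esub> x \<in> ?X True" if "h \<in> vertex_group H True" "h \<noteq> \<one>\<^bsub>G\<^esub>" "x \<in> ?X False" for h x
      using that by (intro V) auto
    show "h \<otimes>\<^bsub>G\<^esub> x \<in> ?X False" if "h \<in> vertex_group H False" "h \<noteq> \<one>\<^bsub>G\<^esub>" "x \<in> ?X True" for h x
      using that by (intro V) auto
    have "p \<in> vertex_group H True \<union> vertex_group H False" if "irreducible_in H p" for p
      using that same[OF that] by (auto simp: vertex_group_def)
    then show "f ` carrier K \<subseteq> generate G (vertex_group H True \<union> vertex_group H False)"
      unfolding H_eq[symmetric] by (intro generated_by_irreducibles generate.incl)
    show "vertex_group H True \<noteq> {\<one>\<^bsub>G\<^esub>}"
      using nontrivial[of w True] w by simp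
    show "vertex_group H False \<noteq> {\<one>\<^bsub>G\<^esub>}"
      using nontrivial[of "word_inv w" False] w subgroup_word_inv by simp
  qed auto
qed

end

text \<open>Up to rotation these are the hyperbolic elements: mixed words are cyclically reduced of even length.\<close>

definition mixed :: "('a + 'b) list \<Rightarrow> bool" where
  "mixed w \<longleftrightarrow> w \<noteq> [] \<and> isl (hd w) \<noteq> isl (last w)"

text \<open>The two preceding decompositions cover the cases whether or not an irreducible element
  leads from \<open>A\<close> to \<open>B\<close>. Passing to the inverse orients the given mixed
  element.\<close>

lemma no_mixed_element:
  assumes f: "group_hom K G f" "inj_on f (carrier K)"
    and K: "freely_indecomposable K" "\<not> K \<cong> integer_group"
    and k: "k \<in> carrier K"
  shows "\<not> mixed (f k)"
proof
  assume mixed: "mixed (f k)"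
  interpret f: group_hom K G f by (rule f)
  have H: "subgroup (f ` carrier K) G"
    using f.img_is_subgroup f.G.subgroup_self by blast
  have W: "W (f k)"
    using f.hom_closed[OF k] by simp
  obtain w where w: "w \<in> f ` carrier K" "w \<noteq> []" "isl (hd w)" "\<not> isl (last w)"
  proof (cases "isl (hd (f k))")
    case True
    then have "f k \<noteq> []" "isl (hd (f k))" "\<not> isl (last (f k))"
      using mixed by (simp_all add: mixed_def)
    then show thesis
      using that[OF imageI[OF k, of f]] by blast
  next
    case False
    then have "word_inv (f k) \<noteq> []" "isl (hd (word_inv (f k)))" "\<not> isl (last (word_inv (f k)))"
      using mixed by (simp_all add: mixed_def)
    then show thesis
      using that[OF subgroup_word_inv[OF H imageI[OF k, of f]]] by blast
  qed
  show False
  proof (cases "\<exists>t. irreducible_in (f ` carrier K) t \<and> isl (hd t) \<and> \<not> isl (last t)")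
    case True
    then show False
      using stable_letter_decomposition[OF H _ _ _ f refl] K by blast
  next
    case False
    then show False
      using amalgam_decomposition[OF H _ w f refl] K(1) by blast
  qed
qed

section \<open>Automorphisms of a free product\<close>

definition conjugate :: "('a + 'b) list \<Rightarrow> ('a + 'b) list \<Rightarrow> ('a + 'b) list" where
  "conjugate g w = g \<otimes>\<^bsub>G\<^esub> w \<otimes>\<^bsub>G\<^esub> inv\<^bsub>G\<^esub> g"

definition factor :: "bool \<Rightarrow> ('a + 'b) list set" where
  "factor s = {w. W w \<and> (w = [] \<or> (\<exists>x. w = [x] \<and> isl x = s))}"

lemma W_conjugate [simp]: "W g \<Longrightarrow> W w \<Longrightarrow> W (conjugate g w)"
  by (simp add: conjugate_def)

lemma conjugate_mult:
  assumes "W g" "W u" "W v"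
  shows "conjugate g (u \<otimes>\<^bsub>G\<^esub> v) = conjugate g u \<otimes>\<^bsub>G\<^esub> conjugate g v"
proof -
  have "conjugate g u \<otimes>\<^bsub>G\<^esub> conjugate g v = g \<otimes>\<^bsub>G\<^esub> u \<otimes>\<^bsub>G\<^esub> (inv\<^bsub>G\<^esub> g \<otimes>\<^bsub>G\<^esub> g) \<otimes>\<^bsub>G\<^esub> v \<otimes>\<^bsub>G\<^esub> inv\<^bsub>G\<^esub> g"
    unfolding conjugate_def using assms by (simp only: m_assoc m_closed inv_closed carrier_G W_mult W_inv)
  then show ?thesis
    using assms l_inv[of g] by (simp add: conjugate_def m_assoc)
qed

lemma conjugate_conjugate: "W g \<Longrightarrow> W h \<Longrightarrow> W w \<Longrightarrow> conjugate g (conjugate h w) = conjugate (g \<otimes>\<^bsub>G\<^esub> h) w"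
  by (simp add: conjugate_def inv_mult_group m_assoc)

lemma conjugate_Nil_left [simp]: "W w \<Longrightarrow> conjugate [] w = w"
  using inv_one by (simp add: conjugate_def)

lemma conjugate_Nil [simp]: "W g \<Longrightarrow> conjugate g [] = []"
  using r_inv[of g] by (simp add: conjugate_def)

lemma conjugate_inv_conjugate [simp]: "W g \<Longrightarrow> W w \<Longrightarrow> conjugate (inv\<^bsub>G\<^esub> g) (conjugate g w) = w"
  using l_inv[of g] by (simp add: conjugate_conjugate)

lemma conjugate_conjugate_inv [simp]: "W g \<Longrightarrow> W w \<Longrightarrow> conjugate g (conjugate (inv\<^bsub>G\<^esub> g) w) = w"
  using r_inv[of g] by (simp add: conjugate_conjugate)

lemma conjugate_eq_Nil [simp]: "W g \<Longrightarrow> W w \<Longrightarrow> conjugate g w = [] \<longleftrightarrow> w = []"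
  by (metis conjugate_Nil conjugate_inv_conjugate W_inv)

lemma conjugate_iso:
  assumes "W g"
  shows "conjugate g \<in> iso G G"
proof (rule isoI)
  show "conjugate g \<in> hom G G"
    using assms by (intro homI) (auto simp: conjugate_mult)
  show "bij_betw (conjugate g) (carrier G) (carrier G)"
    by (rule bij_betw_byWitness[where f' = "conjugate (inv\<^bsub>G\<^esub> g)"]) (use assms in auto)
qed

lemma letters_eq: "x \<in> letters \<longleftrightarrow> W [x]"
  by (simp add: W_Cons)

lemma subgroup_factor: "subgroup (factor s) G"
proof (rule subgroup.intro)
  show "factor s \<subseteq> carrier G" "\<one>\<^bsub>G\<^esub> \<in> factor s"
    by (auto simp: factor_def)
  show "inv\<^bsub>G\<^esub> x \<in> factor s" if "x \<in> factor s" for x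
    using that W_inv[of x] by (auto simp: factor_def inv_G)
  show "u \<otimes>\<^bsub>G\<^esub> v \<in> factor s" if uv: "u \<in> factor s" "v \<in> factor s" for u v
  proof (cases "u = [] \<or> v = []")
    case True
    then show ?thesis
      using uv by (auto simp: factor_def)
  next
    case False
    then obtain x y where xy: "u = [x]" "v = [y]" "isl x = s" "isl y = s" "x \<in> letters" "y \<in> letters"
      using uv by (auto simp: factor_def letters_eq)
    then show ?thesis
      using fp_cons_letter(2,3)[of x y "[]"] letter_mult[of x y]
      by (cases "y = letter_inv x") (auto simp: factor_def mult_G letters_eq)
  qed
qed

lemma conjugate_factor: "x \<in> factor s \<Longrightarrow> w \<in> factor s \<Longrightarrow> conjugate x w \<in> factor s"
  unfolding conjugate_def
  by (intro subgroup.m_closed[OF subgroup_factor] subgroup.m_inv_closed[OF subgroup_factor])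

lemma factor_W: "w \<in> factor s \<Longrightarrow> W w"
  by (simp add: factor_def)

text \<open>The first letter is moved to the end, where it cancels or merges with \<open>b\<close>;
  the word becomes shorter.\<close>

lemma conjugate_rotate:
  assumes "W (a # u @ [b])" "isl a = isl b"
  obtains v where "conjugate [letter_inv a] (a # u @ [b]) = u @ v" "length v \<le> 1"
proof -
  have L: "a \<in> letters" "b \<in> letters" and W: "W (u @ [b])" "W u" "W [a]" "W [letter_inv a]"
    using assms(1) by (auto simp: W_Cons W_append)
  have u: "u = [] \<or> isl (last u) \<noteq> isl b"
    using assms(1) by (auto simp: W_Cons W_append)
  have "conjugate [letter_inv a] (a # u @ [b]) = [letter_inv a] \<otimes>\<^bsub>G\<^esub> (a # u @ [b]) \<otimes>\<^bsub>G\<^esub> [a]"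
    using W L by (simp add: conjugate_def inv_G)
  also have "[letter_inv a] \<otimes>\<^bsub>G\<^esub> (a # u @ [b]) = u @ [b]"
    using fp_cons_letter(2)[of "letter_inv a"] L by (simp add: mult_G)
  also have "(u @ [b]) \<otimes>\<^bsub>G\<^esub> [a] = u \<otimes>\<^bsub>G\<^esub> fp_cons A B b [a]"
    by (simp add: mult_G)
  finally have e: "conjugate [letter_inv a] (a # u @ [b]) = u \<otimes>\<^bsub>G\<^esub> fp_cons A B b [a]" .
  show thesis
  proof (cases "a = letter_inv b")
    case True
    then show thesis
      using that[of "[]"] e W fp_cons_letter(2)[OF L(2,1), of "[]"] by simp
  next
    case False
    let ?c = "letter_mult b a"
    have c: "?c \<in> letters" "isl ?c = isl b" "fp_cons A B b [a] = [?c]"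
      using letter_mult[OF L(2,1)] fp_cons_letter(3)[OF L(2,1)] False assms(2) by simp_all
    have "u \<otimes>\<^bsub>G\<^esub> [?c] = u @ [?c]"
      using c W u by (intro mult_append) (auto simp: W_append W_Cons)
    then show thesis
      using that[of "[?c]"] e c by simp
  qed
qed

section \<open>Embedded indecomposable groups are conjugate into a factor\<close>

context
  fixes K :: "'k monoid" and f
  assumes f: "group_hom K G f" "inj_on f (carrier K)"
    and K: "freely_indecomposable K" "\<not> K \<cong> integer_group"
begin

interpretation f: group_hom K G f by (rule f)

lemma embedding_W: "k \<in> carrier K \<Longrightarrow> W (f k)"
  using f.hom_closed by simp

text \<open>A conjugate of an embedding is an embedding of the same \<open>K\<close>, so the
  previous result applies to all conjugates at once.\<close>

lemma conjugate_not_mixed: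
  assumes "W g" "k \<in> carrier K"
  shows "\<not> mixed (conjugate g (f k))"
proof -
  have c: "conjugate g \<in> hom G G" "inj_on (conjugate g) (carrier G)"
    using conjugate_iso[OF assms(1)] by (auto simp: iso_def bij_betw_def)
  have "group_hom K G (conjugate g \<circ> f)"
    using Group.hom_compose[OF f.homh c(1)] f.G.is_group is_group
    by (intro group_hom.intro group_hom_axioms.intro)
  moreover have "inj_on (conjugate g \<circ> f) (carrier K)"
    using f(2) c(2) embedding_W by (intro comp_inj_on) (auto intro: inj_on_subset)
  ultimately show ?thesis
    using no_mixed_element[OF _ _ K assms(2)] by fastforce
qed

text \<open>If the second image began on the other side, the letter \<open>x\<close> could be put in
  front of it without reduction; then either the image or this product would be mixed.\<close>

lemma conjugate_hd_side:
  assumes "W g" "k \<in> carrier K" "l \<in> carrier K" "conjugate g (f k) = [x]" "conjugate g (f l) \<noteq> []"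
  shows "isl (hd (conjugate g (f l))) = isl x"
proof (rule ccontr)
  assume ne: "\<not> ?thesis"
  let ?v = "conjugate g (f l)"
  have W: "W ?v" "W [x]"
    using assms embedding_W W_conjugate[of g "f k"] by auto
  then have "W ([x] @ ?v)"
    using ne assms(5) by (auto simp: W_Cons)
  then have "conjugate g (f (k \<otimes>\<^bsub>K\<^esub> l)) = x # ?v"
    using assms mult_append[of "[x]" ?v] embedding_W by (simp add: conjugate_mult)
  then have "\<not> mixed (x # ?v)"
    using conjugate_not_mixed[of g "k \<otimes>\<^bsub>K\<^esub> l"] assms by simp
  moreover have "\<not> mixed ?v"
    using conjugate_not_mixed assms by blast
  ultimately show False
    using ne assms(5) by (auto simp: mixed_def)
qed

text \<open>Suppose the image of \<open>l\<close> is longer than a letter. Then both its ends are on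
  the side of \<open>x\<close>, and conjugating by the inverse of its first letter keeps
  \<open>x\<close> in its factor but makes the image of \<open>l\<close> begin on the other
  side.\<close>

lemma conjugate_letter_factor:
  assumes "W g" "k \<in> carrier K" "l \<in> carrier K" "conjugate g (f k) = [x]"
  shows "conjugate g (f l) \<in> factor (isl x)"
proof (cases "conjugate g (f l)")
  case Nil
  then show ?thesis
    by (simp add: factor_def)
next
  case (Cons a w)
  have W: "W (a # w)" "W [x]"
    using assms embedding_W W_conjugate[of g "f k"] W_conjugate[of g "f l"] Cons by auto
  have a: "isl a = isl x"
    using conjugate_hd_side[OF assms] Cons by simp
  show ?thesis
  proof (cases w rule: rev_cases)
    case Nil
    then show ?thesis
      using Cons a W by (simp add: factor_def)
  next
    case (snoc u b)
    have b: "isl a = isl b"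
      using conjugate_not_mixed[OF assms(1,3)] Cons snoc by (auto simp: mixed_def)
    then have u: "u \<noteq> []" "isl (hd u) \<noteq> isl a"
      using W snoc b by (cases u; auto simp: W_Cons)+
    have La: "W [letter_inv a]"
      using W by (simp add: W_Cons)
    let ?g = "[letter_inv a] \<otimes>\<^bsub>G\<^esub> g"
    have g: "W ?g"
      using La assms(1) by simp
    obtain v where v: "conjugate [letter_inv a] (a # u @ [b]) = u @ v"
      using conjugate_rotate[of a u b] W snoc b by metis
    then have l: "conjugate ?g (f l) = u @ v"
      using conjugate_conjugate[OF La assms(1), of "f l"] assms(3) embedding_W Cons snoc by simp
    have "conjugate [letter_inv a] [x] \<in> factor (isl x)"
      using a W La by (intro conjugate_factor) (auto simp: factor_def)
    moreover have "conjugate [letter_inv a] [x] \<noteq> []"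
      using La W by simp
    ultimately obtain y where y: "conjugate [letter_inv a] [x] = [y]" "isl y = isl x"
      by (auto simp: factor_def)
    then have "conjugate ?g (f k) = [y]"
      using conjugate_conjugate[OF La assms(1), of "f k"] assms(2,4) embedding_W by simp
    then have "isl (hd (u @ v)) = isl y"
      using conjugate_hd_side[OF g assms(2,3)] l u by simp
    then show ?thesis
      using u y a by simp
  qed
qed

text \<open>Take a conjugate of the image of one non-trivial \<open>k\<close> of least length. Its
  ends are on one side, so rotation would shorten it unless it is a letter; the whole group then
  follows this letter.\<close>

lemma conjugate_into_factor:
  obtains g s where "W g" "\<And>k. k \<in> carrier K \<Longrightarrow> conjugate g (f k) \<in> factor s"
proof -
  have "carrier K \<noteq> {\<one>\<^bsub>K\<^esub>}"
    using K(1) by (simp add: freely_indecomposable_def)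
  then obtain k where k: "k \<in> carrier K" "k \<noteq> \<one>\<^bsub>K\<^esub>"
    by blast
  then have fk: "f k \<noteq> []"
    using inj_onD[OF f(2), of k "\<one>\<^bsub>K\<^esub>"] f.hom_one by auto
  obtain g where g: "W g" "\<And>h. W h \<Longrightarrow> length (conjugate g (f k)) \<le> length (conjugate h (f k))"
    using ex_has_least_nat[of W "[]" "\<lambda>g. length (conjugate g (f k))"] by auto
  obtain a w where w: "conjugate g (f k) = a # w"
    using conjugate_eq_Nil[OF g(1) embedding_W[OF k(1)]] fk by (cases "conjugate g (f k)") auto
  show thesis
  proof (cases w rule: rev_cases)
    case Nil
    then show thesis
      using that[OF g(1)] conjugate_letter_factor[OF g(1) k(1)] w by blast
  next
    case (snoc u b)
    have b: "isl a = isl b"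
      using conjugate_not_mixed[OF g(1) k(1)] w snoc by (auto simp: mixed_def)
    have W: "W (a # u @ [b])"
      using W_conjugate[OF g(1) embedding_W[OF k(1)]] w snoc by simp
    have La: "W [letter_inv a]"
      using W by (simp add: W_Cons)
    obtain v where v: "conjugate [letter_inv a] (a # u @ [b]) = u @ v" "length v \<le> 1"
      using conjugate_rotate[OF W b] .
    have "conjugate ([letter_inv a] \<otimes>\<^bsub>G\<^esub> g) (f k) = u @ v"
      using conjugate_conjugate[OF La g(1), of "f k"] k embedding_W v w snoc by simp
    then show thesis
      using g(2)[of "[letter_inv a] \<otimes>\<^bsub>G\<^esub> g"] La g(1) v(2) w snoc by simp
  qed
qed

end

section \<open>The factors as subgroups and their malnormality\<close>

lemma fp_inl_iso: "fp_inl A \<in> iso A (G\<lparr>carrier := factor True\<rparr>)"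
  unfolding iso_iff
proof (intro conjI)
  show "fp_inl A \<in> hom A (G\<lparr>carrier := factor True\<rparr>)"
    by (rule homI) (auto simp: fp_inl_def factor_def W_Cons letters_def mult_G)
  show "fp_inl A ` carrier A = carrier (G\<lparr>carrier := factor True\<rparr>)"
    by (auto simp: fp_inl_def factor_def W_Cons letters_def image_iff split: if_splits)
  show "inj_on (fp_inl A) (carrier A)"
    by (auto simp: fp_inl_def inj_on_def split: if_splits)
qed

lemma fp_inr_iso: "fp_inr B \<in> iso B (G\<lparr>carrier := factor False\<rparr>)"
  unfolding iso_iff
proof (intro conjI)
  show "fp_inr B \<in> hom B (G\<lparr>carrier := factor False\<rparr>)"
    by (rule homI) (auto simp: fp_inr_def factor_def W_Cons letters_def mult_G)
  show "fp_inr B ` carrier B = carrier (G\<lparr>carrier := factor False\<rparr>)"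
    by (auto simp: fp_inr_def factor_def W_Cons letters_def image_iff split: if_splits)
  show "inj_on (fp_inr B) (carrier B)"
    by (auto simp: fp_inr_def inj_on_def split: if_splits)
qed

lemma conjugate_letter:
  assumes "W x" "x \<noteq> []" "W [q]" "isl (last x) \<noteq> isl q"
  shows "conjugate x [q] = x @ [q] @ word_inv x"
proof -
  have W: "W (x @ [q] @ word_inv x)"
    using assms W_word_inv[of x] by (auto simp: W_append W_Cons)
  have "x \<otimes>\<^bsub>G\<^esub> [q] = x @ [q]"
    using assms by (intro mult_append) (auto simp: W_append)
  then show ?thesis
    using W mult_append[of "x @ [q]" "word_inv x"] assms by (simp add: conjugate_def inv_G)
qed

text \<open>In the tree, a non-trivial element of a factor fixes only one vertex. In words, the last
  letter of \<open>x\<close> can be absorbed into the factor if it is on side \<open>s\<close>;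
  anything left in front of it makes the conjugate longer than a letter.\<close>

lemma malnormal:
  assumes y: "y \<in> factor s" "y \<noteq> []" and x: "W x" and xy: "conjugate x y \<in> factor s'"
  shows "s' = s" "x \<in> factor s"
proof -
  obtain q where q: "y = [q]" "isl q = s" "W [q]"
    using y by (auto simp: factor_def)
  have long: "conjugate u [r] \<notin> factor s'" if "u \<noteq> []" "W u" "W [r]" "isl (last u) \<noteq> isl r" for u r
    using conjugate_letter[of u r] that by (cases u) (auto simp: factor_def)
  show x': "x \<in> factor s"
  proof (cases x rule: rev_cases)
    case (snoc u p)
    have p: "isl p = s"
      using long[of x q] snoc q x xy by auto
    have W: "W u" "W [p]" "u = [] \<or> isl (last u) \<noteq> isl p"
      using x snoc by (auto simp: W_append)
    have "conjugate [p] y \<in> factor s"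
      using y(1) p W by (intro conjugate_factor) (auto simp: factor_def)
    moreover have "conjugate [p] y \<noteq> []"
      using W q y by simp
    ultimately obtain r where r: "conjugate [p] y = [r]" "isl r = s" "W [r]"
      by (auto simp: factor_def)
    have "conjugate x y = conjugate u (conjugate [p] y)"
      using conjugate_conjugate[OF W(1,2), of y] q mult_append[of u "[p]"] x snoc by simp
    then have "u = []"
      using long[of u r] r W p xy by auto
    then show ?thesis
      using snoc p W by (simp add: factor_def)
  qed (simp add: factor_def)
  have "conjugate x y \<noteq> []"
    using x q y by simp
  then show "s' = s"
    using conjugate_factor[OF x' y(1)] xy by (auto simp: factor_def)
qed

lemma factor_nontrivial:
  assumes "freely_indecomposable A" "freely_indecomposable B"
  obtains x where "x \<in> letters" "isl x = s"
proof -
  obtain a b where "a \<in> carrier A" "a \<noteq> \<one>\<^bsub>A\<^esub>" "b \<in> carrier B" "b \<noteq> \<one>\<^bsub>B\<^esub>"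
    using assms by (auto simp: freely_indecomposable_def)
  then show thesis
    using that[of "Inl a"] that[of "Inr b"] by (cases s) (auto simp: letters_def)
qed

context
  assumes A: "freely_indecomposable A" "\<not> A \<cong> integer_group"
    and B: "freely_indecomposable B" "\<not> B \<cong> integer_group"
begin

lemma factor_image_conjugate:
  assumes "\<phi> \<in> iso G G"
  obtains g s' where "W g" "\<And>w. w \<in> factor s \<Longrightarrow> conjugate g (\<phi> w) \<in> factor s'"
proof -
  note goal = that
  have hom: "\<phi> \<in> hom G G" and inj: "inj_on \<phi> (carrier G)"
    using assms by (auto simp: iso_def bij_betw_def)
  have sub: "factor s \<subseteq> carrier G"
    using factor_W by auto
  \<comment> \<open>Stated for an arbitrary \<open>K\<close> because \<open>A\<close> and
    \<open>B\<close> have different element types.\<close>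
  have main: thesis if K: "group K" "freely_indecomposable K" "\<not> K \<cong> integer_group"
    and i: "i \<in> iso K (G\<lparr>carrier := factor s\<rparr>)" for K :: "'k monoid" and i
  proof -
    have im: "i ` carrier K = factor s" and ii: "inj_on i (carrier K)" "i \<in> hom K G"
      using i sub by (auto simp: iso_iff hom_def)
    have "group_hom K G (\<phi> \<circ> i)"
      using Group.hom_compose[OF ii(2) hom] K(1) is_group
      by (intro group_hom.intro group_hom_axioms.intro)
    moreover have "inj_on (\<phi> \<circ> i) (carrier K)"
      using ii(1) im sub inj by (intro comp_inj_on) (auto intro: inj_on_subset)
    ultimately obtain g s' where "W g" "\<And>k. k \<in> carrier K \<Longrightarrow> conjugate g ((\<phi> \<circ> i) k) \<in> factor s'"
      using conjugate_into_factor[OF _ _ K(2,3)] by blast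
    moreover have "\<exists>k\<in>carrier K. w = i k" if "w \<in> factor s" for w
      using that im by auto
    ultimately show thesis
      using goal by fastforce
  qed
  show thesis
  proof (cases s)
    case True
    then show thesis
      using main[OF A.is_group A] fp_inl_iso by simp
  next
    case False
    then show thesis
      using main[OF B.is_group B] fp_inr_iso by simp
  qed
qed

lemma letter_of_side: obtains x where "x \<in> letters" "isl x = s"
  using factor_nontrivial A(1) B(1) .

text \<open>The inverse automorphism also carries \<open>factor s'\<close> into a conjugate of a
  factor. Testing on one letter of side \<open>s\<close>, malnormality identifies this factor as
  \<open>factor s\<close> and puts the conjugator inside it.\<close>

lemma factor_image_eq:
  assumes \<chi>: "\<chi> \<in> iso G G" and sub: "\<And>w. w \<in> factor s \<Longrightarrow> \<chi> w \<in> factor s'"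
  shows "\<chi> ` factor s = factor s'"
proof (intro equalityI subsetI)
  have bij: "bij_betw \<chi> (carrier G) (carrier G)"
    using \<chi> by (simp add: iso_def)
  let ?i = "inv_into (carrier G) \<chi>"
  have inv: "?i \<in> iso G G"
    using iso_set_sym[OF \<chi>] .
  have inv1: "?i (\<chi> w) = w" if "W w" for w
    using bij that by (intro inv_into_f_f) (auto simp: bij_betw_def)
  have inv2: "\<chi> (?i w) = w" "W (?i w)" if "W w" for w
    using bij_betw_inv_into_right[OF bij, of w] bij_betwE[OF bij_betw_inv_into[OF bij]] that by auto
  obtain h s'' where h: "W h" "\<And>w. w \<in> factor s' \<Longrightarrow> conjugate h (?i w) \<in> factor s''"
    by (rule factor_image_conjugate[OF inv, where s = s']) blast
  obtain x where x: "x \<in> letters" "isl x = s"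
    using letter_of_side .
  then have x': "[x] \<in> factor s"
    by (simp add: factor_def letters_eq)
  then have "conjugate h [x] \<in> factor s''"
    using h(2)[OF sub[OF x']] inv1[of "[x]"] factor_W by simp
  then have hs: "s'' = s" "h \<in> factor s"
    using malnormal[OF x' _ h(1)] by auto
  fix v
  assume v: "v \<in> factor s'"
  have "conjugate (inv\<^bsub>G\<^esub> h) (conjugate h (?i v)) \<in> factor s"
    using h(2)[OF v] unfolding hs(1)
    by (rule conjugate_factor[OF subgroup.m_inv_closed[OF subgroup_factor hs(2)]])
  then have "?i v \<in> factor s"
    using h(1) inv2[OF factor_W[OF v]] by simp
  then show "v \<in> \<chi> ` factor s"
    using inv2(1)[OF factor_W[OF v]] by (metis imageI)
qed (use sub in auto)

lemma conjugate_comp_iso: "\<phi> \<in> iso G G \<Longrightarrow> W g \<Longrightarrow> conjugate g \<circ> \<phi> \<in> iso G G"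
  using iso_set_trans conjugate_iso by blast

lemma automorphism_simps:
  assumes "\<chi> \<in> iso G G"
  shows "W w \<Longrightarrow> W (\<chi> w)" "W u \<Longrightarrow> W v \<Longrightarrow> \<chi> (u \<otimes>\<^bsub>G\<^esub> v) = \<chi> u \<otimes>\<^bsub>G\<^esub> \<chi> v"
    "W w \<Longrightarrow> \<chi> w = [] \<longleftrightarrow> w = []" "W w \<Longrightarrow> \<exists>v. W v \<and> \<chi> v = w"
    "W u \<Longrightarrow> W v \<Longrightarrow> \<chi> u = \<chi> v \<Longrightarrow> u = v"
proof -
  have hom: "\<chi> \<in> hom G G" and inj: "inj_on \<chi> (carrier G)" and surj: "\<chi> ` carrier G = carrier G"
    using assms by (auto simp: iso_def bij_betw_def)
  show "W w \<Longrightarrow> W (\<chi> w)"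
    using hom by (auto simp: hom_def Pi_def)
  show "W u \<Longrightarrow> W v \<Longrightarrow> \<chi> (u \<otimes>\<^bsub>G\<^esub> v) = \<chi> u \<otimes>\<^bsub>G\<^esub> \<chi> v"
    using hom_mult[OF hom] by simp
  show "W w \<Longrightarrow> \<chi> w = [] \<longleftrightarrow> w = []"
    using hom_one[OF hom is_group is_group] inj_onD[OF inj, of w "[]"] by auto
  show "W w \<Longrightarrow> \<exists>v. W v \<and> \<chi> v = w"
    using surj carrier_G by (metis imageE)
  show "W u \<Longrightarrow> W v \<Longrightarrow> \<chi> u = \<chi> v \<Longrightarrow> u = v"
    using inj_onD[OF inj] by simp
qed

text \<open>The images of the letters are \<open>y\<close> or \<open>m y m\<inverse>\<close>, and concatenating them along a reduced
  word gives a reduced word. If \<open>m \<noteq> 1\<close>, no letter on the side \<open>\<not> a\<close> is in the image.\<close>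

lemma surjective_conjugator_trivial:
  assumes \<chi>: "\<chi> \<in> iso G G"
    and T: "\<And>w. w \<in> factor True \<Longrightarrow> \<chi> w \<in> factor a"
    and F: "\<And>w. w \<in> factor False \<Longrightarrow> \<exists>y\<in>factor (\<not> a). \<chi> w = conjugate m y"
    and m: "W m" "m \<noteq> [] \<Longrightarrow> isl (hd m) \<noteq> a \<and> isl (last m) = a"
  shows "m = []"
proof (rule ccontr)
  assume ne: "m \<noteq> []"
  have P: "\<chi> w \<noteq> [] \<and> (if isl (hd w) then isl (hd (\<chi> w)) = a else isl (hd (\<chi> w)) = (\<not> a) \<and> length (\<chi> w) \<ge> 3)"
    if "W w" "w \<noteq> []" for w
    using that
  proof (induction w)
    case (Cons x w)
    have W: "W [x]" "W w"
      using Cons.prems by (auto simp: W_Cons)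
    have "x # w = [x] \<otimes>\<^bsub>G\<^esub> w"
      using Cons.prems mult_append[of "[x]" w] by simp
    then have e: "\<chi> (x # w) = \<chi> [x] \<otimes>\<^bsub>G\<^esub> \<chi> w"
      using automorphism_simps(2)[OF \<chi> W] by simp
    have Ww: "W (\<chi> w)"
      using automorphism_simps(1)[OF \<chi> W(2)] .
    have hd: "\<chi> w = [] \<or> isl (hd (\<chi> w)) = (isl x \<noteq> a)"
      using Cons automorphism_simps(3)[OF \<chi>, of "[]"] by (cases "w = []") (auto simp: W_Cons split: if_splits)
    show ?case
    proof (cases "isl x")
      case True
      then have "\<chi> [x] \<in> factor a" "\<chi> [x] \<noteq> []"
        using T[of "[x]"] W automorphism_simps(3)[OF \<chi> W(1)] by (auto simp: factor_def)
      then obtain y where y: "\<chi> [x] = [y]" "isl y = a" "W [y]"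
        by (auto simp: factor_def)
      then have "W ([y] @ \<chi> w)"
        using hd True Ww by (auto simp: W_Cons)
      then have "\<chi> (x # w) = y # \<chi> w"
        using e y mult_append[of "[y]"] by simp
      then show ?thesis
        using True y by simp
    next
      case False
      then obtain u where u: "u \<in> factor (\<not> a)" "\<chi> [x] = conjugate m u"
        using F[of "[x]"] W by (auto simp: factor_def)
      moreover have "u \<noteq> []"
        using u m(1) automorphism_simps(3)[OF \<chi> W(1)] by auto
      ultimately obtain y where y: "u = [y]" "isl y = (\<not> a)" "W [y]"
        by (auto simp: factor_def)
      then have c: "\<chi> [x] = m @ [y] @ word_inv m"
        using conjugate_letter[of m y] u m ne by auto
      moreover have "isl (last (\<chi> [x])) = (\<not> a)"
        using c ne m(2) by simp
      ultimately have "W (\<chi> [x] @ \<chi> w)"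
        using automorphism_simps(1)[OF \<chi> W(1)] hd False Ww unfolding W_append by blast
      then have "\<chi> (x # w) = m @ [y] @ word_inv m @ \<chi> w"
        using e c mult_append[of "\<chi> [x]"] by simp
      moreover have "length m \<ge> 1"
        using ne by (cases m) auto
      ultimately show ?thesis
        using False ne m(2) by simp
    qed
  qed simp
  \<comment> \<open>A preimage of \<open>[r]\<close> would have to begin in \<open>B\<close> by the
    side of \<open>r\<close>, and then its image would have length at least 3.\<close>
  obtain r where r: "r \<in> letters" "isl r = (\<not> a)"
    using letter_of_side .
  then obtain w where w: "W w" "\<chi> w = [r]"
    using automorphism_simps(4)[OF \<chi>, of "[r]"] by (auto simp: letters_eq)
  then have "w \<noteq> []"
    using automorphism_simps(3)[OF \<chi>, of w] by auto
  then show False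
    using P[of w] w r by (auto split: if_splits)
qed

lemma automorphism_factors:
  assumes \<phi>: "\<phi> \<in> iso G G"
  obtains g a where "W g" "\<And>s w. w \<in> factor s \<Longrightarrow> conjugate g (\<phi> w) \<in> factor (s = a)"
proof -
  obtain g a where g: "W g" "\<And>w. w \<in> factor True \<Longrightarrow> conjugate g (\<phi> w) \<in> factor a"
    by (rule factor_image_conjugate[OF \<phi>, where s = True]) blast
  define \<chi> where "\<chi> = conjugate g \<circ> \<phi>"
  have \<chi>: "\<chi> \<in> iso G G"
    unfolding \<chi>_def using conjugate_comp_iso[OF \<phi> g(1)] .
  have T: "\<chi> w \<in> factor a" if "w \<in> factor True" for w
    using g(2)[OF that] by (simp add: \<chi>_def)
  obtain k b where k: "W k" "\<And>w. w \<in> factor False \<Longrightarrow> conjugate k (\<chi> w) \<in> factor b"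
    by (rule factor_image_conjugate[OF \<chi>, where s = False]) blast
  \<comment> \<open>Otherwise the image of a letter of \<open>B\<close> is conjugate to an element
    of the image of \<open>factor True\<close>, which is all of \<open>factor a\<close>. Pulled back
    along \<open>\<chi>\<close>, a letter of \<open>B\<close> is conjugate into \<open>A\<close>,
    against malnormality.\<close>
  have "b = (\<not> a)"
  proof (rule ccontr)
    assume "b \<noteq> (\<not> a)"
    then have ba: "b = a"
      by auto
    obtain x where x: "x \<in> letters" "isl x = False"
      using letter_of_side .
    then have x': "[x] \<in> factor False"
      by (simp add: factor_def letters_eq)
    have "conjugate k (\<chi> [x]) \<in> \<chi> ` factor True"
      using k(2)[OF x'] ba factor_image_eq[OF \<chi> T] by simp
    then obtain w where w: "w \<in> factor True" "conjugate k (\<chi> [x]) = \<chi> w"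
      by auto
    obtain k' where k': "W k'" "\<chi> k' = k"
      using automorphism_simps(4)[OF \<chi> k(1)] by blast
    have "group_hom G G \<chi>"
      using \<chi> is_group by (auto simp: iso_def intro: group_hom.intro group_hom_axioms.intro)
    then have "\<chi> (inv\<^bsub>G\<^esub> k') = inv\<^bsub>G\<^esub> k"
      using group_hom.hom_inv[of G G \<chi> k'] k' by simp
    then have "\<chi> (conjugate k' [x]) = conjugate k (\<chi> [x])"
      using k' factor_W[OF x'] by (simp add: conjugate_def automorphism_simps(2)[OF \<chi>])
    then have "\<chi> (conjugate k' [x]) = \<chi> w"
      by (rule trans[OF _ w(2)])
    then have "conjugate k' [x] = w"
      by (rule automorphism_simps(5)[OF \<chi> W_conjugate[OF k'(1) factor_W[OF x']] factor_W[OF w(1)]])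
    then show False
      using malnormal(1)[OF x' _ k'(1)] w(1) by auto
  qed
  have F: "\<exists>y\<in>factor (\<not> a). \<chi> w = conjugate (inv\<^bsub>G\<^esub> k) y" if "w \<in> factor False" for w
    using k(1) k(2)[OF that] \<open>b = (\<not> a)\<close> automorphism_simps(1)[OF \<chi> factor_W[OF that]]
    by (intro bexI[of _ "conjugate k (\<chi> w)"]) auto
  obtain p m' where p: "inv\<^bsub>G\<^esub> k = p @ m'" "p \<in> factor a" "m' = [] \<or> isl (hd m') \<noteq> a"
  proof (cases "inv\<^bsub>G\<^esub> k")
    case Nil
    then show thesis
      using that[of "[]" "[]"] by (simp add: factor_def)
  next
    case (Cons x v)
    then have "W (x # v)"
      using W_inv[OF k(1)] by simp
    then show thesis
      using that[of "[x]" v] that[of "[]" "x # v"] Cons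
      by (cases "isl x = a") (auto simp: factor_def W_Cons)
  qed
  have Wpm: "W (p @ m')"
    using p(1) W_inv[OF k(1)] by simp
  obtain m q where m: "m' = m @ q" "q \<in> factor (\<not> a)" "m = [] \<or> isl (last m) = a"
  proof (cases m' rule: rev_cases)
    case Nil
    then show thesis
      using that[of "[]" "[]"] by (simp add: factor_def)
  next
    case (snoc v x)
    then have "W (v @ [x])"
      using Wpm by (simp add: W_append)
    then show thesis
      using that[of v "[x]"] that[of "v @ [x]" "[]"] snoc
      by (cases "isl x = a") (auto simp: factor_def W_append)
  qed
  have W: "W p" "W m" "W q" "W (m @ q)" "W (inv\<^bsub>G\<^esub> p)"
    using Wpm m(1) by (auto simp: W_append)
  have decomp: "inv\<^bsub>G\<^esub> k = p \<otimes>\<^bsub>G\<^esub> (m \<otimes>\<^bsub>G\<^esub> q)"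
    using p(1) m(1) mult_append[OF W(4)] mult_append[OF Wpm] by simp
  define \<omega> where "\<omega> = conjugate (inv\<^bsub>G\<^esub> p) \<circ> \<chi>"
  have \<omega>: "\<omega> \<in> iso G G"
    unfolding \<omega>_def using conjugate_comp_iso[OF \<chi> W(5)] .
  have T': "\<omega> w \<in> factor a" if "w \<in> factor True" for w
    unfolding \<omega>_def comp_apply
    using T[OF that] p(2) by (intro conjugate_factor subgroup.m_inv_closed[OF subgroup_factor])
  have F': "\<exists>y\<in>factor (\<not> a). \<omega> w = conjugate m y" if w: "w \<in> factor False" for w
  proof -
    obtain y where y: "y \<in> factor (\<not> a)" "\<chi> w = conjugate (inv\<^bsub>G\<^esub> k) y"
      using F[OF w] by blast
    have "conjugate (inv\<^bsub>G\<^esub> k) y = conjugate p (conjugate m (conjugate q y))"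
      unfolding decomp using W factor_W[OF y(1)] by (simp add: conjugate_conjugate m_assoc)
    then have "\<omega> w = conjugate m (conjugate q y)"
      using W factor_W[OF y(1)] y(2) by (simp add: \<omega>_def)
    then show ?thesis
      using conjugate_factor[OF m(2) y(1)] by blast
  qed
  have "m \<noteq> [] \<Longrightarrow> isl (hd m) \<noteq> a \<and> isl (last m) = a"
    using p(3) m(1,3) by auto
  then have "m = []"
    using surjective_conjugator_trivial[OF \<omega> T' F' W(2)] by blast
  then have F'': "\<omega> w \<in> factor (\<not> a)" if "w \<in> factor False" for w
    using F'[OF that] factor_W by auto
  show thesis
  proof (rule that)
    show "W (inv\<^bsub>G\<^esub> p \<otimes>\<^bsub>G\<^esub> g)"
      using W g(1) by simp
    fix s w
    assume w: "w \<in> factor s"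
    have "conjugate (inv\<^bsub>G\<^esub> p \<otimes>\<^bsub>G\<^esub> g) (\<phi> w) = \<omega> w"
      using W g(1) automorphism_simps(1)[OF \<phi> factor_W[OF w]] by (simp add: \<omega>_def \<chi>_def conjugate_conjugate)
    then show "conjugate (inv\<^bsub>G\<^esub> p \<otimes>\<^bsub>G\<^esub> g) (\<phi> w) \<in> factor (s = a)"
      using w T' F'' by (cases s; cases a) auto
  qed
qed

lemma letterwise_automorphism:
  assumes \<chi>: "\<chi> \<in> iso G G" and fac: "\<And>s w. w \<in> factor s \<Longrightarrow> \<chi> w \<in> factor (s = a)"
  obtains \<rho> where "\<And>x. x \<in> letters \<Longrightarrow> isl (\<rho> x) = (isl x = a)" "inj_on \<rho> letters"
    "\<And>w. W w \<Longrightarrow> \<chi> w = map \<rho> w"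
proof -
  define \<rho> where "\<rho> x = hd (\<chi> [x])" for x
  have \<rho>: "\<chi> [x] = [\<rho> x] \<and> isl (\<rho> x) = (isl x = a)" if "x \<in> letters" for x
  proof -
    have "\<chi> [x] \<in> factor (isl x = a)" "\<chi> [x] \<noteq> []"
      using that fac[of "[x]" "isl x"] automorphism_simps(3)[OF \<chi>, of "[x]"] by (auto simp: factor_def letters_eq)
    then show ?thesis
      by (auto simp: factor_def \<rho>_def)
  qed
  have "inj_on \<rho> letters"
  proof (rule inj_onI)
    fix x y
    assume "x \<in> letters" "y \<in> letters" "\<rho> x = \<rho> y"
    then have "\<chi> [x] = \<chi> [y]" "W [x]" "W [y]"
      using \<rho> by (auto simp: letters_eq)
    then have "[x] = [y]"
      using automorphism_simps(5)[OF \<chi>] by blast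
    then show "x = y"
      by simp
  qed
  moreover have "\<chi> w = map \<rho> w" if "W w" for w
    using that
  proof (induction w)
    case Nil
    then show ?case
      using automorphism_simps(3)[OF \<chi>, of "[]"] by simp
  next
    case (Cons x w)
    have W: "W [x]" "W w" "x \<in> letters" "w = [] \<or> isl x \<noteq> isl (hd w)"
      using Cons.prems by (auto simp: W_Cons)
    have "W (\<chi> w)" "W (\<chi> [x])"
      using automorphism_simps(1)[OF \<chi>] W by auto
    moreover have "w \<noteq> [] \<Longrightarrow> hd w \<in> letters"
      using W(2) by (cases w) (auto simp: W_Cons)
    ultimately have "W ([\<rho> x] @ map \<rho> w)"
      using Cons W \<rho>[of x] \<rho>[of "hd w"] by (cases "w = []") (auto simp: W_Cons hd_map)
    then have "[\<rho> x] \<otimes>\<^bsub>G\<^esub> map \<rho> w = map \<rho> (x # w)"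
      using mult_append by simp
    moreover have "\<chi> (x # w) = \<chi> [x] \<otimes>\<^bsub>G\<^esub> \<chi> w"
      using automorphism_simps(2)[OF \<chi> W(1,2)] mult_append[of "[x]" w] Cons.prems by simp
    ultimately show ?case
      using Cons.IH W \<rho>[of x] by simp
  qed
  ultimately show thesis
    using that[of \<rho>] \<rho> by blast
qed

lemma automorphism_code_limit:
  assumes \<phi>: "\<phi> \<in> iso G G"
  obtains a where "\<And>s z w. z \<noteq> [] \<Longrightarrow> W w \<Longrightarrow> code_limit s z (\<phi> w) = code_limit (s = a) z w"
    "\<not> a \<Longrightarrow> A \<cong> B"
proof -
  obtain g a where g: "W g" "\<And>s w. w \<in> factor s \<Longrightarrow> conjugate g (\<phi> w) \<in> factor (s = a)"
    by (rule automorphism_factors[OF \<phi>]) blast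
  define \<chi> where "\<chi> = conjugate g \<circ> \<phi>"
  have \<chi>: "\<chi> \<in> iso G G"
    unfolding \<chi>_def using conjugate_comp_iso[OF \<phi> g(1)] .
  have fac: "\<chi> w \<in> factor (s = a)" if "w \<in> factor s" for w s
    using g(2)[OF that] by (simp add: \<chi>_def)
  obtain \<rho> where \<rho>: "\<And>x. x \<in> letters \<Longrightarrow> isl (\<rho> x) = (isl x = a)" "inj_on \<rho> letters"
    "\<And>w. W w \<Longrightarrow> \<chi> w = map \<rho> w"
    by (rule letterwise_automorphism[OF \<chi> fac], assumption) (rule that)
  have side: "code_difference z (side s (\<chi> w)) = code_difference z (side (s = a) w)" if "W w" for s z w
  proof -
    have "filter (\<lambda>x. isl (\<rho> x) = s) w = filter (\<lambda>x. isl x = (s = a)) w"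
      using W_letters[OF that] \<rho>(1) by (intro filter_cong) auto
    then have "side s (\<chi> w) = map \<rho> (side (s = a) w)"
      using \<rho>(3)[OF that] by (simp add: side_def filter_map o_def)
    moreover have "inj_on \<rho> (set (side (s = a) w))"
      using W_letters[OF that] set_side by (intro inj_on_subset[OF \<rho>(2)]) blast
    ultimately show ?thesis
      by (simp add: code_difference_map)
  qed
  have "code_limit s z (\<phi> w) = code_limit (s = a) z w" if z: "z \<noteq> []" and w: "W w" for s z w
  proof -
    have "group_hom G G \<chi>"
      using \<chi> is_group by (auto simp: iso_def intro: group_hom.intro group_hom_axioms.intro)
    then have "\<chi> w [^]\<^bsub>G\<^esub> n = \<chi> (w [^]\<^bsub>G\<^esub> n)" for n :: nat
      using group_hom.hom_nat_pow[of G G \<chi> w n] w by simp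
    then have "code_limit s z (\<chi> w) = code_limit (s = a) z w"
      using w automorphism_simps(1)[OF \<chi>]
      by (simp add: code_homogenisation_def homogenisation_def code_quasimorphism_eq side)
    moreover have "code_limit s z (\<chi> w) = code_limit s z (\<phi> w)"
      using code_limit_conjugate[OF z automorphism_simps(1)[OF \<phi> w] g(1)] by (simp add: \<chi>_def conjugate_def)
    ultimately show ?thesis
      by simp
  qed
  moreover have "A \<cong> B" if a: "\<not> a"
  proof -
    let ?T = "G\<lparr>carrier := factor True\<rparr>" and ?F = "G\<lparr>carrier := factor False\<rparr>"
    have "\<chi> \<in> iso ?T ?F"
      unfolding iso_iff
    proof (intro conjI)
      show "\<chi> ` carrier ?T = carrier ?F"
        using factor_image_eq[OF \<chi>, of True False] fac[of _ True] a by simp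
      then show "\<chi> \<in> hom ?T ?F"
        using automorphism_simps(2)[OF \<chi>] factor_W by (intro homI) auto
      show "inj_on \<chi> (carrier ?T)"
        using \<chi> factor_W by (auto simp: iso_def bij_betw_def intro: inj_on_subset)
    qed
    then have "A \<cong> ?F"
      by (rule is_isoI[OF iso_set_trans[OF fp_inl_iso]])
    moreover have "?F \<cong> B"
      by (rule B.iso_sym[OF is_isoI[OF fp_inr_iso]])
    ultimately show ?thesis
      by (rule iso_trans)
  qed
  ultimately show thesis
    using that by blast
qed

end

end

section \<open>Elements with prescribed code\<close>

fun alternating :: "'c \<Rightarrow> 'c \<Rightarrow> nat list \<Rightarrow> 'c list" where
  "alternating c d [] = []"
| "alternating c d (n # ns) = replicate n c @ alternating d c ns"

definition interleave :: "'c \<Rightarrow> 'c list \<Rightarrow> 'c list" where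
  "interleave b xs = concat (map (\<lambda>x. [x, b]) xs)"

lemma interleave_simps [simp]:
  "interleave b [] = []" "interleave b (x # xs) = x # b # interleave b xs"
  "interleave b (xs @ ys) = interleave b xs @ interleave b ys"
  by (simp_all add: interleave_def)

lemma alternating_append:
  "alternating c d (u @ v) =
    alternating c d u @ (if even (length u) then alternating c d v else alternating d c v)"
  by (induction u arbitrary: c d) auto

lemma rev_alternating:
  "rev (alternating c d ns) =
    (if even (length ns) then alternating d c (rev ns) else alternating c d (rev ns))"
  by (induction ns rule: rev_induct) (auto simp: alternating_append)

lemma set_alternating: "set (alternating c d ns) \<subseteq> {c, d}"
  by (induction ns arbitrary: c d) auto

lemma concat_replicate_alternating:
  "even (length u) \<Longrightarrow>
    concat (replicate n (alternating c d u)) = alternating c d (concat (replicate n u))"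
  by (induction n) (auto simp: alternating_append)

lemma run_lengths_replicate_append:
  assumes "n > 0" "xs = [] \<or> hd xs \<noteq> c"
  shows "run_lengths (replicate n c @ xs) = n # run_lengths xs"
proof -
  obtain m where n: "n = Suc m"
    using assms(1) gr0_implies_Suc by blast
  have "takeWhile (\<lambda>y. y = c) xs = []" "dropWhile (\<lambda>y. y = c) xs = xs"
    using assms(2) by (cases xs; simp)+
  then have "takeWhile (\<lambda>y. y = c) (replicate m c @ xs) = replicate m c"
    "dropWhile (\<lambda>y. y = c) (replicate m c @ xs) = xs"
    by (induction m) simp_all
  then show ?thesis
    by (simp add: n)
qed

lemma run_lengths_alternating:
  "c \<noteq> d \<Longrightarrow> \<forall>n\<in>set ns. n \<noteq> 0 \<Longrightarrow> run_lengths (alternating c d ns) = ns"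
proof (induction ns arbitrary: c d)
  case (Cons n ns)
  have "alternating d c ns = [] \<or> hd (alternating d c ns) \<noteq> c"
    using Cons.prems by (cases ns) (auto simp: hd_append)
  then show ?case
    using Cons by (simp add: run_lengths_replicate_append)
qed simp

lemma code_difference_alternating:
  assumes "c \<noteq> d" "\<forall>n\<in>set ns. n \<noteq> 0"
  shows "code_difference z (alternating c d ns) =
    real (max_disjoint_appearances z ns) - real (max_disjoint_appearances z (rev ns))"
  using assms by (simp add: code_difference_def rev_alternating run_lengths_alternating)

lemma concat_replicate_twice: "concat (replicate n (y @ y)) = concat (replicate (2 * n) y)"
  by (induction n) auto

lemma two_nontrivial_elements:
  fixes C :: "'c monoid" (structure)
  assumes C: "group C" "carrier C \<noteq> {\<one>}" "\<not> C \<cong> integer_mod_group 2"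
  obtains c d where "c \<in> carrier C" "d \<in> carrier C" "c \<noteq> \<one>" "d \<noteq> \<one>" "c \<noteq> d"
proof -
  note goal = that
  interpret group C by fact
  obtain c where c: "c \<in> carrier C" "c \<noteq> \<one>"
    using C(2) by blast
  show thesis
  proof (rule ccontr)
    assume no: "\<not> thesis"
    have only: "x = \<one> \<or> x = c" if "x \<in> carrier C" for x
      using that no c goal by blast
    have cc: "c \<otimes> c = \<one>"
      using only[of "c \<otimes> c"] c by auto
    have carrier: "carrier C = {\<one>, c}"
      using only c by auto
    let ?f = "\<lambda>x. if x = \<one> then 0 else (1::int)"
    have "?f \<in> iso C (integer_mod_group 2)"
      unfolding iso_iff
    proof (intro conjI)
      show "?f \<in> hom C (integer_mod_group 2)"
        using c cc by (intro homI) (auto simp: carrier carrier_integer_mod_group)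
      show "?f ` carrier C = carrier (integer_mod_group 2)"
        using c by (auto simp: carrier carrier_integer_mod_group image_iff)
      show "inj_on ?f (carrier C)"
        using c by (auto simp: carrier inj_on_def)
    qed
    then show False
      using C(3) is_isoI by blast
  qed
qed

definition code_family :: "nat \<Rightarrow> nat list" where
  "code_family i = [1, 2, i + 3]"

lemma generic_code_family: "generic (code_family i)"
  by (auto simp: generic_def code_family_def sublist_Cons_right prefix_Cons)

lemma code_family_not_sublist:
  assumes "i \<noteq> j"
  shows "\<not> sublist (code_family i) (concat (replicate n (code_family j)))"
    "\<not> sublist (code_family i) (rev (concat (replicate n (code_family j))))"
proof -
  have "i + 3 \<in> set (code_family i)" "i + 3 \<notin> set (concat (replicate n (code_family j)))"
    using assms by (auto simp: code_family_def)
  then show "\<not> sublist (code_family i) (concat (replicate n (code_family j)))"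
    "\<not> sublist (code_family i) (rev (concat (replicate n (code_family j))))"
    using set_mono_sublist by (metis set_rev subsetD)+
qed

section \<open>Infinite dimension\<close>

lemma quasimorphism_add:
  assumes "quasimorphism G f" "quasimorphism G h"
  shows "quasimorphism G (\<lambda>g. f g + h g)"
proof -
  obtain D E where "D \<ge> 0" "E \<ge> 0"
    and D: "\<And>x y. x \<in> carrier G \<Longrightarrow> y \<in> carrier G \<Longrightarrow> \<bar>f x + f y - f (x \<otimes>\<^bsub>G\<^esub> y)\<bar> \<le> D"
    and E: "\<And>x y. x \<in> carrier G \<Longrightarrow> y \<in> carrier G \<Longrightarrow> \<bar>h x + h y - h (x \<otimes>\<^bsub>G\<^esub> y)\<bar> \<le> E"
    using assms by (auto simp: quasimorphism_def)
  have "\<bar>(f x + h x) + (f y + h y) - (f (x \<otimes>\<^bsub>G\<^esub> y) + h (x \<otimes>\<^bsub>G\<^esub> y))\<bar> \<le> D + E"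
    if "x \<in> carrier G" "y \<in> carrier G" for x y
    using D[OF that] E[OF that] by linarith
  then show ?thesis
    unfolding quasimorphism_def using \<open>D \<ge> 0\<close> \<open>E \<ge> 0\<close> by (intro exI[of _ "D + E"]) auto
qed

lemma homogeneous_add:
  "homogeneous G f \<Longrightarrow> homogeneous G h \<Longrightarrow> homogeneous G (\<lambda>g. f g + h g)"
  by (auto simp: homogeneous_def algebra_simps)

lemma sum_fun_apply: "(\<Sum>x\<in>S. F x) y = (\<Sum>x\<in>S. F x (y::'g) :: real)"
  by (induction S rule: infinite_finite_induct) auto

lemma infinite_dimensionalI:
  fixes v :: "nat \<Rightarrow> 'g \<Rightarrow> real"
  assumes V: "\<And>i. v i \<in> V" and diag: "\<And>i. v i (g i) \<noteq> 0" and off: "\<And>i j. i \<noteq> j \<Longrightarrow> v i (g j) = 0"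
  shows "infinite_dimensional V"
  unfolding infinite_dimensional_def
proof
  assume "\<exists>S. finite S \<and> S \<subseteq> V \<and> V \<subseteq> real_fun.span S"
  then obtain S where S: "finite S" "V \<subseteq> real_fun.span S"
    by blast
  define I where "I = {..card S}"
  have inj: "inj_on v I"
    using diag off by (metis inj_onI)
  have "real_fun.independent (v ` I)"
  proof (rule real_fun.independent_if_scalars_zero)
    fix c x
    assume zero: "(\<Sum>x\<in>v ` I. (\<lambda>y. c x * x y)) = 0" and x: "x \<in> v ` I"
    then obtain j where j: "j \<in> I" "x = v j"
      by blast
    have "0 = (\<Sum>x\<in>v ` I. (\<lambda>y. c x * x y)) (g j)"
      using zero by simp
    also have "\<dots> = (\<Sum>i\<in>I. c (v i) * v i (g j))"
      unfolding sum_fun_apply by (simp add: sum.reindex[OF inj])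
    also have "\<dots> = (\<Sum>i\<in>{j}. c (v i) * v i (g j))"
      using j(1) off by (intro sum.mono_neutral_right) (auto simp: I_def)
    finally show "c x = 0"
      using diag[of j] j(2) by simp
  qed (simp add: I_def)
  then have "card (v ` I) \<le> card S"
    using real_fun.independent_span_bound[OF S(1)] V S(2) by blast
  then show False
    using card_image[OF inj] by (simp add: I_def)
qed

context free_product_groups
begin

lemma W_interleave:
  assumes "b \<in> letters" "isl b = (\<not> s)" "\<And>x. x \<in> set xs \<Longrightarrow> x \<in> letters \<and> isl x = s"
  shows "W (interleave b xs)"
  using assms(3)
proof (induction xs)
  case (Cons x xs)
  have "interleave b xs = [] \<or> isl (hd (interleave b xs)) = s"
    using Cons.prems by (cases xs) auto
  then show ?case
    using Cons assms(1,2) by (auto simp: W_Cons)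
qed simp

lemma interleave_pow:
  assumes "b \<in> letters" "isl b = (\<not> s)" "\<And>x. x \<in> set xs \<Longrightarrow> x \<in> letters \<and> isl x = s"
  shows "interleave b xs [^]\<^bsub>G\<^esub> (n::nat) = interleave b (concat (replicate n xs))"
proof (induction n)
  case (Suc n)
  have c: "concat (replicate n xs) @ xs = concat (replicate (Suc n) xs)"
    by (induction n) auto
  have "W (interleave b (concat (replicate n xs) @ xs))"
    using assms by (intro W_interleave[where s = s]) auto
  then show ?case
    using Suc mult_append unfolding c[symmetric] by simp
qed simp

lemma side_interleave:
  assumes "isl b = (\<not> s)" "\<And>x. x \<in> set xs \<Longrightarrow> isl x = s"
  shows "side s (interleave b xs) = xs" "side (\<not> s) (interleave b xs) = replicate (length xs) b"
  using assms by (induction xs) (auto simp: side_def)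

context
  fixes s b c d
  assumes b: "b \<in> letters" "isl b = (\<not> s)"
    and c: "c \<in> letters" "isl c = s" and d: "d \<in> letters" "isl d = s" and "c \<noteq> d"
begin

text \<open>Doubling \<open>z\<close> makes the number of runs even, so that powers merge no runs.\<close>

definition witness :: "nat list \<Rightarrow> ('a + 'b) list" where
  "witness z = interleave b (alternating c d (z @ z))"

lemma alternating_letters: "x \<in> set (alternating c d ns) \<Longrightarrow> x \<in> letters \<and> isl x = s"
  using set_alternating[of c d ns] c d by auto

lemma W_witness: "W (witness y)"
  unfolding witness_def by (intro W_interleave[where s = s] b alternating_letters)

lemma witness_pow:
  "witness y [^]\<^bsub>G\<^esub> (n::nat) = interleave b (alternating c d (concat (replicate (2 * n) y)))"
proof -
  have "witness y [^]\<^bsub>G\<^esub> n = interleave b (concat (replicate n (alternating c d (y @ y))))"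
    unfolding witness_def by (intro interleave_pow[where s = s] b alternating_letters)
  then show ?thesis
    by (simp add: concat_replicate_alternating concat_replicate_twice)
qed

lemma code_difference_witness:
  assumes "\<forall>n\<in>set y. n \<noteq> 0"
  shows "code_difference z (side s (witness y [^]\<^bsub>G\<^esub> (n::nat))) =
      real (max_disjoint_appearances z (concat (replicate (2 * n) y))) -
      real (max_disjoint_appearances z (rev (concat (replicate (2 * n) y))))"
    "code_difference z (side (\<not> s) (witness y [^]\<^bsub>G\<^esub> (n::nat))) = 0"
proof -
  show "code_difference z (side (\<not> s) (witness y [^]\<^bsub>G\<^esub> (n::nat))) = 0"
    unfolding witness_pow using side_interleave(2)[OF b(2)] alternating_letters
    by (simp add: code_difference_def)
  show "code_difference z (side s (witness y [^]\<^bsub>G\<^esub> (n::nat))) =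
      real (max_disjoint_appearances z (concat (replicate (2 * n) y))) -
      real (max_disjoint_appearances z (rev (concat (replicate (2 * n) y))))"
    unfolding witness_pow using side_interleave(1)[OF b(2)] alternating_letters assms
    by (subst code_difference_alternating[OF \<open>c \<noteq> d\<close>, symmetric]) auto
qed

lemma code_limit_witness_other_side:
  "generic y \<Longrightarrow> code_limit (\<not> s) z (witness y) = 0"
  by (rule code_limit_eqI[OF W_witness, where K = 0])
    (simp add: code_difference_witness(2) generic_def)

lemma code_limit_witness_ne_zero:
  assumes z: "generic z"
  shows "code_limit s z (witness z) \<noteq> 0"
proof
  assume 0: "code_limit s z (witness z) = 0"
  have z': "z \<noteq> []" "\<forall>n\<in>set z. n \<noteq> 0"
    using z by (auto simp: generic_def)
  have "\<bar>real_of_int (code_quasimorphism G (side_code s) z (witness z [^]\<^bsub>G\<^esub> (31::nat))) -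
      real 31 * code_limit s z (witness z)\<bar> \<le> 60"
    unfolding code_homogenisation_def
    by (rule homogenisation_pow[OF is_group code_quasimorphism_defect[OF z'(1)]])
      (use W_witness in auto)
  then have "\<bar>code_difference z (side s (witness z [^]\<^bsub>G\<^esub> (31::nat)))\<bar> \<le> 60"
    using 0 W_witness by (simp add: code_quasimorphism_eq)
  moreover have "code_difference z (side s (witness z [^]\<^bsub>G\<^esub> (31::nat))) \<ge> real (2 * 31)"
    unfolding code_difference_witness(1)[OF z'(2)] generic_reverse_periodic[OF z]
    using max_disjoint_appearances_concat_replicate[OF z'(1), of "2 * 31"] by linarith
  ultimately show False
    by simp
qed

lemma code_limit_witness_family:
  assumes "i \<noteq> j"
  shows "code_limit s (code_family i) (witness (code_family j)) = 0"
  using generic_code_family[of j] code_family_not_sublist[OF assms]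
  by (intro code_limit_eqI[OF W_witness, where K = 0])
    (simp add: code_difference_witness(1) generic_def max_disjoint_appearances_not_sublist)

lemma infinite_dimensional_letter_vanishing:
  assumes \<Psi>: "\<And>z. z \<noteq> [] \<Longrightarrow> quasimorphism G (\<Psi> z)" "\<And>z. z \<noteq> [] \<Longrightarrow> homogeneous G (\<Psi> z)"
      "\<And>z. z \<noteq> [] \<Longrightarrow> Aut_invariant G (\<Psi> z)"
      "\<And>z g. z \<noteq> [] \<Longrightarrow> g \<in> fp_letters A B \<Longrightarrow> \<Psi> z g = 0"
    and eq: "\<And>y z. generic y \<Longrightarrow> \<Psi> z (witness y) = code_limit s z (witness y)"
  shows "infinite_dimensional (letter_vanishing_quasimorphisms A B)"
proof (rule infinite_dimensionalI)
  fix i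
  let ?v = "\<lambda>g. if W g then \<Psi> (code_family i) g else 0"
  have ne: "code_family i \<noteq> []"
    by (simp add: code_family_def)
  have pow: "W (g [^]\<^bsub>G\<^esub> (n::int))" if "W g" for g n
    using int_pow_closed[of g n] that by simp
  have aut: "W (\<phi> g)" if "\<phi> \<in> carrier (AutoGroup G)" "W g" for \<phi> g
    using that by (auto simp: AutoGroup_def auto_def hom_def Pi_def)
  show "?v \<in> letter_vanishing_quasimorphisms A B"
    using \<Psi>[OF ne] pow aut
    by (auto simp: letter_vanishing_quasimorphisms_def quasimorphism_def homogeneous_def Aut_invariant_def)
  show "?v (witness (code_family i)) \<noteq> 0"
    using W_witness eq generic_code_family code_limit_witness_ne_zero by simp
  show "?v (witness (code_family j)) = 0" if "i \<noteq> j" for j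
    using W_witness eq generic_code_family code_limit_witness_family[OF that] by simp
qed

end

lemma code_limit_letter:
  assumes "g \<in> fp_letters A B"
  shows "code_limit s z g = 0"
proof -
  have "\<exists>t. g \<in> factor t"
    using assms fp_inl_iso fp_inr_iso by (auto simp: fp_letters_def iso_iff)
  then obtain t where t: "g \<in> factor t" ..
  have "g [^]\<^bsub>G\<^esub> n \<in> factor t" for n :: nat
    using subgroup.m_closed[OF subgroup_factor _ t] subgroup.one_closed[OF subgroup_factor, of t]
    by (induction n) auto
  moreover have "code_difference z (side s v) = 0" if "v \<in> factor t" for v
    using that by (auto simp: factor_def side_def)
  ultimately show ?thesis
    using factor_W[OF t] by (intro code_limit_eqI[where K = 0]) simp_all
qed

lemma two_letters:
  assumes "freely_indecomposable A" "freely_indecomposable B"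
    and "if s then \<not> A \<cong> integer_mod_group 2 else \<not> B \<cong> integer_mod_group 2"
  obtains c d where "c \<in> letters" "isl c = s" "d \<in> letters" "isl d = s" "c \<noteq> d"
proof (cases s)
  case True
  then obtain c d where "c \<in> carrier A" "d \<in> carrier A" "c \<noteq> \<one>\<^bsub>A\<^esub>" "d \<noteq> \<one>\<^bsub>A\<^esub>" "c \<noteq> d"
    using two_nontrivial_elements[OF A.is_group] assms by (auto simp: freely_indecomposable_def)
  then show thesis
    using that[of "Inl c" "Inl d"] True by (auto simp: letters_def)
next
  case False
  then obtain c d where "c \<in> carrier B" "d \<in> carrier B" "c \<noteq> \<one>\<^bsub>B\<^esub>" "d \<noteq> \<one>\<^bsub>B\<^esub>" "c \<noteq> d"
    using two_nontrivial_elements[OF B.is_group] assms by (auto simp: freely_indecomposable_def)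
  then show thesis
    using that[of "Inr c" "Inr d"] False by (auto simp: letters_def)
qed

context
  assumes A: "freely_indecomposable A" "\<not> A \<cong> integer_group"
    and B: "freely_indecomposable B" "\<not> B \<cong> integer_group"
begin

lemma automorphism_iso: "\<phi> \<in> carrier (AutoGroup G) \<Longrightarrow> \<phi> \<in> iso G G"
  by (auto simp: AutoGroup_def auto_def Bij_def iso_def)

lemma Aut_invariant_code_limit:
  assumes "\<not> A \<cong> B" "z \<noteq> []"
  shows "Aut_invariant G (code_limit s z)"
  unfolding Aut_invariant_def
proof (intro ballI)
  fix \<phi> g
  assume \<phi>: "\<phi> \<in> carrier (AutoGroup G)" and g: "g \<in> carrier G"
  show "code_limit s z (\<phi> g) = code_limit s z g"
  proof (rule automorphism_code_limit[OF A B automorphism_iso[OF \<phi>]])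
    fix a
    assume "\<And>s z w. z \<noteq> [] \<Longrightarrow> W w \<Longrightarrow> code_limit s z (\<phi> w) = code_limit (s = a) z w"
      and "\<not> a \<Longrightarrow> A \<cong> B"
    then show ?thesis
      using assms g by (cases a) auto
  qed
qed

lemma Aut_invariant_code_limit_sum:
  assumes "z \<noteq> []"
  shows "Aut_invariant G (\<lambda>g. code_limit True z g + code_limit False z g)"
  unfolding Aut_invariant_def
proof (intro ballI)
  fix \<phi> g
  assume \<phi>: "\<phi> \<in> carrier (AutoGroup G)" and g: "g \<in> carrier G"
  show "code_limit True z (\<phi> g) + code_limit False z (\<phi> g) = code_limit True z g + code_limit False z g"
  proof (rule automorphism_code_limit[OF A B automorphism_iso[OF \<phi>]])
    fix a
    assume "\<And>s z w. z \<noteq> [] \<Longrightarrow> W w \<Longrightarrow> code_limit s z (\<phi> w) = code_limit (s = a) z w"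
    then show ?thesis
      using assms g by (cases a) auto
  qed
qed

lemma code_limit_properties:
  assumes "\<not> A \<cong> B" "if s then \<not> A \<cong> integer_mod_group 2 else \<not> B \<cong> integer_mod_group 2"
  shows "generic z \<Longrightarrow> quasimorphism G (code_limit s z) \<and> Aut_invariant G (code_limit s z) \<and>
      unbounded_on_group G (code_limit s z)"
    and "infinite_dimensional (letter_vanishing_quasimorphisms A B)"
proof -
  obtain c d where cd: "c \<in> letters" "isl c = s" "d \<in> letters" "isl d = s" "c \<noteq> d"
    using two_letters[OF A(1) B(1) assms(2)] .
  obtain b where b: "b \<in> letters" "isl b = (\<not> s)"
    using factor_nontrivial[OF A(1) B(1)] .
  note w = b cd
  show "infinite_dimensional (letter_vanishing_quasimorphisms A B)"
    by (rule infinite_dimensional_letter_vanishing[OF w, of "code_limit s"])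
      (use quasimorphism_code_limit homogeneous_code_limit Aut_invariant_code_limit[OF assms(1)]
        code_limit_letter in auto)
  assume z: "generic z"
  then have "z \<noteq> []"
    by (simp add: generic_def)
  then show "quasimorphism G (code_limit s z) \<and> Aut_invariant G (code_limit s z) \<and>
      unbounded_on_group G (code_limit s z)"
    using quasimorphism_code_limit Aut_invariant_code_limit[OF assms(1)]
      homogeneous_unbounded[OF homogeneous_code_limit _ code_limit_witness_ne_zero[OF w z] is_group]
      W_witness[OF w] by auto
qed

lemma code_limit_sum_properties:
  fixes z
  defines "\<Psi> \<equiv> \<lambda>z g. code_limit True z g + code_limit False z g"
  assumes "\<not> A \<cong> integer_mod_group 2"
  shows "generic z \<Longrightarrow> quasimorphism G (\<Psi> z) \<and> Aut_invariant G (\<Psi> z) \<and> unbounded_on_group G (\<Psi> z)"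
    and "infinite_dimensional (letter_vanishing_quasimorphisms A B)"
proof -
  obtain c d where cd: "c \<in> letters" "isl c = True" "d \<in> letters" "isl d = True" "c \<noteq> d"
    using two_letters[OF A(1) B(1), of True] assms by auto
  obtain b where b: "b \<in> letters" "isl b = (\<not> True)"
    using factor_nontrivial[OF A(1) B(1)] .
  note w = b cd
  have quasi: "quasimorphism G (\<Psi> z)" and hom: "homogeneous G (\<Psi> z)" and aut: "Aut_invariant G (\<Psi> z)"
    if "z \<noteq> []" for z
    unfolding \<Psi>_def using that
    by (simp_all add: quasimorphism_add quasimorphism_code_limit homogeneous_add
        homogeneous_code_limit Aut_invariant_code_limit_sum)
  have eq: "\<Psi> z (witness b c d y) = code_limit True z (witness b c d y)" if "generic y" for y z
    unfolding \<Psi>_def using code_limit_witness_other_side[OF w that] by simp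
  show "infinite_dimensional (letter_vanishing_quasimorphisms A B)"
    by (rule infinite_dimensional_letter_vanishing[OF w quasi hom aut _ eq])
      (simp_all add: \<Psi>_def code_limit_letter)
  assume z: "generic z"
  then have ne: "z \<noteq> []"
    by (simp add: generic_def)
  have "\<Psi> z (witness b c d z) \<noteq> 0"
    using eq[OF z] code_limit_witness_ne_zero[OF w z] by simp
  then show "quasimorphism G (\<Psi> z) \<and> Aut_invariant G (\<Psi> z) \<and> unbounded_on_group G (\<Psi> z)"
    using quasi[OF ne] aut[OF ne] homogeneous_unbounded[OF hom[OF ne] _ _ is_group] W_witness[OF w]
    by auto
qed

end

end

theorem proposition4p11:
  fixes A :: "'a monoid" and B :: "'b monoid"
  assumes "group A" and "group B"
    and "freely_indecomposable A" and "freely_indecomposable B"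
    and "\<not> (A \<cong> integer_group)" and "\<not> (B \<cong> integer_group)"
  defines "G \<equiv> free_product A B"
  shows "(\<forall>z. generic z \<longrightarrow>
            (\<not> (A \<cong> B) \<longrightarrow>
              (\<not> (A \<cong> integer_mod_group 2) \<longrightarrow>
                 quasimorphism G (code_homogenisation G A_code z) \<and>
                 Aut_invariant G (code_homogenisation G A_code z) \<and>
                 unbounded_on_group G (code_homogenisation G A_code z)) \<and>
              (\<not> (B \<cong> integer_mod_group 2) \<longrightarrow>
                 quasimorphism G (code_homogenisation G B_code z) \<and>
                 Aut_invariant G (code_homogenisation G B_code z) \<and>
                 unbounded_on_group G (code_homogenisation G B_code z))) \<and>
            (A \<cong> B \<and> \<not> (A \<cong> integer_mod_group 2) \<longrightarrow>
               quasimorphism G (\<lambda>g. code_homogenisation G A_code z g + code_homogenisation G B_code z g) \<and>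
               Aut_invariant G (\<lambda>g. code_homogenisation G A_code z g + code_homogenisation G B_code z g) \<and>
               unbounded_on_group G (\<lambda>g. code_homogenisation G A_code z g + code_homogenisation G B_code z g)))
       \<and> (\<not> (A \<cong> B) \<or> (A \<cong> B \<and> \<not> (A \<cong> integer_mod_group 2)) \<longrightarrow>
            infinite_dimensional (letter_vanishing_quasimorphisms A B))"
proof -
  interpret P: free_product_groups A B
    using assms(1,2) by (rule free_product_groups.intro)
  note ind = assms(3,5,4,6)
  have "\<not> A \<cong> integer_mod_group 2 \<or> \<not> B \<cong> integer_mod_group 2" if "\<not> A \<cong> B"
    using that group.iso_sym[OF assms(2)] iso_trans by blast
  then have dim: "infinite_dimensional (letter_vanishing_quasimorphisms A B)"
    if "\<not> A \<cong> B \<or> A \<cong> B \<and> \<not> A \<cong> integer_mod_group 2"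
    using that P.code_limit_properties(2)[OF ind, of True] P.code_limit_properties(2)[OF ind, of False]
      P.code_limit_sum_properties(2)[OF ind] by auto
  show ?thesis
    unfolding G_def A_code_eq_side_code B_code_eq_side_code
    using P.code_limit_properties(1)[OF ind, of True] P.code_limit_properties(1)[OF ind, of False]
      P.code_limit_sum_properties(1)[OF ind] dim by simp
qed

end
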